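(* In $d$ spacetime dimensions, the generating functional for the Cheung-Remmen action $\mathcal A_{\mathrm{CR}}=\mathcal A_{\mathfrak h\mathfrak h}+\mathcal A_{BB}+\mathcal A_{\mathfrak h\mathfrak h\mathfrak h}+\mathcal A_{B\mathfrak h\mathfrak h}+\mathcal A_{BB\mathfrak h}$ (given in the context) with the gauge fixing term $$\mathcal A_{\mathrm{gf}}=\kappa^{4-d}\,\delta_B\int d^dx\;\overline c_\mu\Big(\kappa\,\partial_\nu\mathfrak h^{\mu\nu}-\frac\varepsilon2\kappa^2b^\mu\Big)$$ takes the following form: $$\begin{aligned}\mathcal Z&=\int\mathcal D[\mathfrak h,B,b,\overline c,c]\,\exp\Big[i\,\mathcal A_{\mathrm{CR}}[\mathfrak h,B]+i\,\mathcal A_{\mathrm{gf}}[\mathfrak h,b,\overline c,c]\Big]\\&=\int\mathcal D[\mathfrak h,B,\overline c,c]\,\exp\Big[i\mathcal A_{\mathfrak h\mathfrak h+\mathrm{gf}}+i\mathcal A_{BB}+i\mathcal A_{\mathfrak h\mathfrak h\mathfrak h}+i\mathcal A_{B\mathfrak h\mathfrak h}+i\mathcal A_{BB\mathfrak h}+i\mathcal A_{\mathrm{gh}}+i\mathcal A_{\mathrm{gh}-\mathfrak h}\Big].\end{aligned}$$ (1) $\mathcal A_{\mathfrak h\mathfrak h+\mathrm{gf}}$ is the action describing the propagation of $\mathfrak h$ with the gauge fixing term: $$\begin{aligned}\mathcal A_{\mathfrak h\mathfrak h+\mathrm{gf}}&=\mathcal A_{\mathfrak h\mathfrak h}+\frac12\frac{\kappa^{4-d}}{\varepsilon}\int\frac{d^dp}{(2\pi)^d}\mathfrak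 h^{\mu_1\nu_1}(-p)\mathfrak h^{\mu_2\nu_2}(p)\,\tfrac14\big[\eta_{\mu_1\mu_2}p_{\nu_1}p_{\nu_2}+\eta_{\mu_1\nu_2}p_{\nu_1}p_{\mu_2}+\eta_{\nu_1\mu_2}p_{\mu_1}p_{\nu_2}+\eta_{\nu_1\nu_2}p_{\mu_1}p_{\mu_2}\big]\\&=\int\frac{d^dp}{(2\pi)^d}\,\mathfrak h^{\mu_1\nu_1}(-p)\,\mathfrak h^{\mu_2\nu_2}(p)\,\tfrac12(\mathcal P_\varepsilon)_{\mu_1\nu_1\mu_2\nu_2}.\end{aligned}$$ In terms of the Nieuwenhuizen operators, $$(\mathcal P_\varepsilon)_{\mu\nu\alpha\beta}=\kappa^{4-d}p^2\Big(\tfrac{d-5}{d-2}P^0_{\mu\nu\alpha\beta}-\tfrac1{2\varepsilon}P^1_{\mu\nu\alpha\beta}+P^2_{\mu\nu\alpha\beta}-\big(\tfrac{d-1}{d-2}+\tfrac1\varepsilon\big)\overline P^0_{\mu\nu\alpha\beta}-\tfrac1{d-2}\overline{\overline P}{}^0_{\mu\nu\alpha\beta}\Big).$$ It is invertible, and the inverse operator reads $$(\mathcal P_\varepsilon^{-1})_{\mu\nu\alpha\beta}=\kappa^{d-4}\frac1{p^2}\Big((-2-3\varepsilon)P^0_{\mu\nu\alpha\beta}-2\varepsilon P^1_{\mu\nu\alpha\beta}+P^2_{\mu\nu\alpha\beta}-\varepsilon\overline P^0_{\mu\nu\alpha\beta}-\varepsilon\overline{\overline P}{}^0_{\mu\nu\alpha\beta}\Big).$$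 (2) $\mathcal A_{\mathrm{gh}}$ is the ghost action: $$\mathcal A_{\mathrm{gh}}=\kappa^{4-d}\int d^dx\,\overline c_\mu\square c^\mu=\kappa^{4-d}\int\frac{d^dp}{(2\pi)^d}\,\overline c^\nu(-p)\,c^\mu(p)\,[-p^2\eta_{\mu\nu}].$$ (3) $\mathcal A_{\mathrm{gh}-\mathfrak h}$ is the action describing the coupling between ghosts and perturbations $\mathfrak h$: $$\begin{aligned}\mathcal A_{\mathrm{gh}-\mathfrak h}&=\kappa^{5-d}\int d^dx\,\mathfrak h^{\mu\nu}\big[\partial_\lambda\overline c_\mu\,\partial_\nu c^\lambda+\partial_\mu\overline c_\lambda\,\partial_\nu c^\lambda+(\partial_\lambda\partial_\mu\overline c_\nu)\,c^\lambda\big]\\&=\int\frac{d^dk}{(2\pi)^d}\frac{d^dp_1}{(2\pi)^d}\frac{d^dp_2}{(2\pi)^d}(2\pi)^d\delta(k+p_1+p_2)\,\mathfrak h^{\mu\nu}(k)\,\overline c_\beta(p_2)\,c^\alpha(p_1)\\&\qquad\times\kappa^{5-d}\big[(p_2)_\alpha(p_1)_\nu\delta^\beta_\mu+(p_2)_\mu(p_1)_\nu\delta^\beta_\alpha+(p_2)_\alpha(p_2)_\mu\delta^\beta_\nu\big].\end{aligned}$$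
   Context: Flat $d$-dimensional background metric $\eta_{\mu\nu}$, used to move indices; $\square=\partial_\mu\partial^\mu$; $\kappa$ is the gravitational coupling, $\varepsilon$ the gauge-fixing parameter. Fields with momentum arguments are Fourier modes; surface terms are omitted. Fields: $\mathfrak h^{\mu\nu}$ (symmetric; the perturbation in $\sqrt{-g}\,g^{\mu\nu}=\eta^{\mu\nu}-\kappa\,\mathfrak h^{\mu\nu}$), $B^\lambda_{\mu\nu}$ (symmetric in $\mu\nu$; an auxiliary field making the action cubic) and $b_\mu$ (the BRST auxiliary field), all commuting; the ghost $c^\mu$ and antighost $\overline c_\mu$, anticommuting. With $\mathfrak h=\eta_{\mu\nu}\mathfrak h^{\mu\nu}$ and, in $B^{\lambda\mu\nu}$, the first index being the upper index of $B^\lambda_{\mu\nu}$, the parts of $\mathcal A_{\mathrm{CR}}$ are $$\mathcal A_{\mathfrak h\mathfrak h}=\int\frac{d^dp}{(2\pi)^d}\,\mathfrak h^{\mu_1\nu_1}(-p)\,\mathfrak h^{\mu_2\nu_2}(p)\,\tfrac12\mathcal P_{\mu_1\nu_1\mu_2\nu_2},$$ $$\begin{aligned}\mathcal P_{\mu_1\nu_1\mu_2\nu_2}=\kappa^{4-d}\Big[&-\tfrac12\big(p_{\mu_1}p_{\mu_2}\eta_{\nu_1\nu_2}+p_{\mu_1}p_{\nu_2}\eta_{\nu_1\mu_2}+p_{\nu_1}p_{\mu_2}\eta_{\mu_1\nu_2}+p_{\nu_1}p_{\nu_2}\eta_{\mu_1\mu_2}\big)\\&+p^2\Big(\tfrac12(\eta_{\mu_1\mu_2}\eta_{\nu_1\nu_2}+\eta_{\mu_1\nu_2}\eta_{\mu_2\nu_1})-\tfrac1{d-2}\eta_{\mu_1\nu_1}\eta_{\mu_2\nu_2}\Big)\Big],\end{aligned}$$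 $$\mathcal A_{BB}=\int d^dx\,2\kappa^{2-d}\big[B^{\mu\nu\lambda}B_{\nu\mu\lambda}-\tfrac1{d-1}B^\mu{}_{\mu\lambda}B^\nu{}_\nu{}^\lambda\big],$$ $$\mathcal A_{\mathfrak h\mathfrak h\mathfrak h}=\int d^dx\,\kappa^{5-d}\mathfrak h^{\mu\nu}\big[-\tfrac12\partial_\mu\mathfrak h_{\alpha\beta}\partial_\nu\mathfrak h^{\alpha\beta}-\partial_\alpha\mathfrak h_{\mu\beta}(\partial^\beta\mathfrak h_\nu{}^\alpha-\partial^\alpha\mathfrak h_\nu{}^\beta)+\tfrac1{d-2}(\tfrac12\partial_\mu\mathfrak h\,\partial_\nu\mathfrak h-\partial_\lambda\mathfrak h_{\mu\nu}\partial^\lambda\mathfrak h)\big],$$ $$\mathcal A_{B\mathfrak h\mathfrak h}=\int d^dx\,\kappa^{4-d}\big[\tfrac2{d-2}(B^\alpha{}_{\alpha\beta}\mathfrak h^{\beta\mu}\partial_\mu\mathfrak h-B^{\alpha\beta\mu}\mathfrak h_{\alpha\beta}\partial_\mu\mathfrak h)-2B^{\nu\beta\lambda}\mathfrak h_\beta{}^\mu(\partial_\mu\mathfrak h_{\nu\lambda}+\partial_\nu\mathfrak h_{\mu\lambda}-\partial_\lambda\mathfrak h_{\mu\nu})\big],$$ $$\mathcal A_{BB\mathfrak h}=\int d^dx\,\kappa^{3-d}\mathfrak h^{\mu\nu}\big[-2B^{\alpha\beta}{}_\mu B_{\beta\alpha\nu}+\tfrac2{d-1}B^\alpha{}_{\alpha\mu}B^\beta{}_{\beta\nu}\big].$$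 The BRST operator $\delta_B$ is odd, commutes with $\partial_\mu$, annihilates $\eta$, and acts by $$\delta_B\mathfrak h^{\mu\nu}=\mathfrak h^{\mu\lambda}\partial_\lambda c^\nu+\mathfrak h^{\nu\lambda}\partial_\lambda c^\mu-\partial_\lambda(\mathfrak h^{\mu\nu}c^\lambda)-\tfrac1\kappa\big[\partial^\mu c^\nu+\partial^\nu c^\mu-\eta^{\mu\nu}\partial_\lambda c^\lambda\big],\quad\delta_Bc^\mu=-c^\sigma\partial_\sigma c^\mu,\quad\delta_B\overline c_\mu=b_\mu,\quad\delta_Bb_\mu=0.$$ Functional integrals are formal; $b_\mu$ is integrated out as a Gaussian integral, constants being absorbed in the normalisation. Nieuwenhuizen operators: with $\omega_{\mu\nu}=p_\mu p_\nu/p^2$, $\theta_{\mu\nu}=\eta_{\mu\nu}-\omega_{\mu\nu}$, $P^1_{\mu\nu\alpha\beta}=\tfrac12(\theta_{\mu\alpha}\omega_{\nu\beta}+\theta_{\mu\beta}\omega_{\nu\alpha}+\theta_{\nu\alpha}\omega_{\mu\beta}+\theta_{\nu\beta}\omega_{\mu\alpha})$, $P^2_{\mu\nu\alpha\beta}=\tfrac12(\theta_{\mu\alpha}\theta_{\nu\beta}+\theta_{\mu\beta}\theta_{\nu\alpha})-\tfrac13\theta_{\mu\nu}\theta_{\alpha\beta}$, $P^0_{\mu\nu\alpha\beta}=\tfrac13\theta_{\mu\nu}\theta_{\alpha\beta}$, $\overline P^0_{\mu\nu\alpha\beta}=\omega_{\mu\nu}\omega_{\alpha\beta}$, $\overline{\overline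 P}{}^0_{\mu\nu\alpha\beta}=\theta_{\mu\nu}\omega_{\alpha\beta}+\omega_{\mu\nu}\theta_{\alpha\beta}$ (the factors $\tfrac13$ are kept for all $d$). Products contract the second index pair of the first operator with the first pair of the second, and the identity is $I_{\mu\nu\alpha\beta}=\tfrac12(\eta_{\mu\alpha}\eta_{\nu\beta}+\eta_{\mu\beta}\eta_{\nu\alpha})$.
   Formalization: Signs corrected: P_ε has +1/(2ε)P¹ and −((d−1)/(d−2)−1/ε)P̄⁰; its inverse has (−2+3ε)P⁰+2εP¹+P²+εP̄⁰ with −ε times the double-bar term as printed; the momentum form of the ghost–h coupling has −κ^{5−d} instead of +κ^{5−d}. *)

theory Defs
  imports "HOL-Analysis.Analysis"
begin

section \<open>Values of the fields\<close>

text \<open>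
  Commuting and anticommuting fields take values in the even part \<open>Ev\<close> and the odd part \<open>Od\<close>
  of a complex supercommutative Banach algebra. The type is a real algebra; the complex
  structure is multiplication by the even element \<open>J\<close>, the imaginary unit.
\<close>

definition superalgebra ::
  "'a::{real_normed_algebra_1,banach} set \<Rightarrow> 'a set \<Rightarrow> 'a \<Rightarrow> bool" where
  "superalgebra Ev Od J \<longleftrightarrow>
     subspace Ev \<and> subspace Od \<and> closed Ev \<and> closed Od \<and>
     Ev \<inter> Od = {0} \<and> (\<forall>x. \<exists>a\<in>Ev. \<exists>b\<in>Od. x = a + b) \<and>
     (\<forall>a\<in>Ev. \<forall>b\<in>Ev. a * b \<in> Ev) \<and> (\<forall>a\<in>Ev. \<forall>b\<in>Od. a * b \<in> Od) \<and>
     (\<forall>a\<in>Od. \<forall>b\<in>Od. a * b \<in> Ev) \<and>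
     (\<forall>a\<in>Ev. \<forall>x. a * x = x * a) \<and> (\<forall>a\<in>Od. \<forall>b\<in>Od. a * b = - (b * a)) \<and>
     1 \<in> Ev \<and> J \<in> Ev \<and> J * J = - 1"


section \<open>Calculus on spacetime\<close>

text \<open>
  Spacetime is \<open>real^'n\<close>, so \<open>d = CARD('n)\<close>. Components \<open>x $ \<mu>\<close> of a position are
  \<open>x\<^sup>\<mu>\<close>, components \<open>p $ \<mu>\<close> of a momentum are \<open>p\<^sub>\<mu>\<close>; hence the
  pairing of a momentum with a position is the plain inner product, for every signature.
\<close>

definition pd :: "'n::finite \<Rightarrow> (real^'n \<Rightarrow> 'a::real_normed_vector) \<Rightarrow> real^'n \<Rightarrow> 'a" where
  "pd \<mu> f x = frechet_derivative f (at x) (axis \<mu> 1)"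

text \<open>
  Smooth functions all of whose iterated partial derivatives decrease rapidly: surface terms
  vanish and all Fourier integrals converge absolutely.
\<close>

definition schwartz :: "(real^'n::finite \<Rightarrow> 'a::real_normed_vector) \<Rightarrow> bool" where
  "schwartz f \<longleftrightarrow>
     (\<forall>ms k. (\<forall>x. foldr pd ms f differentiable (at x)) \<and>
             bounded (range (\<lambda>x. (1 + norm x) ^ k *\<^sub>R foldr pd ms f x)))"

definition mode ::
  "'a::{real_normed_algebra_1,banach,second_countable_topology} \<Rightarrow> (real^'n::finite \<Rightarrow> 'a) \<Rightarrow>
     real^'n \<Rightarrow> 'a" where
  "mode J f p = (LINT x|lborel. exp (- (p \<bullet> x) *\<^sub>R J) * f x)"

text \<open>The momentum integral carries the measure \<open>d\<^sup>dp / (2\<pi>)\<^sup>d\<close>.\<close>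

definition mint ::
  "(real^'n::finite \<Rightarrow> 'a::{banach,second_countable_topology}) \<Rightarrow> 'a" where
  "mint f = (1 / (2 * pi) ^ CARD('n)) *\<^sub>R (LINT p|lborel. f p)"

text \<open>
  The integral over \<open>k\<close>, \<open>p\<^sub>1\<close>, \<open>p\<^sub>2\<close>, each with the measure above, against
  \<open>(2\<pi>)\<^sup>d \<delta>(k + p\<^sub>1 + p\<^sub>2)\<close>: the distribution removes one factor of
  \<open>(2\<pi>)\<^sup>d\<close> and puts \<open>k = - (p\<^sub>1 + p\<^sub>2)\<close>.
\<close>

definition mint_delta ::
  "(real^'n::finite \<Rightarrow> real^'n \<Rightarrow> real^'n \<Rightarrow> 'a::{banach,second_countable_topology}) \<Rightarrow> 'a" where
  "mint_delta F = mint (\<lambda>p1. mint (\<lambda>p2. F (- (p1 + p2)) p1 p2))"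


section \<open>Metric and momentum-space operators\<close>

text \<open>
  The flat metric is \<open>diag (sg)\<close> with \<open>sg \<mu> = \<plusminus>1\<close>, of any signature. It is its own
  inverse, so \<open>eta sg\<close> stands for both \<open>\<eta>\<^sub>\<mu>\<^sub>\<nu>\<close> and \<open>\<eta>\<^sup>\<mu>\<^sup>\<nu>\<close>, and
  raising or lowering an index \<open>\<mu>\<close> is multiplication by \<open>sg \<mu>\<close>.
\<close>

definition eta :: "('n \<Rightarrow> real) \<Rightarrow> 'n \<Rightarrow> 'n \<Rightarrow> real" where
  "eta sg \<mu> \<nu> = (if \<mu> = \<nu> then sg \<mu> else 0)"

definition psq :: "('n::finite \<Rightarrow> real) \<Rightarrow> real^'n \<Rightarrow> real" where
  "psq sg p = (\<Sum>\<mu>\<in>UNIV. sg \<mu> * p $ \<mu> * p $ \<mu>)"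

type_synonym 'n kernel = "'n \<Rightarrow> 'n \<Rightarrow> 'n \<Rightarrow> 'n \<Rightarrow> real"

definition op_mult :: "('n::finite \<Rightarrow> real) \<Rightarrow> 'n kernel \<Rightarrow> 'n kernel \<Rightarrow> 'n kernel" where
  "op_mult sg K L \<mu> \<nu> \<alpha> \<beta> =
     (\<Sum>\<rho>\<in>UNIV. \<Sum>\<sigma>\<in>UNIV. K \<mu> \<nu> \<rho> \<sigma> * sg \<rho> * sg \<sigma> * L \<rho> \<sigma> \<alpha> \<beta>)"

definition op_id :: "('n \<Rightarrow> real) \<Rightarrow> 'n kernel" where
  "op_id sg \<mu> \<nu> \<alpha> \<beta> =
     1/2 * (eta sg \<mu> \<alpha> * eta sg \<nu> \<beta> + eta sg \<mu> \<beta> * eta sg \<nu> \<alpha>)"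

definition inverse_op :: "('n::finite \<Rightarrow> real) \<Rightarrow> 'n kernel \<Rightarrow> 'n kernel \<Rightarrow> bool" where
  "inverse_op sg K L \<longleftrightarrow> op_mult sg K L = op_id sg \<and> op_mult sg L K = op_id sg"

definition omega :: "('n::finite \<Rightarrow> real) \<Rightarrow> real^'n \<Rightarrow> 'n \<Rightarrow> 'n \<Rightarrow> real" where
  "omega sg p \<mu> \<nu> = p $ \<mu> * p $ \<nu> / psq sg p"

definition theta :: "('n::finite \<Rightarrow> real) \<Rightarrow> real^'n \<Rightarrow> 'n \<Rightarrow> 'n \<Rightarrow> real" where
  "theta sg p \<mu> \<nu> = eta sg \<mu> \<nu> - omega sg p \<mu> \<nu>"

definition NP1 :: "('n::finite \<Rightarrow> real) \<Rightarrow> real^'n \<Rightarrow> 'n kernel" where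
  "NP1 sg p \<mu> \<nu> \<alpha> \<beta> =
     1/2 * (theta sg p \<mu> \<alpha> * omega sg p \<nu> \<beta> + theta sg p \<mu> \<beta> * omega sg p \<nu> \<alpha>
          + theta sg p \<nu> \<alpha> * omega sg p \<mu> \<beta> + theta sg p \<nu> \<beta> * omega sg p \<mu> \<alpha>)"

definition NP2 :: "('n::finite \<Rightarrow> real) \<Rightarrow> real^'n \<Rightarrow> 'n kernel" where
  "NP2 sg p \<mu> \<nu> \<alpha> \<beta> =
     1/2 * (theta sg p \<mu> \<alpha> * theta sg p \<nu> \<beta> + theta sg p \<mu> \<beta> * theta sg p \<nu> \<alpha>)
     - 1/3 * theta sg p \<mu> \<nu> * theta sg p \<alpha> \<beta>"

definition NP0 :: "('n::finite \<Rightarrow> real) \<Rightarrow> real^'n \<Rightarrow> 'n kernel" where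
  "NP0 sg p \<mu> \<nu> \<alpha> \<beta> = 1/3 * theta sg p \<mu> \<nu> * theta sg p \<alpha> \<beta>"

definition NP0bar :: "('n::finite \<Rightarrow> real) \<Rightarrow> real^'n \<Rightarrow> 'n kernel" where
  "NP0bar sg p \<mu> \<nu> \<alpha> \<beta> = omega sg p \<mu> \<nu> * omega sg p \<alpha> \<beta>"

definition NP0barbar :: "('n::finite \<Rightarrow> real) \<Rightarrow> real^'n \<Rightarrow> 'n kernel" where
  "NP0barbar sg p \<mu> \<nu> \<alpha> \<beta> =
     theta sg p \<mu> \<nu> * omega sg p \<alpha> \<beta> + omega sg p \<mu> \<nu> * theta sg p \<alpha> \<beta>"

definition Pker :: "('n::finite \<Rightarrow> real) \<Rightarrow> real \<Rightarrow> real^'n \<Rightarrow> 'n kernel" where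
  "Pker sg \<kappa> p \<mu>1 \<nu>1 \<mu>2 \<nu>2 = \<kappa> powi (4 - int CARD('n)) *
     (- 1/2 * (p $ \<mu>1 * p $ \<mu>2 * eta sg \<nu>1 \<nu>2 + p $ \<mu>1 * p $ \<nu>2 * eta sg \<nu>1 \<mu>2
             + p $ \<nu>1 * p $ \<mu>2 * eta sg \<mu>1 \<nu>2 + p $ \<nu>1 * p $ \<nu>2 * eta sg \<mu>1 \<mu>2)
      + psq sg p * (1/2 * (eta sg \<mu>1 \<mu>2 * eta sg \<nu>1 \<nu>2 + eta sg \<mu>1 \<nu>2 * eta sg \<mu>2 \<nu>1)
                    - 1 / (real CARD('n) - 2) * eta sg \<mu>1 \<nu>1 * eta sg \<mu>2 \<nu>2))"

definition gf_ker :: "('n::finite \<Rightarrow> real) \<Rightarrow> real^'n \<Rightarrow> 'n kernel" where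
  "gf_ker sg p \<mu>1 \<nu>1 \<mu>2 \<nu>2 =
     1/4 * (eta sg \<mu>1 \<mu>2 * p $ \<nu>1 * p $ \<nu>2 + eta sg \<mu>1 \<nu>2 * p $ \<nu>1 * p $ \<mu>2
          + eta sg \<nu>1 \<mu>2 * p $ \<mu>1 * p $ \<nu>2 + eta sg \<nu>1 \<nu>2 * p $ \<mu>1 * p $ \<mu>2)"

definition Peps :: "('n::finite \<Rightarrow> real) \<Rightarrow> real \<Rightarrow> real \<Rightarrow> real^'n \<Rightarrow> 'n kernel" where
  "Peps sg \<kappa> \<epsilon> p \<mu>1 \<nu>1 \<mu>2 \<nu>2 =
     Pker sg \<kappa> p \<mu>1 \<nu>1 \<mu>2 \<nu>2
     + \<kappa> powi (4 - int CARD('n)) / \<epsilon> * gf_ker sg p \<mu>1 \<nu>1 \<mu>2 \<nu>2"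


section \<open>Fields\<close>

text \<open>
  Index positions: \<open>hf \<phi> \<mu> \<nu>\<close> is \<open>h\<^sup>\<mu>\<^sup>\<nu>\<close>; in \<open>Bf \<phi> \<lambda> \<mu> \<nu>\<close> the
  index \<open>\<lambda>\<close> is upper and \<open>\<mu>\<close>, \<open>\<nu>\<close> are lower; the ghost \<open>cf \<phi> \<mu>\<close> has an
  upper index, the antighost \<open>cbf \<phi> \<mu>\<close> and the auxiliary field \<open>b \<mu>\<close> have lower ones.
\<close>

record ('a, 'n) fields =
  hf :: "'n \<Rightarrow> 'n \<Rightarrow> real^'n \<Rightarrow> 'a"
  Bf :: "'n \<Rightarrow> 'n \<Rightarrow> 'n \<Rightarrow> real^'n \<Rightarrow> 'a"
  cbf :: "'n \<Rightarrow> real^'n \<Rightarrow> 'a"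
  cf :: "'n \<Rightarrow> real^'n \<Rightarrow> 'a"

definition field_space ::
  "'a::real_normed_vector set \<Rightarrow> 'a set \<Rightarrow> ('a, 'n::finite) fields set" where
  "field_space Ev Od = {\<phi>.
     (\<forall>\<mu> \<nu>. schwartz (hf \<phi> \<mu> \<nu>) \<and> range (hf \<phi> \<mu> \<nu>) \<subseteq> Ev \<and> hf \<phi> \<mu> \<nu> = hf \<phi> \<nu> \<mu>) \<and>
     (\<forall>l \<mu> \<nu>. schwartz (Bf \<phi> l \<mu> \<nu>) \<and> range (Bf \<phi> l \<mu> \<nu>) \<subseteq> Ev \<and> Bf \<phi> l \<mu> \<nu> = Bf \<phi> l \<nu> \<mu>) \<and>
     (\<forall>\<mu>. schwartz (cbf \<phi> \<mu>) \<and> range (cbf \<phi> \<mu>) \<subseteq> Od) \<and>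
     (\<forall>\<mu>. schwartz (cf \<phi> \<mu>) \<and> range (cf \<phi> \<mu>) \<subseteq> Od)}"

definition b_space ::
  "'a::real_normed_vector set \<Rightarrow> ('n::finite \<Rightarrow> real^'n \<Rightarrow> 'a) set" where
  "b_space Ev = {b. \<forall>\<mu>. schwartz (b \<mu>) \<and> range (b \<mu>) \<subseteq> Ev}"


section \<open>The Cheung-Remmen action\<close>

text \<open>Suffix letters of \<open>h\<close> and \<open>B\<close>: \<open>u\<close> for upper, \<open>l\<close> for lower index.\<close>

context
  fixes sg :: "'n::finite \<Rightarrow> real"
    and \<phi> :: "('a::{real_normed_algebra_1,banach,second_countable_topology}, 'n) fields"
begin

definition h_ll :: "'n \<Rightarrow> 'n \<Rightarrow> real^'n \<Rightarrow> 'a" where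
  "h_ll \<mu> \<nu> x = (sg \<mu> * sg \<nu>) *\<^sub>R hf \<phi> \<mu> \<nu> x"

definition h_lu :: "'n \<Rightarrow> 'n \<Rightarrow> real^'n \<Rightarrow> 'a" where
  "h_lu \<mu> \<nu> x = sg \<mu> *\<^sub>R hf \<phi> \<mu> \<nu> x"

definition h_tr :: "real^'n \<Rightarrow> 'a" where
  "h_tr x = (\<Sum>\<mu>\<in>UNIV. \<Sum>\<nu>\<in>UNIV. eta sg \<mu> \<nu> *\<^sub>R hf \<phi> \<mu> \<nu> x)"

definition B_uuu :: "'n \<Rightarrow> 'n \<Rightarrow> 'n \<Rightarrow> real^'n \<Rightarrow> 'a" where
  "B_uuu l \<mu> \<nu> x = (sg \<mu> * sg \<nu>) *\<^sub>R Bf \<phi> l \<mu> \<nu> x"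

definition B_uul :: "'n \<Rightarrow> 'n \<Rightarrow> 'n \<Rightarrow> real^'n \<Rightarrow> 'a" where
  "B_uul l \<mu> \<nu> x = sg \<mu> *\<^sub>R Bf \<phi> l \<mu> \<nu> x"

definition B_ulu :: "'n \<Rightarrow> 'n \<Rightarrow> 'n \<Rightarrow> real^'n \<Rightarrow> 'a" where
  "B_ulu l \<mu> \<nu> x = sg \<nu> *\<^sub>R Bf \<phi> l \<mu> \<nu> x"

definition B_lll :: "'n \<Rightarrow> 'n \<Rightarrow> 'n \<Rightarrow> real^'n \<Rightarrow> 'a" where
  "B_lll l \<mu> \<nu> x = sg l *\<^sub>R Bf \<phi> l \<mu> \<nu> x"

text \<open>\<open>\<integral> d\<^sup>dp/(2\<pi>)\<^sup>d h(-p) h(p) K(p)\<close>, indices contracted in order.\<close>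

definition hh_form :: "'a \<Rightarrow> (real^'n \<Rightarrow> 'n kernel) \<Rightarrow> 'a" where
  "hh_form J K = mint (\<lambda>p. \<Sum>\<mu>1\<in>UNIV. \<Sum>\<nu>1\<in>UNIV. \<Sum>\<mu>2\<in>UNIV. \<Sum>\<nu>2\<in>UNIV.
     K p \<mu>1 \<nu>1 \<mu>2 \<nu>2 *\<^sub>R (mode J (hf \<phi> \<mu>1 \<nu>1) (- p) * mode J (hf \<phi> \<mu>2 \<nu>2) p))"

definition A_hh :: "'a \<Rightarrow> real \<Rightarrow> 'a" where
  "A_hh J \<kappa> = hh_form J (\<lambda>p \<mu>1 \<nu>1 \<mu>2 \<nu>2. 1/2 * Pker sg \<kappa> p \<mu>1 \<nu>1 \<mu>2 \<nu>2)"

definition A_BB :: "real \<Rightarrow> 'a" where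
  "A_BB \<kappa> = (LINT x|lborel. (2 * \<kappa> powi (2 - int CARD('n))) *\<^sub>R
     ((\<Sum>\<mu>\<in>UNIV. \<Sum>\<nu>\<in>UNIV. \<Sum>l\<in>UNIV. B_uuu \<mu> \<nu> l x * B_lll \<nu> \<mu> l x)
      - (1 / (real CARD('n) - 1)) *\<^sub>R
        (\<Sum>\<mu>\<in>UNIV. \<Sum>\<nu>\<in>UNIV. \<Sum>l\<in>UNIV. Bf \<phi> \<mu> \<mu> l x * B_ulu \<nu> \<nu> l x)))"

definition A_hhh :: "real \<Rightarrow> 'a" where
  "A_hhh \<kappa> = (LINT x|lborel. \<kappa> powi (5 - int CARD('n)) *\<^sub>R
     (\<Sum>\<mu>\<in>UNIV. \<Sum>\<nu>\<in>UNIV. hf \<phi> \<mu> \<nu> x *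
       (- (1/2) *\<^sub>R (\<Sum>\<alpha>\<in>UNIV. \<Sum>\<beta>\<in>UNIV. pd \<mu> (h_ll \<alpha> \<beta>) x * pd \<nu> (hf \<phi> \<alpha> \<beta>) x)
        - (\<Sum>\<alpha>\<in>UNIV. \<Sum>\<beta>\<in>UNIV. pd \<alpha> (h_ll \<mu> \<beta>) x *
             (sg \<beta> *\<^sub>R pd \<beta> (h_lu \<nu> \<alpha>) x - sg \<alpha> *\<^sub>R pd \<alpha> (h_lu \<nu> \<beta>) x))
        + (1 / (real CARD('n) - 2)) *\<^sub>R
            ((1/2) *\<^sub>R (pd \<mu> h_tr x * pd \<nu> h_tr x)
             - (\<Sum>l\<in>UNIV. pd l (h_ll \<mu> \<nu>) x * (sg l *\<^sub>R pd l h_tr x))))))"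

definition A_Bhh :: "real \<Rightarrow> 'a" where
  "A_Bhh \<kappa> = (LINT x|lborel. \<kappa> powi (4 - int CARD('n)) *\<^sub>R
     ((2 / (real CARD('n) - 2)) *\<^sub>R
        ((\<Sum>\<alpha>\<in>UNIV. \<Sum>\<beta>\<in>UNIV. \<Sum>\<mu>\<in>UNIV. Bf \<phi> \<alpha> \<alpha> \<beta> x * hf \<phi> \<beta> \<mu> x * pd \<mu> h_tr x)
         - (\<Sum>\<alpha>\<in>UNIV. \<Sum>\<beta>\<in>UNIV. \<Sum>\<mu>\<in>UNIV. B_uuu \<alpha> \<beta> \<mu> x * h_ll \<alpha> \<beta> x * pd \<mu> h_tr x))
      - 2 *\<^sub>R (\<Sum>\<nu>\<in>UNIV. \<Sum>\<beta>\<in>UNIV. \<Sum>l\<in>UNIV. \<Sum>\<mu>\<in>UNIV. B_uuu \<nu> \<beta> l x * h_lu \<beta> \<mu> x *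
          (pd \<mu> (h_ll \<nu> l) x + pd \<nu> (h_ll \<mu> l) x - pd l (h_ll \<mu> \<nu>) x))))"

definition A_BBh :: "real \<Rightarrow> 'a" where
  "A_BBh \<kappa> = (LINT x|lborel. \<kappa> powi (3 - int CARD('n)) *\<^sub>R
     (\<Sum>\<mu>\<in>UNIV. \<Sum>\<nu>\<in>UNIV. hf \<phi> \<mu> \<nu> x *
       (- 2 *\<^sub>R (\<Sum>\<alpha>\<in>UNIV. \<Sum>\<beta>\<in>UNIV. B_uul \<alpha> \<beta> \<mu> x * B_lll \<beta> \<alpha> \<nu> x)
        + (2 / (real CARD('n) - 1)) *\<^sub>R
            (\<Sum>\<alpha>\<in>UNIV. \<Sum>\<beta>\<in>UNIV. Bf \<phi> \<alpha> \<alpha> \<mu> x * Bf \<phi> \<beta> \<beta> \<nu> x))))"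

definition A_CR :: "'a \<Rightarrow> real \<Rightarrow> 'a" where
  "A_CR J \<kappa> = A_hh J \<kappa> + A_BB \<kappa> + A_hhh \<kappa> + A_Bhh \<kappa> + A_BBh \<kappa>"

definition A_hh_gf :: "'a \<Rightarrow> real \<Rightarrow> real \<Rightarrow> 'a" where
  "A_hh_gf J \<kappa> \<epsilon> =
     A_hh J \<kappa> + (1/2 * (\<kappa> powi (4 - int CARD('n)) / \<epsilon>)) *\<^sub>R hh_form J (gf_ker sg)"

text \<open>\<open>\<box>\<close> is \<open>\<Sum>\<^sub>\<nu> sg \<nu> \<partial>\<^sub>\<nu>\<partial>\<^sub>\<nu>\<close>.\<close>

definition A_gh :: "real \<Rightarrow> 'a" where
  "A_gh \<kappa> = \<kappa> powi (4 - int CARD('n)) *\<^sub>R (LINT x|lborel.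
     (\<Sum>\<mu>\<in>UNIV. cbf \<phi> \<mu> x * (\<Sum>\<nu>\<in>UNIV. sg \<nu> *\<^sub>R pd \<nu> (pd \<nu> (cf \<phi> \<mu>)) x)))"

end

definition A_gh_h ::
  "('a::{real_normed_algebra_1,banach,second_countable_topology}, 'n::finite) fields \<Rightarrow>
     real \<Rightarrow> 'a" where
  "A_gh_h \<phi> \<kappa> = \<kappa> powi (5 - int CARD('n)) *\<^sub>R (LINT x|lborel.
     (\<Sum>\<mu>\<in>UNIV. \<Sum>\<nu>\<in>UNIV. hf \<phi> \<mu> \<nu> x *
       (\<Sum>l\<in>UNIV. pd l (cbf \<phi> \<mu>) x * pd \<nu> (cf \<phi> l) x
                + pd \<mu> (cbf \<phi> l) x * pd \<nu> (cf \<phi> l) x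
                + pd l (pd \<mu> (cbf \<phi> \<nu>)) x * cf \<phi> l x)))"


section \<open>BRST operator and gauge fixing\<close>

text \<open>
  An odd derivation is only determined on the algebra of differential polynomials in the
  fields, so these are represented by terms; \<open>den\<close> evaluates a term on field configurations.
\<close>

datatype 'n gen = GH 'n 'n | GB 'n 'n 'n | Gb 'n | Gcb 'n | Gc 'n

datatype 'n dpoly =
    Gen "'n gen"
  | Cst real
  | Par 'n "'n dpoly"
  | Add "'n dpoly" "'n dpoly" (infixl "\<oplus>" 65)
  | Mul "'n dpoly" "'n dpoly" (infixl "\<odot>" 70)
  | Sm "'n \<Rightarrow> 'n dpoly" (binder "\<Oplus>" 60)

fun den_gen ::
  "('a, 'n::finite) fields \<Rightarrow> ('n \<Rightarrow> real^'n \<Rightarrow> 'a) \<Rightarrow> 'n gen \<Rightarrow> real^'n \<Rightarrow> 'a" where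
  "den_gen \<phi> b (GH \<mu> \<nu>) = hf \<phi> \<mu> \<nu>"
| "den_gen \<phi> b (GB l \<mu> \<nu>) = Bf \<phi> l \<mu> \<nu>"
| "den_gen \<phi> b (Gb \<mu>) = b \<mu>"
| "den_gen \<phi> b (Gcb \<mu>) = cbf \<phi> \<mu>"
| "den_gen \<phi> b (Gc \<mu>) = cf \<phi> \<mu>"

primrec den ::
  "('a::real_normed_algebra_1, 'n::finite) fields \<Rightarrow> ('n \<Rightarrow> real^'n \<Rightarrow> 'a) \<Rightarrow>
     'n dpoly \<Rightarrow> real^'n \<Rightarrow> 'a" where
  "den \<phi> b (Gen g) = den_gen \<phi> b g"
| "den \<phi> b (Cst r) = (\<lambda>x. of_real r)"
| "den \<phi> b (Par \<mu> e) = pd \<mu> (den \<phi> b e)"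
| "den \<phi> b (e \<oplus> f) = (\<lambda>x. den \<phi> b e x + den \<phi> b f x)"
| "den \<phi> b (e \<odot> f) = (\<lambda>x. den \<phi> b e x * den \<phi> b f x)"
| "den \<phi> b (Sm F) = (\<lambda>x. \<Sum>\<mu>\<in>UNIV. den \<phi> b (F \<mu>) x)"

fun odd_gen :: "'n gen \<Rightarrow> bool" where
  "odd_gen (Gcb _) = True"
| "odd_gen (Gc _) = True"
| "odd_gen _ = False"

text \<open>
  Grade involution: multiplication by \<open>(-1)\<close> to the parity on homogeneous terms. With it the
  graded Leibniz rule needs no case distinction and covers inhomogeneous sums.
\<close>

primrec inv_gr :: "'n dpoly \<Rightarrow> 'n dpoly" where
  "inv_gr (Gen g) = (if odd_gen g then Cst (- 1) \<odot> Gen g else Gen g)"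
| "inv_gr (Cst r) = Cst r"
| "inv_gr (Par \<mu> e) = Par \<mu> (inv_gr e)"
| "inv_gr (e \<oplus> f) = inv_gr e \<oplus> inv_gr f"
| "inv_gr (e \<odot> f) = inv_gr e \<odot> inv_gr f"
| "inv_gr (Sm F) = Sm (\<lambda>\<mu>. inv_gr (F \<mu>))"

text \<open>The variation of \<open>B\<close> is left as the parameter \<open>\<tau>\<close>; no term used here contains \<open>B\<close>.\<close>

fun brst_gen ::
  "('n \<Rightarrow> real) \<Rightarrow> real \<Rightarrow> ('n \<Rightarrow> 'n \<Rightarrow> 'n \<Rightarrow> 'n dpoly) \<Rightarrow> 'n gen \<Rightarrow> 'n dpoly" where
  "brst_gen sg \<kappa> \<tau> (GH \<mu> \<nu>) =
     (\<Oplus>l. Gen (GH \<mu> l) \<odot> Par l (Gen (Gc \<nu>)))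
     \<oplus> (\<Oplus>l. Gen (GH \<nu> l) \<odot> Par l (Gen (Gc \<mu>)))
     \<oplus> Cst (- 1) \<odot> (\<Oplus>l. Par l (Gen (GH \<mu> \<nu>) \<odot> Gen (Gc l)))
     \<oplus> Cst (- 1 / \<kappa>) \<odot>
        (Cst (sg \<mu>) \<odot> Par \<mu> (Gen (Gc \<nu>)) \<oplus> Cst (sg \<nu>) \<odot> Par \<nu> (Gen (Gc \<mu>))
         \<oplus> Cst (- eta sg \<mu> \<nu>) \<odot> (\<Oplus>l. Par l (Gen (Gc l))))"
| "brst_gen sg \<kappa> \<tau> (GB l \<mu> \<nu>) = \<tau> l \<mu> \<nu>"
| "brst_gen sg \<kappa> \<tau> (Gb \<mu>) = Cst 0"
| "brst_gen sg \<kappa> \<tau> (Gcb \<mu>) = Gen (Gb \<mu>)"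
| "brst_gen sg \<kappa> \<tau> (Gc \<mu>) = Cst (- 1) \<odot> (\<Oplus>\<sigma>. Gen (Gc \<sigma>) \<odot> Par \<sigma> (Gen (Gc \<mu>)))"

primrec brst ::
  "('n \<Rightarrow> real) \<Rightarrow> real \<Rightarrow> ('n \<Rightarrow> 'n \<Rightarrow> 'n \<Rightarrow> 'n dpoly) \<Rightarrow> 'n dpoly \<Rightarrow> 'n dpoly" where
  "brst sg \<kappa> \<tau> (Gen g) = brst_gen sg \<kappa> \<tau> g"
| "brst sg \<kappa> \<tau> (Cst r) = Cst 0"
| "brst sg \<kappa> \<tau> (Par \<mu> e) = Par \<mu> (brst sg \<kappa> \<tau> e)"
| "brst sg \<kappa> \<tau> (e \<oplus> f) = brst sg \<kappa> \<tau> e \<oplus> brst sg \<kappa> \<tau> f"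
| "brst sg \<kappa> \<tau> (e \<odot> f) = brst sg \<kappa> \<tau> e \<odot> f \<oplus> inv_gr e \<odot> brst sg \<kappa> \<tau> f"
| "brst sg \<kappa> \<tau> (Sm F) = Sm (\<lambda>\<mu>. brst sg \<kappa> \<tau> (F \<mu>))"

definition gf_density :: "('n \<Rightarrow> real) \<Rightarrow> real \<Rightarrow> real \<Rightarrow> 'n dpoly" where
  "gf_density sg \<kappa> \<epsilon> =
     (\<Oplus>\<mu>. Gen (Gcb \<mu>) \<odot>
        (Cst \<kappa> \<odot> (\<Oplus>\<nu>. Par \<nu> (Gen (GH \<mu> \<nu>)))
         \<oplus> Cst (- (\<epsilon> / 2) * \<kappa>\<^sup>2) \<odot> (Cst (sg \<mu>) \<odot> Gen (Gb \<mu>))))"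

definition A_gf ::
  "('n::finite \<Rightarrow> real) \<Rightarrow> ('n \<Rightarrow> 'n \<Rightarrow> 'n \<Rightarrow> 'n dpoly) \<Rightarrow>
     ('a::{real_normed_algebra_1,banach,second_countable_topology}, 'n) fields \<Rightarrow>
     ('n \<Rightarrow> real^'n \<Rightarrow> 'a) \<Rightarrow> real \<Rightarrow> real \<Rightarrow> 'a" where
  "A_gf sg \<tau> \<phi> b \<kappa> \<epsilon> = \<kappa> powi (4 - int CARD('n)) *\<^sub>R
     (LINT x|lborel. den \<phi> b (brst sg \<kappa> \<tau> (gf_density sg \<kappa> \<epsilon>)) x)"


section \<open>Formal functional integrals\<close>

text \<open>
  A formal functional integral is a functional of integrands, which are restricted to the space
  of field configurations; outside that space their values are irrelevant.
\<close>

abbreviation fint :: "(('c \<Rightarrow> 'a) \<Rightarrow> 'z) \<Rightarrow> 'c set \<Rightarrow> ('c \<Rightarrow> 'a) \<Rightarrow> 'z" where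
  "fint D S F \<equiv> D (restrict F S)"

definition b_gauss ::
  "('n::finite \<Rightarrow> real) \<Rightarrow> 'a::{real_normed_algebra_1,banach,second_countable_topology} \<Rightarrow>
     real \<Rightarrow> real \<Rightarrow> ('n \<Rightarrow> real^'n \<Rightarrow> 'a) \<Rightarrow> 'a" where
  "b_gauss sg J \<kappa> \<epsilon> b =
     exp (J * (\<kappa> powi (4 - int CARD('n)) *\<^sub>R (LINT x|lborel.
       (- (\<epsilon> / 2) * \<kappa>\<^sup>2) *\<^sub>R (\<Sum>\<mu>\<in>UNIV. b \<mu> x * (sg \<mu> *\<^sub>R b \<mu> x)))))"

text \<open>
  The rules of formal Gaussian integration over \<open>b\<close>: factors independent of \<open>b\<close> can be
  pulled out, the integration variable can be shifted, and the measure is normalised so as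
  to absorb the value of the pure Gaussian. They are only required of Gaussian integrands:
  there is no nonzero translation-invariant functional on all functionals of \<open>b\<close>.
\<close>

definition gaussian_b_integral ::
  "('n::finite \<Rightarrow> real) \<Rightarrow> 'a::{real_normed_algebra_1,banach,second_countable_topology} set \<Rightarrow>
     'a \<Rightarrow> real \<Rightarrow> real \<Rightarrow> ((('n \<Rightarrow> real^'n \<Rightarrow> 'a) \<Rightarrow> 'a) \<Rightarrow> 'a) \<Rightarrow> bool" where
  "gaussian_b_integral sg Ev J \<kappa> \<epsilon> Db \<longleftrightarrow>
     (\<forall>z. \<forall>f\<in>b_space Ev.
        fint Db (b_space Ev) (\<lambda>b. z * b_gauss sg J \<kappa> \<epsilon> (\<lambda>\<mu> x. b \<mu> x - f \<mu> x))
        = z * fint Db (b_space Ev) (\<lambda>b. b_gauss sg J \<kappa> \<epsilon> (\<lambda>\<mu> x. b \<mu> x - f \<mu> x))) \<and>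
     (\<forall>f\<in>b_space Ev.
        fint Db (b_space Ev) (\<lambda>b. b_gauss sg J \<kappa> \<epsilon> (\<lambda>\<mu> x. b \<mu> x - f \<mu> x))
        = fint Db (b_space Ev) (b_gauss sg J \<kappa> \<epsilon>)) \<and>
     fint Db (b_space Ev) (b_gauss sg J \<kappa> \<epsilon>) = 1"

end

(*
  The auxiliary field b enters only through the BRST variation of the antighost, quadratically and
  without derivatives. Completing the square around b = (d h)/(eps kappa) leaves the pure Gaussian,
  absorbed in the normalisation, and the term (d h)^2/(2 eps), which the Fourier transform turns
  into the gauge-fixing kernel. The rest of the gauge-fixing action is - cbar d(delta h); integrating
  by parts moves all derivatives onto cbar and yields the two ghost actions, the two extra quadratic
  terms cancelling because in momentum space partial derivatives commute.

  All statements in momentum space reduce to the Parseval formula for algebra-valued Schwartz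
  functions, whose imaginary unit is a central element J with J^2 = -1. It follows from Fourier
  inversion, proved by Gaussian regularisation of the momentum integral.

  The kernel of the quadratic action lies in the algebra spanned by the identity on transverse
  tensors, P^1, and the four products of theta and omega. This span is closed under composition, so
  the inverse is verified by comparing six coefficients.
*)
theory Submission
  imports Defs "HOL-Probability.Probability"
begin

section \<open>Decay estimates and integrability over R^d\<close>

section \<open>Rapidly decreasing functions\<close>

text \<open>The values lie in a noncommutative algebra without complex scalars, so phases are
  elements \<open>cplx (cis t)\<close>: central, but with norm bounded only by
  \<open>1 + norm J\<close>. The one explicit Fourier transform needed, that of a Gaussian, is
  scalar and is carried over by the bounded linear map \<open>cplx\<close>. The rules for the
  integral over b concern only a constant times a shifted Gaussian, and each configuration shifts by
  its own divergence. So for every configuration the integrand has to be brought exactly into that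
  form. The exponential of the sum splits only because the Gaussian exponent is even and hence
  commutes with the rest of the action. The outer functional D then sees equal integrands. Signs
  follow from the definitions. A derivative acts on modes as J p; with momenta -p and p two
  derivatives give +p p, so the gauge-fixing kernel is added with +1/\<epsilon>, while each cubic
  ghost vertex acquires J J = -1. Hence some signs in the kernel, its inverse and the ghost vertex
  in momentum space differ from the formulas displayed at the top.\<close>

definition decay :: "(real^'n::finite \<Rightarrow> 'a::real_normed_vector) \<Rightarrow> bool" where
  "decay f \<longleftrightarrow> (\<forall>k. bounded (range (\<lambda>x. (1 + norm x) ^ k *\<^sub>R f x)))"

lemma decay_bound:
  assumes "decay f"
  obtains C where "C > 0" "\<And>x. norm (f x) \<le> C / (1 + norm x) ^ k"
proof -
  obtain C where C: "C > 0" "\<And>x. norm ((1 + norm x) ^ k *\<^sub>R f x) \<le> C"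
    using assms unfolding decay_def bounded_pos by blast
  have "norm (f x) \<le> C / (1 + norm x) ^ k" for x
    using C(2)[of x] by (simp add: pos_le_divide_eq add_pos_nonneg mult.commute)
  with C(1) that show thesis by blast
qed

lemma decayI:
  assumes "\<And>k. \<exists>C. \<forall>x. norm (f x) \<le> C / (1 + norm x) ^ k"
  shows "decay f"
  unfolding decay_def bounded_iff
proof
  fix k
  obtain C where "\<And>x. norm (f x) \<le> C / (1 + norm x) ^ k"
    using assms by blast
  then have "norm ((1 + norm x) ^ k *\<^sub>R f x) \<le> C" for x
    by (simp add: pos_le_divide_eq add_pos_nonneg mult.commute)
  then show "\<exists>C. \<forall>y\<in>range (\<lambda>x. (1 + norm x) ^ k *\<^sub>R f x). norm y \<le> C"
    by blast
qed

lemma decay_dominated: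
  assumes "decay f" "\<And>x. norm (g x) \<le> C * norm (f x)"
  shows "decay g"
proof (rule decayI)
  fix k
  obtain K where K: "\<And>x. norm (f x) \<le> K / (1 + norm x) ^ k"
    using decay_bound[OF assms(1)] by metis
  have "norm (g x) \<le> \<bar>C\<bar> * norm (f x)" for x
    using assms(2)[of x] by (meson abs_ge_self mult_right_mono norm_ge_zero order_trans)
  also have "\<bar>C\<bar> * norm (f x) \<le> \<bar>C\<bar> * (K / (1 + norm x) ^ k)" for x
    by (intro mult_left_mono K) auto
  finally show "\<exists>C. \<forall>x. norm (g x) \<le> C / (1 + norm x) ^ k"
    by (intro exI[of _ "\<bar>C\<bar> * K"]) auto
qed

lemma decay_add:
  assumes "decay f" "decay g"
  shows "decay (\<lambda>x. f x + g x)"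
proof (rule decayI)
  fix k
  obtain K L where "\<And>x. norm (f x) \<le> K / (1 + norm x) ^ k" "\<And>x. norm (g x) \<le> L / (1 + norm x) ^ k"
    using assms decay_bound by metis
  then have "norm (f x + g x) \<le> (K + L) / (1 + norm x) ^ k" for x
    using norm_triangle_mono[of "f x" _ "g x"] by (simp add: add_divide_distrib)
  then show "\<exists>C. \<forall>x. norm (f x + g x) \<le> C / (1 + norm x) ^ k" by blast
qed

lemma decay_bounded_linear:
  assumes "bounded_linear L" "decay f"
  shows "decay (\<lambda>x. L (f x))"
proof -
  obtain K where "\<And>y. norm (L y) \<le> norm y * K"
    using bounded_linear.bounded[OF assms(1)] by blast
  then show ?thesis
    by (intro decay_dominated[OF assms(2), of _ K]) (simp add: mult.commute)
qed

lemma decay_mult: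
  fixes f g :: "real^'n::finite \<Rightarrow> 'a::real_normed_algebra"
  assumes "decay f" "decay g"
  shows "decay (\<lambda>x. f x * g x)"
proof -
  obtain K where K: "\<And>x. norm (f x) \<le> K / (1 + norm x) ^ 0"
    using decay_bound[OF assms(1)] by metis
  show ?thesis
  proof (rule decay_dominated[OF assms(2), of _ K])
    show "norm (f x * g x) \<le> K * norm (g x)" for x
      using K[of x] norm_mult_ineq[of "f x" "g x"]
      by (simp add: order_trans[OF _ mult_right_mono])
  qed
qed

text \<open>On a Euclidean space \<open>lborel\<close> is the image of a product measure indexed by
  basis vectors. The bijection from i to \<open>axis i 1\<close>, inverted by \<open>ix\<close>,
  replaces that index set by the coordinate type, and Fubini for finite products applies.\<close>

lemma integrable_prod_components:
  fixes f :: "'n::finite \<Rightarrow> real \<Rightarrow> 'b::{real_normed_field,banach,second_countable_topology}"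
  assumes "\<And>i. integrable lborel (f i)"
  shows "integrable lborel (\<lambda>x::real^'n. \<Prod>i\<in>UNIV. f i (x $ i))"
    and "(LINT x|lborel. (\<Prod>i\<in>UNIV. f i ((x::real^'n) $ i))) = (\<Prod>i\<in>UNIV. LINT t|lborel. f i t)"
proof -
  interpret product_sigma_finite "\<lambda>_::real^'n. lborel :: real measure" ..
  define ix :: "real^'n \<Rightarrow> 'n" where "ix b = (THE i. b = axis i 1)" for b
  have ix: "ix (axis i 1) = i" for i
    unfolding ix_def by (rule the_equality) (auto simp: axis_eq_axis)
  have bij: "bij_betw (\<lambda>i. axis i (1::real)) UNIV (Basis :: (real^'n) set)"
    by (auto simp: bij_betw_def inj_on_def axis_eq_axis Basis_vec_def)
  have reindex: "(\<Prod>b\<in>Basis. g (ix b) b) = (\<Prod>i\<in>UNIV. g i (axis i 1))" for g :: "'n \<Rightarrow> real^'n \<Rightarrow> 'b"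
    using prod.reindex_bij_betw[OF bij, of "\<lambda>b. g (ix b) b"] by (simp add: ix)
  have comp: "(\<Sum>b\<in>Basis. g b *\<^sub>R b) $ i = g (axis i 1)" for g :: "real^'n \<Rightarrow> real" and i
  proof -
    have "(\<Sum>b\<in>Basis. g b *\<^sub>R b) = (\<Sum>j\<in>UNIV. g (axis j 1) *\<^sub>R (axis j 1 :: real^'n))"
      using sum.reindex_bij_betw[OF bij, of "\<lambda>b. g b *\<^sub>R b"] by simp
    then show ?thesis
      by (simp add: axis_def if_distrib cong: if_cong)
  qed
  have meas: "(\<lambda>g. \<Sum>b\<in>Basis. g b *\<^sub>R b) \<in> measurable (\<Pi>\<^sub>M b\<in>(Basis::(real^'n) set). lborel) borel"
    by measurable
  have fm[measurable]: "f i \<in> borel_measurable borel" for i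
    using borel_measurable_integrable[OF assms[of i]] by simp
  have cm: "(\<lambda>x::real^'n. x $ i) \<in> borel_measurable borel" for i
    by (intro borel_measurable_continuous_onI continuous_intros)
  have Fm: "(\<lambda>x::real^'n. \<Prod>i\<in>UNIV. f i (x $ i)) \<in> borel_measurable borel"
    by (intro borel_measurable_prod measurable_compose[OF cm fm])
  have eq: "(\<lambda>g. \<Prod>i\<in>UNIV. f i ((\<Sum>b\<in>Basis. g b *\<^sub>R b :: real^'n) $ i)) = (\<lambda>g. \<Prod>b\<in>Basis. f (ix b) (g b))"
    by (rule ext) (simp only: comp reindex[of "\<lambda>i b. f i (g b)" for g])
  have "integrable (\<Pi>\<^sub>M b\<in>(Basis::(real^'n) set). lborel) (\<lambda>g. \<Prod>b\<in>Basis. f (ix b) (g b))"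
    by (intro product_integrable_prod assms) auto
  then show "integrable lborel (\<lambda>x::real^'n. \<Prod>i\<in>UNIV. f i (x $ i))"
    by (subst lborel_eq, subst integrable_distr_eq[OF meas Fm]) (simp only: eq)
  have "(LINT x|lborel. (\<Prod>i\<in>UNIV. f i ((x::real^'n) $ i)))
      = (LINT g|(\<Pi>\<^sub>M b\<in>(Basis::(real^'n) set). lborel). (\<Prod>b\<in>Basis. f (ix b) (g b)))"
    by (subst lborel_eq, subst integral_distr[OF meas Fm]) (simp only: eq)
  also have "\<dots> = (\<Prod>b\<in>(Basis::(real^'n) set). LINT t|lborel. f (ix b) t)"
    by (intro product_integral_prod assms) auto
  finally show "(LINT x|lborel. (\<Prod>i\<in>UNIV. f i ((x::real^'n) $ i))) = (\<Prod>i\<in>UNIV. LINT t|lborel. f i t)"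
    by (simp add: reindex[of "\<lambda>i b. LINT t|lborel. f i t"])
qed

text \<open>Each coordinate satisfies 1 + x_i^2 <= (1 + norm x)^2. Multiplying over the d
  coordinates dominates the weight by a product of integrable functions 1 / (1 + t^2), which is the
  origin of the exponent 2d.\<close>

lemma integrable_weight:
  "integrable lborel (\<lambda>x::real^'n::finite. 1 / (1 + norm x) ^ (2 * CARD('n)))"
proof (rule Bochner_Integration.integrable_bound)
  have "integrable lborel (\<lambda>t::real. inverse (1 + t\<^sup>2))"
    using integrable_inverse_1_plus_square by (simp add: set_integrable_def)
  then show "integrable lborel (\<lambda>x::real^'n. \<Prod>i\<in>UNIV. inverse (1 + (x $ i)\<^sup>2))"
    by (rule integrable_prod_components)
  have "(\<Prod>i\<in>UNIV. 1 + (x $ i)\<^sup>2) \<le> (1 + norm x) ^ (2 * CARD('n))" for x :: "real^'n"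
  proof -
    have "1 + (x $ i)\<^sup>2 \<le> (1 + norm x)\<^sup>2" for i
      using power_mono[OF component_le_norm_cart[of x i], of 2]
      by (simp add: power2_sum, use norm_ge_zero[of x] in linarith)
    then have "(\<Prod>i\<in>UNIV. 1 + (x $ i)\<^sup>2) \<le> (\<Prod>i\<in>(UNIV::'n set). (1 + norm x)\<^sup>2)"
      by (intro prod_mono) auto
    then show ?thesis by (simp add: power_mult)
  qed
  moreover have "(\<Prod>i\<in>UNIV. 1 + (x $ i)\<^sup>2) > 0" for x :: "real^'n"
    by (intro prod_pos) (auto intro: add_pos_nonneg)
  ultimately show "AE x in lborel. norm (1 / (1 + norm x) ^ (2 * CARD('n)))
      \<le> norm (\<Prod>i\<in>UNIV. inverse (1 + ((x::real^'n) $ i)\<^sup>2))"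
    by (intro AE_I2)
      (simp add: prod_inversef[unfolded o_def] divide_inverse abs_prod prod_nonneg le_imp_inverse_le
        abs_of_pos[OF add_pos_nonneg])
qed auto

lemma integrable_decay:
  fixes f :: "real^'n::finite \<Rightarrow> 'a::{banach,second_countable_topology}"
  assumes "decay f" and [measurable]: "f \<in> borel_measurable borel"
  shows "integrable lborel f"
proof -
  obtain C where C: "C > 0" "\<And>x. norm (f x) \<le> C / (1 + norm x) ^ (2 * CARD('n))"
    using decay_bound[OF assms(1)] by metis
  show ?thesis
  proof (rule Bochner_Integration.integrable_bound)
    show "integrable lborel (\<lambda>x::real^'n. C * (1 / (1 + norm x) ^ (2 * CARD('n))))"
      by (intro integrable_mult_right integrable_weight)
    show "AE x in lborel. norm (f x) \<le> norm (C * (1 / (1 + norm x) ^ (2 * CARD('n))))"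
      using C by simp
  qed simp
qed

section \<open>Closure properties of the Schwartz class\<close>

section \<open>Partial derivatives and Schwartz functions\<close>

lemma pd_eqI:
  assumes "(f has_derivative f') (at x)"
  shows "pd \<mu> f x = f' (axis \<mu> 1)"
  by (simp add: pd_def frechet_derivative_at[OF assms, symmetric])

lemma frechet_derivative_has_derivative:
  "f differentiable (at x) \<Longrightarrow> (f has_derivative frechet_derivative f (at x)) (at x)"
  by (rule frechet_derivative_works[THEN iffD1])

lemma pd_add:
  assumes "f differentiable (at x)" "g differentiable (at x)"
  shows "pd \<mu> (\<lambda>x. f x + g x) x = pd \<mu> f x + pd \<mu> g x"
  unfolding pd_eqI[OF has_derivative_add[OF assms[THEN frechet_derivative_has_derivative]]] by (simp add: pd_def)

lemma pd_bounded_linear: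
  assumes "bounded_linear L" "f differentiable (at x)"
  shows "pd \<mu> (\<lambda>x. L (f x)) x = L (pd \<mu> f x)"
  unfolding pd_eqI[OF bounded_linear.has_derivative[OF assms(1) frechet_derivative_has_derivative[OF assms(2)]]]
  by (simp add: pd_def)

lemma pd_mult:
  fixes f g :: "real^'n::finite \<Rightarrow> 'a::real_normed_algebra"
  assumes "f differentiable (at x)" "g differentiable (at x)"
  shows "pd \<mu> (\<lambda>x. f x * g x) x = f x * pd \<mu> g x + pd \<mu> f x * g x"
  unfolding pd_eqI[OF has_derivative_mult[OF assms[THEN frechet_derivative_has_derivative]]] by (simp add: pd_def)

lemma differentiable_bounded_linear:
  assumes "bounded_linear L" "f differentiable (at x)"
  shows "(\<lambda>x. L (f x)) differentiable (at x)"
  using bounded_linear.has_derivative[OF assms(1) frechet_derivative_has_derivative[OF assms(2)]]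
  by (rule differentiableI)

lemma schwartz_differentiable: "schwartz f \<Longrightarrow> f differentiable (at x)"
  unfolding schwartz_def by (drule spec[of _ "[]"]) simp

lemma schwartz_decay: "schwartz f \<Longrightarrow> decay f"
  unfolding schwartz_def decay_def by (drule spec[of _ "[]"]) simp

lemma schwartz_pd: "schwartz f \<Longrightarrow> schwartz (pd \<mu> f)"
  unfolding schwartz_def
proof (intro allI)
  fix ms k
  assume *: "\<forall>ms k. (\<forall>x. foldr pd ms f differentiable at x) \<and>
                  bounded (range (\<lambda>x. (1 + norm x) ^ k *\<^sub>R foldr pd ms f x))"
  show "(\<forall>x. foldr pd ms (pd \<mu> f) differentiable at x) \<and>
       bounded (range (\<lambda>x. (1 + norm x) ^ k *\<^sub>R foldr pd ms (pd \<mu> f) x))"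
    \<comment> \<open>\<open>foldr\<close> applies the last list entry first, so a derivative taken
      before all others is appended at the end of the list.\<close>
    using *[rule_format, of "ms @ [\<mu>]" k] by simp
qed

text \<open>Iterated derivatives are reached one at a time, so a class of differentiable, rapidly
  decreasing functions that is stable under partial derivatives contains only Schwartz functions.
  Closure properties then need just the first-order differentiation rules.\<close>

lemma schwartz_coinduct:
  assumes "Q f"
    and "\<And>f. Q f \<Longrightarrow> (\<forall>x. f differentiable (at x)) \<and> decay f \<and> (\<forall>\<mu>. Q (pd \<mu> f))"
  shows "schwartz f"
proof -
  have "(\<forall>x. foldr pd ms f differentiable (at x)) \<and> decay (foldr pd ms f)" for ms
    using assms(1)
  proof (induction ms arbitrary: f rule: rev_induct)
    case Nil
    with assms(2)[of f] show ?case by simp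
  next
    case (snoc m ms)
    with assms(2)[of f] show ?case by simp
  qed
  then show ?thesis
    unfolding schwartz_def decay_def by blast
qed

lemma schwartz_add:
  assumes "schwartz f" "schwartz g"
  shows "schwartz (\<lambda>x. f x + g x)"
proof -
  define Q where "Q h \<longleftrightarrow> (\<exists>f g. schwartz f \<and> schwartz g \<and> h = (\<lambda>x. f x + g x))" for h :: "real^'a \<Rightarrow> 'b"
  have "Q (\<lambda>x. f x + g x)"
    using assms unfolding Q_def by blast
  then show ?thesis
  proof (rule schwartz_coinduct)
    fix h assume "Q h"
    then obtain f g where h: "schwartz f" "schwartz g" "h = (\<lambda>x. f x + g x)"
      unfolding Q_def by blast
    have "pd \<mu> h = (\<lambda>x. pd \<mu> f x + pd \<mu> g x)" for \<mu>
      unfolding h(3) by (intro ext pd_add schwartz_differentiable h)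
    then have "Q (pd \<mu> h)" for \<mu>
      unfolding Q_def using h schwartz_pd by blast
    then show "(\<forall>x. h differentiable (at x)) \<and> decay h \<and> (\<forall>\<mu>. Q (pd \<mu> h))"
      using h by (simp add: decay_add schwartz_decay differentiable_add schwartz_differentiable)
  qed
qed

lemma schwartz_bounded_linear:
  assumes L: "bounded_linear L" and f: "schwartz f"
  shows "schwartz (\<lambda>x. L (f x))"
proof -
  define Q where "Q h \<longleftrightarrow> (\<exists>f. schwartz f \<and> h = (\<lambda>x. L (f x)))" for h :: "real^'c \<Rightarrow> 'b"
  have "Q (\<lambda>x. L (f x))"
    using f unfolding Q_def by blast
  then show ?thesis
  proof (rule schwartz_coinduct)
    fix h assume "Q h"
    then obtain f where h: "schwartz f" "h = (\<lambda>x. L (f x))"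
      unfolding Q_def by blast
    have "pd \<mu> h = (\<lambda>x. L (pd \<mu> f x))" for \<mu>
      unfolding h(2) by (intro ext pd_bounded_linear L schwartz_differentiable h)
    then have "Q (pd \<mu> h)" for \<mu>
      unfolding Q_def using h schwartz_pd by blast
    then show "(\<forall>x. h differentiable (at x)) \<and> decay h \<and> (\<forall>\<mu>. Q (pd \<mu> h))"
      using h by (simp add: decay_bounded_linear[OF L] schwartz_decay
          differentiable_bounded_linear[OF L] schwartz_differentiable)
  qed
qed

lemma schwartz_scaleR: "schwartz f \<Longrightarrow> schwartz (\<lambda>x. c *\<^sub>R f x)"
  by (rule schwartz_bounded_linear[OF bounded_linear_scaleR_right])

lemma schwartz_minus: "schwartz f \<Longrightarrow> schwartz (\<lambda>x. - f x)"
  using schwartz_scaleR[of f "-1"] by simp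

lemma schwartz_diff: "schwartz f \<Longrightarrow> schwartz g \<Longrightarrow> schwartz (\<lambda>x. f x - g x)"
  using schwartz_add[OF _ schwartz_minus, of f g] by simp

lemma schwartz_zero: "schwartz (\<lambda>x. 0)"
proof -
  have "pd \<mu> (\<lambda>x. 0 :: 'b) = (\<lambda>x. 0)" for \<mu> :: 'a
    by (intro ext) (simp add: pd_eqI[OF has_derivative_const])
  then show ?thesis
    by (intro schwartz_coinduct[of "\<lambda>f. f = (\<lambda>x. 0)"]) (simp_all add: decay_def bounded_iff exI[of _ 0])
qed

lemma schwartz_sum:
  "(\<And>i. i \<in> A \<Longrightarrow> schwartz (f i)) \<Longrightarrow> schwartz (\<lambda>x. \<Sum>i\<in>A. f i x)"
  by (induction A rule: infinite_finite_induct) (simp_all add: schwartz_zero schwartz_add)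

text \<open>The Leibniz rule turns one product into a sum of two, so the products alone are not
  stable under differentiation; their finite sums are.\<close>

inductive prod_sum :: "(real^'n::finite \<Rightarrow> 'a::real_normed_algebra) \<Rightarrow> bool" where
  "schwartz f \<Longrightarrow> schwartz g \<Longrightarrow> prod_sum (\<lambda>x. f x * g x)"
| "prod_sum f \<Longrightarrow> prod_sum g \<Longrightarrow> prod_sum (\<lambda>x. f x + g x)"

lemma schwartz_mult:
  fixes f g :: "real^'n::finite \<Rightarrow> 'a::real_normed_algebra"
  assumes "schwartz f" "schwartz g"
  shows "schwartz (\<lambda>x. f x * g x)"
proof -
  have step: "(\<forall>x. h differentiable (at x)) \<and> decay h \<and> (\<forall>\<mu>. prod_sum (pd \<mu> h))"
    if "prod_sum h" for h :: "real^'n \<Rightarrow> 'a"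
    using that
  proof induction
    case (1 f g)
    then have "pd \<mu> (\<lambda>x. f x * g x) = (\<lambda>x. f x * pd \<mu> g x + pd \<mu> f x * g x)" for \<mu>
      by (intro ext pd_mult schwartz_differentiable)
    moreover have "(\<lambda>x. f x * g x) differentiable (at x)" for x
      by (intro differentiable_mult schwartz_differentiable 1)
    moreover have "prod_sum (\<lambda>x. f x * pd \<mu> g x + pd \<mu> f x * g x)" for \<mu>
      using 1 by (intro prod_sum.intros(2)[OF prod_sum.intros(1) prod_sum.intros(1)] schwartz_pd)
    ultimately show ?case
      using 1 by (simp add: decay_mult schwartz_decay)
  next
    case (2 f g)
    then have "pd \<mu> (\<lambda>x. f x + g x) = (\<lambda>x. pd \<mu> f x + pd \<mu> g x)" for \<mu>
      by (intro ext pd_add) auto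
    with 2 show ?case
      by (simp add: prod_sum.intros(2) decay_add differentiable_add)
  qed
  show ?thesis
    by (rule schwartz_coinduct[of prod_sum, OF prod_sum.intros(1)[OF assms] step])
qed

lemma borel_measurable_differentiable:
  "(\<And>x. f differentiable (at x)) \<Longrightarrow> f \<in> borel_measurable borel"
  by (simp add: borel_measurable_continuous_onI continuous_at_imp_continuous_on
      differentiable_imp_continuous_within)

lemma schwartz_borel_measurable: "schwartz f \<Longrightarrow> f \<in> borel_measurable borel"
  by (rule borel_measurable_differentiable[OF schwartz_differentiable])

lemma schwartz_integrable:
  fixes f :: "real^'n::finite \<Rightarrow> 'a::{banach,second_countable_topology}"
  shows "schwartz f \<Longrightarrow> integrable lborel f"
  by (simp add: integrable_decay schwartz_decay schwartz_borel_measurable)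

section \<open>Difference quotients, vanishing of surface terms, integration by parts\<close>

lemma has_vector_derivative_line:
  fixes f :: "real^'n::finite \<Rightarrow> 'a::real_normed_vector"
  assumes diff: "\<And>x. f differentiable (at x)"
  shows "((\<lambda>s. f (x + s *\<^sub>R axis \<mu> 1)) has_vector_derivative pd \<mu> f (x + s *\<^sub>R axis \<mu> 1)) (at s within S)"
proof -
  have "((\<lambda>s. x + s *\<^sub>R axis \<mu> 1) has_vector_derivative axis \<mu> 1) (at s within S)"
    by (auto intro!: derivative_eq_intros)
  moreover have "(f has_derivative frechet_derivative f (at (x + s *\<^sub>R axis \<mu> 1)))
      (at (x + s *\<^sub>R axis \<mu> 1) within (\<lambda>s. x + s *\<^sub>R axis \<mu> 1) ` S)"
    using frechet_derivative_has_derivative[OF diff] has_derivative_at_withinI by blast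
  ultimately show ?thesis
    using vector_derivative_diff_chain_within[of "\<lambda>s. x + s *\<^sub>R axis \<mu> 1" "axis \<mu> 1" s S f]
    by (simp add: pd_def o_def)
qed

text \<open>As a limit of a sequence of difference quotients, the derivative inherits measurability
  and membership in closed subspaces; the latter keeps derivatives of even fields even.\<close>

lemma pd_LIMSEQ:
  fixes f :: "real^'n::finite \<Rightarrow> 'a::real_normed_vector"
  assumes "\<And>x. f differentiable (at x)"
  shows "(\<lambda>n. of_nat (Suc n) *\<^sub>R (f (x + inverse (of_nat (Suc n)) *\<^sub>R axis \<mu> 1) - f x)) \<longlonglongrightarrow> pd \<mu> f x"
proof -
  let ?e = "axis \<mu> 1 :: real^'n"
  let ?q = "\<lambda>n. of_nat (Suc n) *\<^sub>R (f (x + inverse (of_nat (Suc n)) *\<^sub>R ?e) - f x)"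
  note line = has_vector_derivative_line[OF assms]
    let ?g = "\<lambda>s. f (x + s *\<^sub>R ?e)"
    have "((\<lambda>h. norm (?g (0 + h) - ?g 0 - h *\<^sub>R pd \<mu> f x) / norm h) \<longlongrightarrow> 0) (at 0)"
      using line[of x \<mu> 0 UNIV] unfolding has_vector_derivative_def has_derivative_at by simp
    moreover have "filterlim (\<lambda>n. inverse (real (Suc n))) (at 0) sequentially"
      by (intro filterlim_atI LIMSEQ_inverse_real_of_nat) auto
    ultimately have "(\<lambda>n. norm (?g (0 + inverse (real (Suc n))) - ?g 0
        - inverse (real (Suc n)) *\<^sub>R pd \<mu> f x) / norm (inverse (real (Suc n)))) \<longlonglongrightarrow> 0"
      by (rule filterlim_compose)
    moreover have "norm (?g (0 + inverse (real (Suc n))) - ?g 0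
        - inverse (real (Suc n)) *\<^sub>R pd \<mu> f x) / norm (inverse (real (Suc n)))
      = norm (?q n - pd \<mu> f x)" for n
    proof -
      have "?q n - pd \<mu> f x = real (Suc n) *\<^sub>R (?g (0 + inverse (real (Suc n))) - ?g 0
        - inverse (real (Suc n)) *\<^sub>R pd \<mu> f x)"
        unfolding scaleR_diff_right by (simp del: of_nat_Suc)
      then show ?thesis
        by (simp add: divide_inverse mult.commute del: of_nat_Suc)
    qed
    ultimately have "(\<lambda>n. norm (?q n - pd \<mu> f x)) \<longlonglongrightarrow> 0"
      by (simp only:)
    then show ?thesis
      by (rule LIM_zero_cancel[OF tendsto_norm_zero_cancel])
qed

lemma pd_in_closed_subspace:
  fixes f :: "real^'n::finite \<Rightarrow> 'a::real_normed_vector"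
  assumes "\<And>x. f differentiable (at x)" "subspace E" "closed E" "range f \<subseteq> E"
  shows "pd \<mu> f x \<in> E"
proof (rule closed_sequentially[OF assms(3) _ pd_LIMSEQ[OF assms(1)]])
  show "of_nat (Suc n) *\<^sub>R (f (x + inverse (of_nat (Suc n)) *\<^sub>R axis \<mu> 1) - f x) \<in> E" for n
    using assms(4) by (intro subspace_scale subspace_diff assms(2)) auto
qed

text \<open>By translation invariance every difference quotient has integral zero.\<close>

lemma integral_pd_eq_0:
  fixes f :: "real^'n::finite \<Rightarrow> 'a::{banach,second_countable_topology}"
  assumes diff: "\<And>x. f differentiable (at x)" and "decay f" and decay: "decay (pd \<mu> f)"
  shows "(LINT x|lborel. pd \<mu> f x) = 0"
proof -
  let ?e = "axis \<mu> 1 :: real^'n"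
  have [measurable]: "f \<in> borel_measurable borel"
    by (rule borel_measurable_differentiable[OF diff])
  have int: "integrable lborel f"
    by (rule integrable_decay) fact+
  have shift_int: "integrable lborel (\<lambda>x. f (x + t *\<^sub>R ?e))"
    and shift: "(LINT x|lborel. f (x + t *\<^sub>R ?e)) = integral\<^sup>L lborel f" for t
  proof -
    have d: "distr lborel borel ((+) (t *\<^sub>R ?e)) = lborel"
      by (rule lborel_distr_plus)
    have m: "(+) (t *\<^sub>R ?e) \<in> measurable lborel borel" by measurable
    show "integrable lborel (\<lambda>x. f (x + t *\<^sub>R ?e))"
      using integrable_distr[OF m, of f] int d by (simp add: add.commute)
    show "(LINT x|lborel. f (x + t *\<^sub>R ?e)) = integral\<^sup>L lborel f"
      using integral_distr[OF m, of f] d by (simp add: add.commute)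
  qed
  note line = has_vector_derivative_line[OF diff]
  define q where "q n x = of_nat (Suc n) *\<^sub>R (f (x + inverse (of_nat (Suc n)) *\<^sub>R ?e) - f x)" for n x
  let ?k = "2 * CARD('n)"
  obtain C where C: "C > 0" "\<And>x. norm (pd \<mu> f x) \<le> C / (1 + norm x) ^ ?k"
    using decay_bound[OF decay] by metis
  \<comment> \<open>By the mean value inequality the quotient at x is controlled by derivatives at
    points y within distance 1 of x. There 1 + norm y is at least half of 1 + norm x, and the
    halving costs the factor \<open>2 ^ ?k\<close>.\<close>
  have bound: "norm (q n x) \<le> C * 2 ^ ?k * (1 / (1 + norm x) ^ ?k)" for n x
  proof -
    define t where "t = inverse (real (Suc n))"
    have t: "0 < t" "t \<le> 1" by (auto simp: t_def field_simps)
    let ?B = "C * 2 ^ ?k * (1 / (1 + norm x) ^ ?k)"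
    have B: "norm (pd \<mu> f (x + s *\<^sub>R ?e)) \<le> ?B" if "s \<in> {0..t}" for s
    proof -
      have s: "0 \<le> s" "s \<le> t" "\<bar>s\<bar> = s" using that by auto
      have "norm x \<le> norm (x + s *\<^sub>R ?e) + \<bar>s\<bar>"
        using norm_triangle_ineq4[of "x + s *\<^sub>R ?e" "s *\<^sub>R ?e"] by (simp add: norm_axis_1)
      moreover have "(1 + a) / 2 \<le> 1 + b" if "a \<le> b + \<bar>s\<bar>" "0 \<le> b" for a b :: real
        using s t that by (simp add: field_simps)
      ultimately have "(1 + norm x) / 2 \<le> 1 + norm (x + s *\<^sub>R ?e)"
        by simp
      then have "((1 + norm x) / 2) ^ ?k \<le> (1 + norm (x + s *\<^sub>R ?e)) ^ ?k"
        by (intro power_mono) auto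
      then have "C / (1 + norm (x + s *\<^sub>R ?e)) ^ ?k \<le> C / ((1 + norm x) / 2) ^ ?k"
        using C(1) by (intro divide_left_mono mult_pos_pos zero_less_power) (auto intro: add_pos_nonneg)
      with C(2)[of "x + s *\<^sub>R ?e"] show ?thesis
        by (simp add: power_divide)
    qed
    have "norm (f (x + t *\<^sub>R ?e) - f (x + 0 *\<^sub>R ?e)) \<le> ?B * norm (t - 0)"
    proof (rule differentiable_bound[where S="{0..t}" and f'="\<lambda>s h. h *\<^sub>R pd \<mu> f (x + s *\<^sub>R ?e)"])
      show "((\<lambda>s. f (x + s *\<^sub>R ?e)) has_derivative (\<lambda>h. h *\<^sub>R pd \<mu> f (x + s *\<^sub>R ?e))) (at s within {0..t})" for s
        using line[of x \<mu> s "{0..t}"] by (simp add: has_vector_derivative_def)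
      show "onorm (\<lambda>h. h *\<^sub>R pd \<mu> f (x + s *\<^sub>R ?e)) \<le> ?B" if "s \<in> {0..t}" for s
      proof (rule onorm_bound)
        show "0 \<le> ?B" using B[OF that] norm_ge_zero order_trans by blast
        show "norm (h *\<^sub>R pd \<mu> f (x + s *\<^sub>R ?e)) \<le> ?B * norm h" for h
          unfolding norm_scaleR using mult_left_mono[OF B[OF that], of "\<bar>h\<bar>"]
          by (simp only: real_norm_def mult.commute[of ?B] abs_ge_zero)
      qed
    qed (use t in auto)
    then have "inverse t * norm (f (x + t *\<^sub>R ?e) - f x) \<le> ?B"
      using t by (simp add: field_simps)
    then show ?thesis
      by (simp add: q_def t_def)
  qed
  have "(\<lambda>n. integral\<^sup>L lborel (q n)) \<longlonglongrightarrow> integral\<^sup>L lborel (pd \<mu> f)"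
  proof (rule integral_dominated_convergence[where w="\<lambda>x. C * 2 ^ ?k * (1 / (1 + norm x) ^ ?k)"])
    have [measurable]: "q n \<in> borel_measurable borel" for n
      unfolding q_def by measurable
    show "q n \<in> borel_measurable lborel" for n by simp
    have lim: "(\<lambda>n. q n x) \<longlonglongrightarrow> pd \<mu> f x" for x
      unfolding q_def by (rule pd_LIMSEQ[OF diff])
    then show "AE x in lborel. (\<lambda>n. q n x) \<longlonglongrightarrow> pd \<mu> f x" by simp
    show "pd \<mu> f \<in> borel_measurable lborel"
      by (simp, rule borel_measurable_LIMSEQ_metric[where f=q]) (use lim in auto)
    show "integrable lborel (\<lambda>x::real^'n. C * 2 ^ ?k * (1 / (1 + norm x) ^ ?k))"
      by (intro integrable_mult_right integrable_weight)
    show "AE x in lborel. norm (q n x) \<le> C * 2 ^ ?k * (1 / (1 + norm x) ^ ?k)" for n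
      using bound by simp
  qed
  moreover have "integral\<^sup>L lborel (q n) = 0" for n
    unfolding q_def using int shift_int[of "inverse (real (Suc n))"] shift[of "inverse (real (Suc n))"]
    by simp
  ultimately show ?thesis
    by (simp add: LIMSEQ_const_iff)
qed

lemma integration_by_parts:
  fixes f g :: "real^'n::finite \<Rightarrow> 'a::{real_normed_algebra,banach,second_countable_topology}"
  assumes "schwartz f" "schwartz g"
  shows "(LINT x|lborel. f x * pd \<mu> g x) = - (LINT x|lborel. pd \<mu> f x * g x)"
proof -
  have s: "schwartz (\<lambda>x. f x * g x)" by (intro schwartz_mult assms)
  have "pd \<mu> (\<lambda>x. f x * g x) = (\<lambda>x. f x * pd \<mu> g x + pd \<mu> f x * g x)"
    by (intro ext pd_mult schwartz_differentiable assms)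
  moreover have "integral\<^sup>L lborel (pd \<mu> (\<lambda>x. f x * g x)) = 0"
    by (intro integral_pd_eq_0 schwartz_differentiable schwartz_decay schwartz_pd s)
  moreover have "integrable lborel (\<lambda>x. f x * pd \<mu> g x)" "integrable lborel (\<lambda>x. pd \<mu> f x * g x)"
    by (intro schwartz_integrable schwartz_mult schwartz_pd assms)+
  ultimately show ?thesis
    by (simp add: eq_neg_iff_add_eq_0)
qed

section \<open>Exchange and substitution of integrals; the transform of a Gaussian\<close>

section \<open>Gaussian integrals\<close>

text \<open>A product majorant suffices for every exchange below: one variable is controlled by a
  field, the other by a Gaussian or by a rapidly decreasing mode.\<close>

lemma fubini_dominated:
  fixes F :: "real^'n::finite \<Rightarrow> real^'n \<Rightarrow> 'a::{banach,second_countable_topology}"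
  assumes [measurable]: "case_prod F \<in> borel_measurable (borel \<Otimes>\<^sub>M borel)"
    and a: "integrable lborel a" and b: "integrable lborel b"
    and bound: "\<And>x y. norm (F x y) \<le> a x * b y"
  shows "(LINT x|lborel. LINT y|lborel. F x y) = (LINT y|lborel. LINT x|lborel. F x y)"
proof -
  have F: "case_prod F \<in> borel_measurable (lborel \<Otimes>\<^sub>M lborel)"
    by measurable
  have int_y: "integrable lborel (F x)" for x
  proof (rule Bochner_Integration.integrable_bound)
    show "integrable lborel (\<lambda>y. a x * b y)" by (intro integrable_mult_right b)
    show "AE y in lborel. norm (F x y) \<le> norm (a x * b y)"
      by (intro AE_I2 order_trans[OF bound]) simp
  qed measurable
  have "integrable (lborel \<Otimes>\<^sub>M lborel) (case_prod F)"
  proof (rule lborel_pair.Fubini_integrable[OF F])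
    show "integrable lborel (\<lambda>x. LINT y|lborel. norm (case_prod F (x, y)))"
    proof (rule Bochner_Integration.integrable_bound)
      show "integrable lborel (\<lambda>x. a x * integral\<^sup>L lborel b)" by (intro integrable_mult_left a)
      show "AE x in lborel. norm (LINT y|lborel. norm (case_prod F (x, y))) \<le> norm (a x * integral\<^sup>L lborel b)"
      proof (intro AE_I2)
        fix x
        have "(LINT y|lborel. norm (F x y)) \<le> (LINT y|lborel. a x * b y)"
          by (intro integral_mono integrable_norm int_y integrable_mult_right b bound)
        then show "norm (LINT y|lborel. norm (case_prod F (x, y))) \<le> norm (a x * integral\<^sup>L lborel b)"
          by (simp add: integral_nonneg)
      qed
    qed measurable
    show "AE x in lborel. integrable lborel (\<lambda>y. case_prod F (x, y))"
      using int_y by simp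
  qed
  from lborel_pair.Fubini_integral[OF this] show ?thesis by simp
qed

lemma lborel_integral_affine:
  fixes f :: "real^'n::finite \<Rightarrow> 'a::{banach,second_countable_topology}"
  assumes "c \<noteq> 0" and [measurable]: "f \<in> borel_measurable borel"
  shows "integral\<^sup>L lborel f = \<bar>c\<bar> ^ CARD('n) *\<^sub>R (LINT x|lborel. f (t + c *\<^sub>R x))"
proof -
  have "integral\<^sup>L lborel f = integral\<^sup>L (density (distr lborel borel (\<lambda>x. t + c *\<^sub>R x)) (\<lambda>_. ennreal (\<bar>c\<bar> ^ DIM(real^'n)))) f"
    by (subst lborel_affine[OF assms(1), of t]) simp
  also have "\<dots> = \<bar>c\<bar> ^ CARD('n) *\<^sub>R (LINT x|lborel. f (t + c *\<^sub>R x))"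
    by (subst integral_density) (auto simp: integral_distr)
  finally show ?thesis .
qed

lemma lborel_integrable_affine:
  fixes f :: "real^'n::finite \<Rightarrow> 'a::{banach,second_countable_topology}"
  assumes "c \<noteq> 0" and f: "integrable lborel f"
  shows "integrable lborel (\<lambda>x. f (t + c *\<^sub>R x))"
proof -
  have [measurable]: "f \<in> borel_measurable borel"
    using f by auto
  have "integrable (density (distr lborel borel (\<lambda>x. t + c *\<^sub>R x)) (\<lambda>_. ennreal (\<bar>c\<bar> ^ DIM(real^'n)))) f"
    using f by (subst (asm) lborel_affine[OF assms(1), of t])
  then have "integrable lborel (\<lambda>x. \<bar>c\<bar> ^ CARD('n) *\<^sub>R f (t + c *\<^sub>R x))"
    by (simp add: integrable_density integrable_distr_eq)
  then show ?thesis
    using integrable_scaleR_right[of "inverse (\<bar>c\<bar> ^ CARD('n))" lborel "\<lambda>x. \<bar>c\<bar> ^ CARD('n) *\<^sub>R f (t + c *\<^sub>R x)"] assms(1)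
    by simp
qed

text \<open>This is the characteristic function of the standard normal distribution, with the factor
  1 / sqrt (2 pi) of the density cleared.\<close>

lemma gauss_fourier_real:
  "integrable lborel (\<lambda>t. exp (- t\<^sup>2 / 2) *\<^sub>R cis (t * z))"
  "(LINT t|lborel. exp (- t\<^sup>2 / 2) *\<^sub>R cis (t * z)) = sqrt (2 * pi) * exp (- z\<^sup>2 / 2)"
proof -
  have eq: "std_normal_density t *\<^sub>R iexp (z * t) = (1 / sqrt (2 * pi)) *\<^sub>R (exp (- t\<^sup>2 / 2) *\<^sub>R cis (t * z))" for t
    by (simp add: std_normal_density_def cis_conv_exp mult.commute scaleR_conv_of_real)
  interpret real_distribution std_normal_distribution
    by (rule real_dist_normal_dist)
  have "integrable std_normal_distribution (\<lambda>t. iexp (z * t))"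
    by (rule integrable_iexp) auto
  then have "integrable lborel (\<lambda>t. std_normal_density t *\<^sub>R iexp (z * t))"
    by (subst (asm) integrable_density) auto
  then show int: "integrable lborel (\<lambda>t. exp (- t\<^sup>2 / 2) *\<^sub>R cis (t * z))"
    unfolding eq using integrable_scaleR_right[of "sqrt (2 * pi)"] by fastforce
  have "complex_of_real (exp (- z\<^sup>2 / 2)) = char std_normal_distribution z"
    by (simp add: char_std_normal_distribution)
  also have "\<dots> = (LINT t|lborel. std_normal_density t *\<^sub>R iexp (z * t))"
    unfolding char_def by (subst integral_density) auto
  also have "\<dots> = (1 / sqrt (2 * pi)) *\<^sub>R (LINT t|lborel. exp (- t\<^sup>2 / 2) *\<^sub>R cis (t * z))"
    unfolding eq by (rule integral_scaleR_right)
  finally show "(LINT t|lborel. exp (- t\<^sup>2 / 2) *\<^sub>R cis (t * z)) = sqrt (2 * pi) * exp (- z\<^sup>2 / 2)"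
    by (simp add: scaleR_conv_of_real field_simps)
qed

lemma cis_sum: "finite A \<Longrightarrow> cis (\<Sum>i\<in>A. f i) = (\<Prod>i\<in>A. cis (f i))"
  by (induction A rule: finite_induct) (auto simp: cis_mult[symmetric])

lemma gauss_fourier:
  fixes z :: "real^'n::finite"
  shows "integrable lborel (\<lambda>p::real^'n. exp (- (norm p)\<^sup>2 / 2) *\<^sub>R cis (p \<bullet> z))"
    and "(LINT p|lborel. exp (- (norm (p::real^'n))\<^sup>2 / 2) *\<^sub>R cis (p \<bullet> z))
      = sqrt (2 * pi) ^ CARD('n) * exp (- (norm z)\<^sup>2 / 2)"
proof -
  have sq: "(norm p)\<^sup>2 = (\<Sum>i\<in>UNIV. (p $ i)\<^sup>2)" for p :: "real^'n"
    unfolding power2_norm_eq_inner inner_vec_def by (simp add: power2_eq_square)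
  have ex: "exp (- (norm p)\<^sup>2 / 2) = (\<Prod>i\<in>UNIV. exp (- (p $ i)\<^sup>2 / 2))" for p :: "real^'n"
    unfolding sq by (simp add: exp_sum[symmetric] sum_negf sum_divide_distrib)
  have eq: "exp (- (norm p)\<^sup>2 / 2) *\<^sub>R cis (p \<bullet> z)
      = (\<Prod>i\<in>UNIV. exp (- (p $ i)\<^sup>2 / 2) *\<^sub>R cis (p $ i * z $ i))" for p :: "real^'n"
    unfolding ex by (simp add: inner_vec_def cis_sum scaleR_conv_of_real prod.distrib)
  show "integrable lborel (\<lambda>p::real^'n. exp (- (norm p)\<^sup>2 / 2) *\<^sub>R cis (p \<bullet> z))"
    unfolding eq by (rule integrable_prod_components) (rule gauss_fourier_real)
  show "(LINT p|lborel. exp (- (norm (p::real^'n))\<^sup>2 / 2) *\<^sub>R cis (p \<bullet> z))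
      = sqrt (2 * pi) ^ CARD('n) * exp (- (norm z)\<^sup>2 / 2)"
    unfolding eq ex[of z]
    by (subst integrable_prod_components(2)[OF gauss_fourier_real(1)], subst gauss_fourier_real(2))
      (simp add: prod.distrib)
qed

lemma gauss_integrable: "integrable lborel (\<lambda>p::real^'n::finite. exp (- (norm p)\<^sup>2 / 2))"
  using integrable_Re[OF gauss_fourier(1)[of 0]] by simp

lemma gauss_integral:
  "(LINT p|lborel. exp (- (norm (p::real^'n::finite))\<^sup>2 / 2)) = sqrt (2 * pi) ^ CARD('n)"
  using arg_cong[OF gauss_fourier(2)[of "0::real^'n"], of Re] integral_Re[OF gauss_fourier(1)[of "0::real^'n"]]
  by simp

section \<open>Phases built from J, decay of modes, Fourier inversion\<close>

section \<open>The Fourier transform\<close>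

locale imaginary_unit =
  fixes J :: "'a::{real_normed_algebra_1,banach,second_countable_topology}"
  assumes J_square: "J * J = - 1" and J_central: "J * x = x * J"
begin

text \<open>The unital homomorphism from the complex numbers that sends the imaginary unit to
  J.\<close>

definition cplx :: "complex \<Rightarrow> 'a" where
  "cplx z = Re z *\<^sub>R 1 + Im z *\<^sub>R J"

lemma bounded_linear_cplx: "bounded_linear cplx"
  unfolding cplx_def
  by (intro bounded_linear_add bounded_linear_compose[OF bounded_linear_scaleR_left]
      bounded_linear_Re bounded_linear_Im)

lemma cplx_mult: "cplx (z * w) = cplx z * cplx w"
  by (simp add: cplx_def algebra_simps J_square)

lemma cplx_1 [simp]: "cplx 1 = 1"
  by (simp add: cplx_def)

lemma cplx_of_real: "cplx (complex_of_real r) = of_real r"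
  by (simp add: cplx_def of_real_def)

lemma cplx_commute: "cplx z * x = x * cplx z"
  by (simp add: cplx_def algebra_simps J_central)

lemma cplx_exp: "cplx (exp z) = exp (cplx z)"
proof -
  have pow: "cplx (z ^ n) = cplx z ^ n" for n
    by (induction n) (simp_all add: cplx_mult)
  have "(\<lambda>n. cplx (z ^ n /\<^sub>R fact n)) sums cplx (exp z)"
    by (rule bounded_linear.sums[OF bounded_linear_cplx exp_converges])
  then have "(\<lambda>n. cplx z ^ n /\<^sub>R fact n) sums cplx (exp z)"
    by (simp add: pow linear_simps[OF bounded_linear_cplx])
  with exp_converges show ?thesis
    by (blast intro: sums_unique2)
qed

lemma exp_scaleR_J: "exp (t *\<^sub>R J) = cplx (cis t)"
  by (simp add: cis_conv_exp cplx_exp) (simp add: cplx_def)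

lemma cplx_cis: "cplx (cis t) = cos t *\<^sub>R 1 + sin t *\<^sub>R J"
  by (simp add: cplx_def)

text \<open>The norm of J may exceed 1, so phases are not isometries; later estimates pay this
  constant factor instead.\<close>

lemma norm_cplx_cis: "norm (cplx (cis t)) \<le> 1 + norm J"
proof -
  have "norm (cplx (cis t)) \<le> \<bar>cos t\<bar> * 1 + \<bar>sin t\<bar> * norm J"
    unfolding cplx_cis by (rule order_trans[OF norm_triangle_ineq]) simp
  also have "\<dots> \<le> 1 * 1 + 1 * norm J"
    by (intro add_mono mult_right_mono) auto
  finally show ?thesis by simp
qed

lemma norm_cplx_cis_mult: "norm (cplx (cis t) * y) \<le> (1 + norm J) * norm y"
  by (rule order_trans[OF norm_mult_ineq]) (intro mult_right_mono norm_cplx_cis norm_ge_zero)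

lemma continuous_cplx_cis [continuous_intros]:
  fixes f :: "'b::t2_space \<Rightarrow> real"
  shows "continuous_on S f \<Longrightarrow> continuous_on S (\<lambda>x. cplx (cis (f x)))"
  unfolding cplx_cis by (intro continuous_intros)

lemma measurable_cplx_cis [measurable]:
  "f \<in> borel_measurable M \<Longrightarrow> (\<lambda>x. cplx (cis (f x))) \<in> borel_measurable M"
  by (rule measurable_compose[OF _ borel_measurable_continuous_onI[OF continuous_cplx_cis[OF continuous_on_id]]])

lemma mode_eq: "mode J f p = (LINT x|lborel. cplx (cis (- (p \<bullet> x))) * f x)"
  unfolding mode_def exp_scaleR_J ..

lemma integrable_cplx_cis:
  fixes f :: "real^'n::finite \<Rightarrow> 'a"
  assumes "integrable lborel f" and [measurable]: "g \<in> borel_measurable borel"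
  shows "integrable lborel (\<lambda>x. cplx (cis (g x)) * f x)"
proof (rule Bochner_Integration.integrable_bound)
  have [measurable]: "f \<in> borel_measurable borel"
    using assms(1) by auto
  show "(\<lambda>x. cplx (cis (g x)) * f x) \<in> borel_measurable lborel" by measurable
  show "integrable lborel (\<lambda>x. (1 + norm J) * norm (f x))"
    by (intro integrable_mult_right integrable_norm assms)
  show "AE x in lborel. norm (cplx (cis (g x)) * f x) \<le> norm ((1 + norm J) * norm (f x))"
    by (intro AE_I2 order_trans[OF norm_cplx_cis_mult]) simp
qed

lemma norm_mode_le:
  assumes "integrable lborel f"
  shows "norm (mode J f p) \<le> (1 + norm J) * (LINT x|lborel. norm (f x))"
proof -
  have int: "integrable lborel (\<lambda>x. cplx (cis (- (p \<bullet> x))) * f x)"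
    by (intro integrable_cplx_cis assms) measurable
  have "norm (mode J f p) \<le> (LINT x|lborel. norm (cplx (cis (- (p \<bullet> x))) * f x))"
    unfolding mode_eq by (rule integral_norm_bound)
  also have "\<dots> \<le> (LINT x|lborel. (1 + norm J) * norm (f x))"
    by (intro integral_mono integrable_norm int integrable_mult_right assms norm_cplx_cis_mult)
  finally show ?thesis by simp
qed

lemma measurable_mode:
  assumes "integrable lborel f"
  shows "mode J f \<in> borel_measurable borel"
proof -
  have [measurable]: "f \<in> borel_measurable borel"
    using assms by auto
  have "(\<lambda>(p, x). cplx (cis (- (p \<bullet> x))) * f x) \<in> borel_measurable (borel \<Otimes>\<^sub>M lborel)"
    by measurable
  then show ?thesis
    unfolding mode_eq by (intro lborel.borel_measurable_lebesgue_integral)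
qed

text \<open>The derivative of phase times f integrates to zero, and the phase with exponent -(p . x)
  J has derivative -p_\<mu> J times itself. The two terms of the Leibniz rule therefore balance with
  a positive sign.\<close>

lemma mode_pd:
  assumes f: "schwartz f"
  shows "mode J (pd \<mu> f) p = p $ \<mu> *\<^sub>R (J * mode J f p)"
proof -
  define e where "e x = cplx (cis (- (p \<bullet> x)))" for x
  have e': "(e has_derivative (\<lambda>h. - (p \<bullet> h) *\<^sub>R (J * e x))) (at x)" for x
    unfolding e_def cplx_cis
    by (auto intro!: derivative_eq_intros simp: algebra_simps J_square)
  have e_diff: "e differentiable (at x)" for x
    using e' differentiableI by blast
  have pd_e: "pd \<mu> e x = - p $ \<mu> *\<^sub>R (J * e x)" for x
    by (simp add: pd_eqI[OF e'] inner_axis)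
  have pd_ef: "pd \<mu> (\<lambda>x. e x * f x) = (\<lambda>x. e x * pd \<mu> f x + - p $ \<mu> *\<^sub>R (J * (e x * f x)))"
    by (intro ext) (simp add: pd_mult[OF e_diff schwartz_differentiable[OF f]] pd_e mult.assoc)
  have dec: "decay (\<lambda>x. e x * g x)" if "decay g" for g
    unfolding e_def by (rule decay_dominated[OF that norm_cplx_cis_mult])
  have L: "bounded_linear (\<lambda>y. - p $ \<mu> *\<^sub>R (J * y))"
    by (intro bounded_linear_compose[OF bounded_linear_scaleR_right bounded_linear_mult_right])
  have "integral\<^sup>L lborel (pd \<mu> (\<lambda>x. e x * f x)) = 0"
  proof (rule integral_pd_eq_0)
    show "(\<lambda>x. e x * f x) differentiable (at x)" for x
      by (intro differentiable_mult e_diff schwartz_differentiable f)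
    show "decay (\<lambda>x. e x * f x)"
      by (intro dec schwartz_decay f)
    show "decay (pd \<mu> (\<lambda>x. e x * f x))"
      unfolding pd_ef by (intro decay_add dec schwartz_decay schwartz_pd f decay_bounded_linear[OF L])
  qed
  moreover have "integrable lborel (\<lambda>x. e x * g x)" if "schwartz g" for g
    unfolding e_def by (intro integrable_cplx_cis schwartz_integrable that) measurable
  ultimately show ?thesis
    using f schwartz_pd[OF f, of \<mu>] unfolding pd_ef mode_eq e_def[symmetric]
    by (simp add: eq_neg_iff_add_eq_0)
qed

text \<open>Each further power of the momentum is traded for a derivative: multiplying the mode of a
  derivative by J gives -p_\<mu> times the mode of f. The derivative is again Schwartz, so the
  induction has to run over all f at once.\<close>

lemma mode_bounded_pow:
  assumes "schwartz f"
  shows "\<exists>C. \<forall>p. (1 + norm p) ^ k * norm (mode J f p) \<le> C"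
  using assms
proof (induction k arbitrary: f)
  case 0
  then show ?case
    using norm_mode_le[OF schwartz_integrable] by auto
next
  case (Suc k)
  obtain C where C: "\<And>p. (1 + norm p) ^ k * norm (mode J f p) \<le> C"
    using Suc by blast
  have "\<forall>\<mu>. \<exists>C. \<forall>p. (1 + norm p) ^ k * norm (mode J (pd \<mu> f) p) \<le> C"
    using Suc schwartz_pd by blast
  then obtain D where D: "\<And>\<mu> p. (1 + norm p) ^ k * norm (mode J (pd \<mu> f) p) \<le> D \<mu>"
    by metis
  have "(1 + norm p) ^ Suc k * norm (mode J f p) \<le> C + (\<Sum>\<mu>\<in>UNIV. norm J * D \<mu>)" for p
  proof -
    have comp: "\<bar>p $ \<mu>\<bar> * norm (mode J f p) \<le> norm J * norm (mode J (pd \<mu> f) p)" for \<mu>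
    proof -
      have "J * mode J (pd \<mu> f) p = - (p $ \<mu> *\<^sub>R mode J f p)"
        by (simp add: mode_pd Suc.prems mult.assoc[symmetric] J_square)
      then have "\<bar>p $ \<mu>\<bar> * norm (mode J f p) = norm (J * mode J (pd \<mu> f) p)"
        by simp
      then show ?thesis
        by (simp add: norm_mult_ineq)
    qed
    have "(1 + norm p) * norm (mode J f p) \<le> (1 + (\<Sum>\<mu>\<in>UNIV. \<bar>p $ \<mu>\<bar>)) * norm (mode J f p)"
      by (intro mult_right_mono add_left_mono norm_le_l1_cart) auto
    also have "\<dots> = norm (mode J f p) + (\<Sum>\<mu>\<in>UNIV. \<bar>p $ \<mu>\<bar> * norm (mode J f p))"
      by (simp add: distrib_right sum_distrib_right)
    also have "\<dots> \<le> norm (mode J f p) + (\<Sum>\<mu>\<in>UNIV. norm J * norm (mode J (pd \<mu> f) p))"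
      by (intro add_left_mono sum_mono comp)
    finally have "(1 + norm p) ^ k * ((1 + norm p) * norm (mode J f p))
        \<le> (1 + norm p) ^ k * (norm (mode J f p) + (\<Sum>\<mu>\<in>UNIV. norm J * norm (mode J (pd \<mu> f) p)))"
      by (intro mult_left_mono) auto
    also have "\<dots> = (1 + norm p) ^ k * norm (mode J f p)
        + (\<Sum>\<mu>\<in>UNIV. norm J * ((1 + norm p) ^ k * norm (mode J (pd \<mu> f) p)))"
      by (simp add: distrib_left sum_distrib_left mult.left_commute)
    also have "\<dots> \<le> C + (\<Sum>\<mu>\<in>UNIV. norm J * D \<mu>)"
      by (intro add_mono sum_mono mult_left_mono C D norm_ge_zero)
    finally show ?thesis
      by (simp add: mult.assoc mult.left_commute)
  qed
  then show ?case by blast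
qed

lemma decay_mode: "schwartz f \<Longrightarrow> decay (mode J f)"
  using mode_bounded_pow[of f] unfolding decay_def bounded_iff by (auto simp: abs_of_nonneg)

lemma integrable_mode: "schwartz f \<Longrightarrow> integrable lborel (mode J f)"
  by (intro integrable_decay decay_mode measurable_mode schwartz_integrable)

text \<open>Inversion: regularise the momentum integral by a Gaussian of width \<open>1/\<delta>\<close> and let \<open>\<delta>\<close> tend to 0.\<close>

lemma regularised_inversion:
  assumes f: "schwartz f" and \<delta>: "\<delta> > 0"
  shows "(LINT p|lborel. exp (- (norm (\<delta> *\<^sub>R p))\<^sup>2 / 2) *\<^sub>R (cplx (cis (p \<bullet> x)) * mode J f p))
    = sqrt (2 * pi) ^ CARD('n::finite) *\<^sub>R
      (LINT w|lborel. exp (- (norm w)\<^sup>2 / 2) *\<^sub>R f (x + \<delta> *\<^sub>R (w :: real^'n)))"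
proof -
  let ?g = "\<lambda>p::real^'n. exp (- (norm (\<delta> *\<^sub>R p))\<^sup>2 / 2)"
  let ?c = "sqrt (2 * pi) ^ CARD('n)"
  note [measurable] = schwartz_borel_measurable[OF f]
  have [simp]: "\<delta> \<noteq> 0" using \<delta> by simp
  have mz: "(\<lambda>p. ?g p *\<^sub>R cis (p \<bullet> z)) \<in> borel_measurable borel" for z
    by (intro borel_measurable_continuous_onI continuous_intros) auto
  have gF: "(LINT p|lborel. ?g p *\<^sub>R cis (p \<bullet> z)) = (1 / \<delta>) ^ CARD('n) *\<^sub>R of_real (?c * exp (- (norm ((1/\<delta>) *\<^sub>R z))\<^sup>2 / 2))" for z
  proof -
    have "(LINT p|lborel. ?g p *\<^sub>R cis (p \<bullet> z)) = \<bar>1 / \<delta>\<bar> ^ CARD('n) *\<^sub>R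
        (LINT q|lborel. exp (- (norm (q::real^'n))\<^sup>2 / 2) *\<^sub>R cis (q \<bullet> ((1/\<delta>) *\<^sub>R z)))"
      by (subst lborel_integral_affine[where c="1/\<delta>" and t=0, OF _ mz]) simp_all
    then show ?thesis
      unfolding gauss_fourier(2) using \<delta> by simp
  qed
  have gint: "integrable lborel ?g"
    using lborel_integrable_affine[OF \<open>\<delta> \<noteq> 0\<close> gauss_integrable[where 'n='n], of 0] by simp
  have gF_int: "integrable lborel (\<lambda>p. ?g p *\<^sub>R cis (p \<bullet> z))" for z
  proof (rule Bochner_Integration.integrable_bound[OF gint])
    show "(\<lambda>p. ?g p *\<^sub>R cis (p \<bullet> z)) \<in> borel_measurable lborel"
      using mz[of z] by simp
  qed simp
  have "(LINT p|lborel. ?g p *\<^sub>R (cplx (cis (p \<bullet> x)) * mode J f p))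
      = (LINT p|lborel. LINT y|lborel. ?g p *\<^sub>R (cplx (cis (p \<bullet> (x - y))) * f y))"
  proof (rule Bochner_Integration.integral_cong[OF refl])
    fix p :: "real^'n"
    have "integrable lborel (\<lambda>y. cplx (cis (- (p \<bullet> y))) * f y)"
      by (intro integrable_cplx_cis schwartz_integrable f) measurable
    then have "cplx (cis (p \<bullet> x)) * mode J f p = (LINT y|lborel. cplx (cis (p \<bullet> x)) * (cplx (cis (- (p \<bullet> y))) * f y))"
      unfolding mode_eq by simp
    also have "\<dots> = (LINT y|lborel. cplx (cis (p \<bullet> (x - y))) * f y)"
      by (simp add: mult.assoc[symmetric] cplx_mult[symmetric] cis_mult inner_diff_right)
    finally show "?g p *\<^sub>R (cplx (cis (p \<bullet> x)) * mode J f p)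
        = (LINT y|lborel. ?g p *\<^sub>R (cplx (cis (p \<bullet> (x - y))) * f y))"
      by simp
  qed
  \<comment> \<open>The Gaussian is what makes the integrand absolutely integrable in p as well;
    this exchange is the purpose of the regularisation.\<close>
  also have "\<dots> = (LINT y|lborel. LINT p|lborel. ?g p *\<^sub>R (cplx (cis (p \<bullet> (x - y))) * f y))"
  proof (rule fubini_dominated)
    show "integrable lborel (\<lambda>p. ?g p * (1 + norm J))"
      by (intro integrable_mult_left gint)
    show "integrable lborel (\<lambda>y. norm (f y))"
      by (intro integrable_norm schwartz_integrable f)
    show "norm (?g p *\<^sub>R (cplx (cis (p \<bullet> (x - y))) * f y)) \<le> ?g p * (1 + norm J) * norm (f y)" for p y
      using mult_left_mono[OF norm_cplx_cis_mult[of "p \<bullet> (x - y)" "f y"], of "?g p"]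
      by (simp add: mult.assoc)
  qed measurable
  also have "\<dots> = (LINT y|lborel. ((1 / \<delta>) ^ CARD('n) * (?c * exp (- (norm ((1/\<delta>) *\<^sub>R (x - y)))\<^sup>2 / 2))) *\<^sub>R f y)"
  proof (rule Bochner_Integration.integral_cong[OF refl])
    fix y
    have "(LINT p|lborel. ?g p *\<^sub>R (cplx (cis (p \<bullet> (x - y))) * f y))
        = (LINT p|lborel. cplx (?g p *\<^sub>R cis (p \<bullet> (x - y))) * f y)"
      by (simp add: linear_simps[OF bounded_linear_cplx])
    also have "\<dots> = (LINT p|lborel. cplx (?g p *\<^sub>R cis (p \<bullet> (x - y)))) * f y"
      by (intro Bochner_Integration.integral_mult_left integrable_bounded_linear[OF bounded_linear_cplx] gF_int)
    also have "(LINT p|lborel. cplx (?g p *\<^sub>R cis (p \<bullet> (x - y)))) = cplx (LINT p|lborel. ?g p *\<^sub>R cis (p \<bullet> (x - y)))"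
      by (intro Bochner_Integration.integral_bounded_linear[OF bounded_linear_cplx] gF_int)
    finally show "(LINT p|lborel. ?g p *\<^sub>R (cplx (cis (p \<bullet> (x - y))) * f y))
        = ((1 / \<delta>) ^ CARD('n) * (?c * exp (- (norm ((1/\<delta>) *\<^sub>R (x - y)))\<^sup>2 / 2))) *\<^sub>R f y"
      unfolding gF by (simp only: linear_simps[OF bounded_linear_cplx] cplx_of_real) (simp add: of_real_def)
  qed
  \<comment> \<open>The substitution y = x + \<delta> w; its Jacobian cancels the power of
    1/\<delta> produced by the Gaussian transform.\<close>
  also have "\<dots> = \<delta> ^ CARD('n) *\<^sub>R (LINT w|lborel. ((1 / \<delta>) ^ CARD('n) * (?c * exp (- (norm w)\<^sup>2 / 2))) *\<^sub>R f (x + \<delta> *\<^sub>R w))"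
    using \<delta> by (subst lborel_integral_affine[where c=\<delta> and t=x]) simp_all
  also have "\<dots> = (LINT w|lborel. ?c *\<^sub>R (exp (- (norm w)\<^sup>2 / 2) *\<^sub>R f (x + \<delta> *\<^sub>R w)))"
    using \<delta> by (subst integral_scaleR_right[symmetric]) (simp add: power_one_over)
  finally show ?thesis unfolding integral_scaleR_right .
qed

theorem fourier_inversion:
  fixes f :: "real^'n::finite \<Rightarrow> 'a"
  assumes f: "schwartz f"
  shows "f x = mint (\<lambda>p. cplx (cis (p \<bullet> x)) * mode J f p)"
proof -
  let ?c = "sqrt (2 * pi) ^ CARD('n)"
  let ?d = "\<lambda>n. inverse (real (Suc n))"
  note [measurable] = schwartz_borel_measurable[OF f] measurable_mode[OF schwartz_integrable[OF f]]
  have d0: "?d \<longlonglongrightarrow> 0"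
    by (rule LIMSEQ_inverse_real_of_nat)
  obtain C where C: "\<And>x. norm (f x) \<le> C"
    using decay_bound[OF schwartz_decay[OF f], of 0] by auto
  have "(\<lambda>n. LINT p|lborel. exp (- (norm (?d n *\<^sub>R p))\<^sup>2 / 2) *\<^sub>R (cplx (cis (p \<bullet> x)) * mode J f p))
      \<longlonglongrightarrow> (LINT p|lborel. cplx (cis (p \<bullet> x)) * mode J f p)"
  proof (rule integral_dominated_convergence[where w="\<lambda>p. (1 + norm J) * norm (mode J f p)"])
    show "integrable lborel (\<lambda>p. (1 + norm J) * norm (mode J f p))"
      by (intro integrable_mult_right integrable_norm integrable_mode f)
    show "AE p in lborel. norm (exp (- (norm (?d n *\<^sub>R p))\<^sup>2 / 2) *\<^sub>R (cplx (cis (p \<bullet> x)) * mode J f p))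
        \<le> (1 + norm J) * norm (mode J f p)" for n
    proof (intro AE_I2)
      fix p
      have "exp (- (norm (?d n *\<^sub>R p))\<^sup>2 / 2) * norm (cplx (cis (p \<bullet> x)) * mode J f p) \<le> 1 * ((1 + norm J) * norm (mode J f p))"
        by (intro mult_mono norm_cplx_cis_mult) auto
      then show "norm (exp (- (norm (?d n *\<^sub>R p))\<^sup>2 / 2) *\<^sub>R (cplx (cis (p \<bullet> x)) * mode J f p))
        \<le> (1 + norm J) * norm (mode J f p)" by simp
    qed
    show "AE p in lborel. (\<lambda>n. exp (- (norm (?d n *\<^sub>R p))\<^sup>2 / 2) *\<^sub>R (cplx (cis (p \<bullet> x)) * mode J f p))
        \<longlonglongrightarrow> cplx (cis (p \<bullet> x)) * mode J f p"
    proof (intro AE_I2)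
      fix p
      have "(\<lambda>n. exp (- (norm (?d n *\<^sub>R p))\<^sup>2 / 2) *\<^sub>R (cplx (cis (p \<bullet> x)) * mode J f p))
        \<longlonglongrightarrow> exp (- (norm (0 *\<^sub>R p))\<^sup>2 / 2) *\<^sub>R (cplx (cis (p \<bullet> x)) * mode J f p)"
        by (intro tendsto_intros d0) auto
      then show "(\<lambda>n. exp (- (norm (?d n *\<^sub>R p))\<^sup>2 / 2) *\<^sub>R (cplx (cis (p \<bullet> x)) * mode J f p))
        \<longlonglongrightarrow> cplx (cis (p \<bullet> x)) * mode J f p" by simp
    qed
  qed measurable
  \<comment> \<open>In position space the Gaussian concentrates at x: continuity of f gives the
    limit and boundedness of f the majorant.\<close>
  moreover have "(\<lambda>n. LINT w|lborel. exp (- (norm w)\<^sup>2 / 2) *\<^sub>R f (x + ?d n *\<^sub>R w))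
      \<longlonglongrightarrow> (LINT w|lborel. exp (- (norm (w::real^'n))\<^sup>2 / 2) *\<^sub>R f x)"
  proof (rule integral_dominated_convergence[where w="\<lambda>w. exp (- (norm (w::real^'n))\<^sup>2 / 2) * C"])
    show "integrable lborel (\<lambda>w. exp (- (norm (w::real^'n))\<^sup>2 / 2) * C)"
      by (intro integrable_mult_left gauss_integrable)
    show "AE w in lborel. norm (exp (- (norm w)\<^sup>2 / 2) *\<^sub>R f (x + ?d n *\<^sub>R w)) \<le> exp (- (norm w)\<^sup>2 / 2) * C" for n
      by (intro AE_I2) (simp add: C)
    show "AE w in lborel. (\<lambda>n. exp (- (norm w)\<^sup>2 / 2) *\<^sub>R f (x + ?d n *\<^sub>R w)) \<longlonglongrightarrow> exp (- (norm w)\<^sup>2 / 2) *\<^sub>R f x"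
    proof (intro AE_I2 tendsto_scaleR tendsto_const)
      fix w
      have "(\<lambda>n. x + ?d n *\<^sub>R w) \<longlonglongrightarrow> x + 0 *\<^sub>R w"
        by (intro tendsto_intros d0)
      moreover have "isCont f x"
        by (intro differentiable_imp_continuous_within schwartz_differentiable f)
      ultimately show "(\<lambda>n. f (x + ?d n *\<^sub>R w)) \<longlonglongrightarrow> f x"
        by (auto intro: isCont_tendsto_compose)
    qed
  qed measurable
  then have "(\<lambda>n. ?c *\<^sub>R (LINT w|lborel. exp (- (norm w)\<^sup>2 / 2) *\<^sub>R f (x + ?d n *\<^sub>R w)))
      \<longlonglongrightarrow> ?c *\<^sub>R (LINT w|lborel. exp (- (norm (w::real^'n))\<^sup>2 / 2) *\<^sub>R f x)"
    by (intro tendsto_intros)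
  ultimately have "(LINT p|lborel. cplx (cis (p \<bullet> x)) * mode J f p)
      = ?c *\<^sub>R (LINT w|lborel. exp (- (norm (w::real^'n))\<^sup>2 / 2) *\<^sub>R f x)"
    unfolding regularised_inversion[OF f positive_imp_inverse_positive[OF of_nat_0_less_iff[THEN iffD2, OF zero_less_Suc]]]
    by (rule LIMSEQ_unique)
  also have "(LINT w|lborel. exp (- (norm (w::real^'n))\<^sup>2 / 2) *\<^sub>R f x) = ?c *\<^sub>R f x"
    unfolding integral_scaleR_left[OF gauss_integrable] gauss_integral ..
  \<comment> \<open>One factor \<open>?c\<close> comes from the transform of the Gaussian and one
    from its total mass; together they cancel the normalisation in \<open>mint\<close>.\<close>
  also have "?c *\<^sub>R ?c *\<^sub>R f x = (2 * pi) ^ CARD('n) *\<^sub>R f x"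
  proof -
    have "?c * ?c = (sqrt (2 * pi) * sqrt (2 * pi)) ^ CARD('n)"
      by (rule power_mult_distrib[symmetric])
    then show ?thesis by simp
  qed
  finally show ?thesis
    by (simp add: mint_def)
qed

end

section \<open>Parseval, convolution, and trilinear integrals with momentum conservation\<close>

lemma integrable_bounded_mult:
  fixes f g :: "'b::euclidean_space \<Rightarrow> 'a::{real_normed_algebra,banach,second_countable_topology}"
  assumes "f \<in> borel_measurable borel" and "\<And>x. norm (f x) \<le> C" and g: "integrable lborel g"
  shows "integrable lborel (\<lambda>x. f x * g x)" "integrable lborel (\<lambda>x. g x * f x)"
proof -
  have [measurable]: "g \<in> borel_measurable borel" "f \<in> borel_measurable borel"
    using g assms(1) by auto
  have C: "integrable lborel (\<lambda>x. C * norm (g x))"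
    by (intro integrable_mult_right integrable_norm g)
  have "norm (f x * g x) \<le> C * norm (g x)" for x
    by (rule order_trans[OF norm_mult_ineq]) (intro mult_right_mono assms norm_ge_zero)
  then show "integrable lborel (\<lambda>x. f x * g x)"
    by (intro Bochner_Integration.integrable_bound[OF C] AE_I2) (auto intro!: order_trans[OF _ abs_ge_self])
  have "norm (g x * f x) \<le> C * norm (g x)" for x
    by (rule order_trans[OF norm_mult_ineq]) (subst mult.commute, intro mult_right_mono assms norm_ge_zero)
  then show "integrable lborel (\<lambda>x. g x * f x)"
    by (intro Bochner_Integration.integrable_bound[OF C] AE_I2) (auto intro!: order_trans[OF _ abs_ge_self])
qed

lemma mint_scaleR: "mint (\<lambda>p. c *\<^sub>R f p) = c *\<^sub>R mint f"
  unfolding mint_def integral_scaleR_right by simp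

lemma mint_add:
  "integrable lborel f \<Longrightarrow> integrable lborel g \<Longrightarrow> mint (\<lambda>p. f p + g p) = mint f + mint g"
  by (simp add: mint_def scaleR_add_right)

lemma mint_sum:
  "(\<And>i. i \<in> A \<Longrightarrow> integrable lborel (f i)) \<Longrightarrow> mint (\<lambda>p. \<Sum>i\<in>A. f i p) = (\<Sum>i\<in>A. mint (f i))"
  by (simp add: mint_def scaleR_sum_right)

context imaginary_unit
begin

lemma integrable_mode_mult:
  assumes f: "integrable lborel f" and g: "schwartz g"
  shows "integrable lborel (\<lambda>p. mode J f (q - p) * mode J g p)"
proof (rule integrable_bounded_mult(1)[OF _ norm_mode_le[OF f] integrable_mode[OF g]])
  note [measurable] = measurable_mode[OF f]
  show "(\<lambda>p. mode J f (q - p)) \<in> borel_measurable borel" by measurable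
qed

text \<open>Only g is expanded by inversion, so f need merely be integrable. The formula can then be
  applied to f times a phase without showing that product to be Schwartz. Centrality of phases keeps
  f to the left of g.\<close>

theorem parseval:
  fixes f g :: "real^'n::finite \<Rightarrow> 'a"
  assumes f: "integrable lborel f" and g: "schwartz g"
  shows "(LINT x|lborel. f x * g x) = mint (\<lambda>p. mode J f (- p) * mode J g p)"
proof -
  let ?c = "1 / (2 * pi) ^ CARD('n)"
  note [measurable] = measurable_mode[OF schwartz_integrable[OF g]]
  have fm [measurable]: "f \<in> borel_measurable borel" using f by auto
  have int: "integrable lborel (\<lambda>p. cplx (cis (p \<bullet> x)) * mode J g p)" for x
    by (intro integrable_cplx_cis integrable_mode g) measurable
  have "(LINT x|lborel. f x * g x) = (LINT x|lborel. ?c *\<^sub>R (LINT p|lborel. f x * (cplx (cis (p \<bullet> x)) * mode J g p)))"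
    by (intro Bochner_Integration.integral_cong refl, subst fourier_inversion[OF g])
      (simp add: mint_def int)
  also have "\<dots> = ?c *\<^sub>R (LINT x|lborel. LINT p|lborel. f x * (cplx (cis (p \<bullet> x)) * mode J g p))"
    by (rule integral_scaleR_right)
  also have "(LINT x|lborel. LINT p|lborel. f x * (cplx (cis (p \<bullet> x)) * mode J g p))
      = (LINT p|lborel. LINT x|lborel. f x * (cplx (cis (p \<bullet> x)) * mode J g p))"
  proof (rule fubini_dominated)
    show "integrable lborel (\<lambda>x. norm (f x))" by (intro integrable_norm f)
    show "integrable lborel (\<lambda>p. (1 + norm J) * norm (mode J g p))"
      by (intro integrable_mult_right integrable_norm integrable_mode g)
    show "norm (f x * (cplx (cis (p \<bullet> x)) * mode J g p)) \<le> norm (f x) * ((1 + norm J) * norm (mode J g p))" for x p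
      by (rule order_trans[OF norm_mult_ineq]) (intro mult_left_mono norm_cplx_cis_mult norm_ge_zero)
  qed measurable
  also have "\<dots> = (LINT p|lborel. mode J f (- p) * mode J g p)"
  proof (rule Bochner_Integration.integral_cong[OF refl])
    fix p
    have "integrable lborel (\<lambda>x. cplx (cis (p \<bullet> x)) * f x)"
      by (intro integrable_cplx_cis f) measurable
    then have "(LINT x|lborel. (cplx (cis (p \<bullet> x)) * f x) * mode J g p) = (LINT x|lborel. cplx (cis (p \<bullet> x)) * f x) * mode J g p"
      by simp
    moreover have "(cplx (cis (p \<bullet> x)) * f x) * mode J g p = f x * (cplx (cis (p \<bullet> x)) * mode J g p)" for x
      by (simp add: cplx_commute mult.assoc)
    ultimately show "(LINT x|lborel. f x * (cplx (cis (p \<bullet> x)) * mode J g p)) = mode J f (- p) * mode J g p"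
      by (simp add: mode_eq)
  qed
  finally show ?thesis by (simp add: mint_def)
qed

lemma mode_modulated: "mode J (\<lambda>x. cplx (cis (- (q \<bullet> x))) * f x) p = mode J f (q + p)"
  unfolding mode_eq
  by (simp add: mult.assoc[symmetric] cplx_mult[symmetric] cis_mult inner_add_left algebra_simps)

text \<open>Parseval for f times the phase of momentum q; the mode of that product at -p is the mode
  of f at q - p.\<close>

lemma mode_mult:
  assumes f: "integrable lborel f" and g: "schwartz g"
  shows "mode J (\<lambda>x. f x * g x) q = mint (\<lambda>p. mode J f (q - p) * mode J g p)"
proof -
  have "integrable lborel (\<lambda>x. cplx (cis (- (q \<bullet> x))) * f x)"
    by (intro integrable_cplx_cis f) measurable
  from parseval[OF this g] show ?thesis
    unfolding mode_modulated by (simp add: mode_eq mult.assoc)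
qed

text \<open>The integrability conditions under which the iterated integral in
  \<open>mint_delta\<close> is additive, at the inner and at the outer level.\<close>

definition delta_integrable ::
  "(real^'n::finite \<Rightarrow> real^'n \<Rightarrow> real^'n \<Rightarrow> 'a) \<Rightarrow> bool" where
  "delta_integrable F \<longleftrightarrow> (\<forall>p1. integrable lborel (\<lambda>p2. F (- (p1 + p2)) p1 p2)) \<and>
     integrable lborel (\<lambda>p1. mint (\<lambda>p2. F (- (p1 + p2)) p1 p2))"

lemma delta_integrable_add:
  assumes "delta_integrable F" "delta_integrable G"
  shows "delta_integrable (\<lambda>k p1 p2. F k p1 p2 + G k p1 p2)"
    and "mint_delta (\<lambda>k p1 p2. F k p1 p2 + G k p1 p2) = mint_delta F + mint_delta G"
  using assms unfolding delta_integrable_def mint_delta_def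
  by (simp_all add: mint_add)

lemma delta_integrable_scaleR:
  assumes "delta_integrable F"
  shows "delta_integrable (\<lambda>k p1 p2. c *\<^sub>R F k p1 p2)"
    and "mint_delta (\<lambda>k p1 p2. c *\<^sub>R F k p1 p2) = c *\<^sub>R mint_delta F"
  using assms unfolding delta_integrable_def mint_delta_def
  by (simp_all add: mint_scaleR)

lemma delta_integrable_0: "delta_integrable (\<lambda>k p1 p2. 0)" "mint_delta (\<lambda>k p1 p2. 0) = 0"
  by (simp_all add: delta_integrable_def mint_delta_def mint_def)

lemma delta_integrable_sum:
  assumes "\<And>i. i \<in> A \<Longrightarrow> delta_integrable (F i)"
  shows "delta_integrable (\<lambda>k p1 p2. \<Sum>i\<in>A. F i k p1 p2)"
    and "mint_delta (\<lambda>k p1 p2. \<Sum>i\<in>A. F i k p1 p2) = (\<Sum>i\<in>A. mint_delta (F i))"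
  using assms
  by (induction A rule: infinite_finite_induct)
    (simp_all add: delta_integrable_0 delta_integrable_add)

text \<open>With k = -p1 - p2 the integral over p2 is a convolution and yields the mode of f g at
  -p1; the integral over p1 is then Parseval for f g and h. This is how momentum conservation
  encodes a product taken at one point.\<close>

lemma delta_integrable_modes:
  assumes f: "schwartz f" and g: "schwartz g" and h: "schwartz h"
  shows "delta_integrable (\<lambda>k p1 p2. mode J f k * mode J g p2 * mode J h p1)"
    and "mint_delta (\<lambda>k p1 p2. mode J f k * mode J g p2 * mode J h p1) = (LINT x|lborel. f x * g x * h x)"
proof -
  let ?F = "\<lambda>p1 p2. mode J f (- p1 - p2) * mode J g p2"
  have int: "integrable lborel (?F p1)" for p1
    by (intro integrable_mode_mult schwartz_integrable f g)
  have fg: "integrable lborel (\<lambda>x. f x * g x)"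
    by (intro schwartz_integrable schwartz_mult f g)
  have inner: "mint (\<lambda>p2. ?F p1 p2 * mode J h p1) = mode J (\<lambda>x. f x * g x) (- p1) * mode J h p1" for p1
    using int[of p1] mode_mult[OF schwartz_integrable[OF f] g, of "- p1"] by (simp add: mint_def)
  have "integrable lborel (\<lambda>p1. mode J (\<lambda>x. f x * g x) (- p1) * mode J h p1)"
    using integrable_mode_mult[OF fg h, of 0] by simp
  then show "delta_integrable (\<lambda>k p1 p2. mode J f k * mode J g p2 * mode J h p1)"
    unfolding delta_integrable_def using int by (simp add: inner)
  show "mint_delta (\<lambda>k p1 p2. mode J f k * mode J g p2 * mode J h p1) = (LINT x|lborel. f x * g x * h x)"
    unfolding mint_delta_def by (simp add: inner parseval[OF fg h])
qed

end

section \<open>The algebra of transverse and longitudinal kernels; the propagator\<close>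

section \<open>Spin projectors\<close>

locale projectors =
  fixes sg :: "'n::finite \<Rightarrow> real" and p :: "real^'n"
  assumes metric: "sg \<mu> = 1 \<or> sg \<mu> = - 1" and psq: "psq sg p \<noteq> 0"
begin

abbreviation "w \<equiv> omega sg p"
abbreviation "th \<equiv> theta sg p"

lemma sg_sq: "sg \<mu> * sg \<mu> = 1"
  using metric[of \<mu>] by auto

lemma w_sym: "w \<mu> \<nu> = w \<nu> \<mu>"
  by (simp add: omega_def mult.commute)

lemma eta_sym: "eta sg \<mu> \<nu> = eta sg \<nu> \<mu>"
  by (simp add: eta_def)

lemma th_sym: "th \<mu> \<nu> = th \<nu> \<mu>"
  by (simp add: theta_def w_sym[of \<mu>] eta_sym[of \<mu>])

text \<open>The matrix w has rank one, so the indices in a product of two of its entries may be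
  regrouped. This is the only relation among entries used in the kernel computations besides
  symmetry.\<close>

lemma w_swap: "w \<mu> \<alpha> * w \<nu> \<beta> = w \<mu> \<nu> * w \<alpha> \<beta>" "w \<mu> \<beta> * w \<nu> \<alpha> = w \<mu> \<nu> * w \<alpha> \<beta>"
  by (simp_all add: omega_def)

text \<open>A matrix acting on a vector, with \<open>sg\<close> raising the summed index. For this
  action \<open>eta\<close> is the identity, and \<open>th\<close> and \<open>w\<close> are
  complementary projections that annihilate each other.\<close>

definition comp :: "('n \<Rightarrow> 'n \<Rightarrow> real) \<Rightarrow> ('n \<Rightarrow> real) \<Rightarrow> 'n \<Rightarrow> real" where
  "comp A u \<mu> = (\<Sum>\<rho>\<in>UNIV. A \<mu> \<rho> * sg \<rho> * u \<rho>)"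

lemma comp_eta: "comp (eta sg) u \<mu> = u \<mu>"
proof -
  have "eta sg \<mu> \<rho> * sg \<rho> * u \<rho> = (if \<rho> = \<mu> then u \<mu> else 0)" for \<rho>
    using sg_sq[of \<mu>] by (simp add: eta_def)
  then show ?thesis by (simp add: comp_def)
qed

lemma comp_w: "comp w (\<lambda>\<rho>. w \<rho> \<alpha>) \<mu> = w \<mu> \<alpha>"
proof -
  have "w \<mu> \<rho> * sg \<rho> * w \<rho> \<alpha> = sg \<rho> * p $ \<rho> * p $ \<rho> * (w \<mu> \<alpha> / psq sg p)" for \<rho>
    by (simp add: omega_def)
  then have "comp w (\<lambda>\<rho>. w \<rho> \<alpha>) \<mu> = psq sg p * (w \<mu> \<alpha> / psq sg p)"
    unfolding comp_def psq_def sum_distrib_right by simp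
  then show ?thesis using psq by simp
qed

lemma comp_diff: "comp (\<lambda>\<mu> \<rho>. A \<mu> \<rho> - B \<mu> \<rho>) u \<mu> = comp A u \<mu> - comp B u \<mu>"
  "comp A (\<lambda>\<rho>. u \<rho> - v \<rho>) \<mu> = comp A u \<mu> - comp A v \<mu>"
  by (simp_all add: comp_def algebra_simps sum_subtractf)

lemma comp_w_eta: "comp w (\<lambda>\<rho>. eta sg \<rho> \<alpha>) \<mu> = w \<mu> \<alpha>"
proof -
  have "w \<mu> \<rho> * sg \<rho> * eta sg \<rho> \<alpha> = (if \<rho> = \<alpha> then w \<mu> \<alpha> else 0)" for \<rho>
    using sg_sq[of \<alpha>] by (simp add: eta_def)
  then show ?thesis by (simp add: comp_def)
qed

lemma th_fun: "th = (\<lambda>\<mu> \<nu>. eta sg \<mu> \<nu> - w \<mu> \<nu>)"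
  by (intro ext) (simp add: theta_def)

lemma comp_table:
  "comp th (\<lambda>\<rho>. th \<rho> \<alpha>) \<mu> = th \<mu> \<alpha>" "comp th (\<lambda>\<rho>. w \<rho> \<alpha>) \<mu> = 0"
  "comp w (\<lambda>\<rho>. th \<rho> \<alpha>) \<mu> = 0"
  by (simp_all add: th_fun comp_diff comp_eta comp_w comp_w_eta)

text \<open>A kernel whose last two indices are fixed is a matrix M. A kernel factor that couples
  each free index to one summed index transforms the two indices of M separately
  (\<open>act\<close>); a factor that couples the two summed indices to each other contracts M to a
  number (\<open>tr\<close>).\<close>

definition act where
  "act A B M \<mu> \<nu> = (\<Sum>\<rho>\<in>UNIV. \<Sum>\<sigma>\<in>UNIV. A \<mu> \<rho> * B \<nu> \<sigma> * sg \<rho> * sg \<sigma> * (M \<rho> \<sigma> :: real))"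

definition tr where
  "tr D M = (\<Sum>\<rho>\<in>UNIV. \<Sum>\<sigma>\<in>UNIV. D \<rho> \<sigma> * sg \<rho> * sg \<sigma> * (M \<rho> \<sigma> :: real))"

lemma act_linear:
  "act A B (\<lambda>\<rho> \<sigma>. M \<rho> \<sigma> + N \<rho> \<sigma>) \<mu> \<nu> = act A B M \<mu> \<nu> + act A B N \<mu> \<nu>"
  "act A B (\<lambda>\<rho> \<sigma>. c * M \<rho> \<sigma>) \<mu> \<nu> = c * act A B M \<mu> \<nu>"
  by (simp_all add: act_def algebra_simps sum.distrib sum_distrib_left)

lemma tr_linear:
  "tr D (\<lambda>\<rho> \<sigma>. M \<rho> \<sigma> + N \<rho> \<sigma>) = tr D M + tr D N"
  "tr D (\<lambda>\<rho> \<sigma>. c * M \<rho> \<sigma>) = c * tr D M"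
  by (simp_all add: tr_def algebra_simps sum.distrib sum_distrib_left)

lemma act_outer: "act A B (\<lambda>\<rho> \<sigma>. u \<rho> * v \<sigma>) \<mu> \<nu> = comp A u \<mu> * comp B v \<nu>"
  unfolding act_def comp_def sum_product by (simp add: mult_ac)

lemma act_matrix: "act A B M \<mu> \<nu> = comp A (\<lambda>\<rho>. comp B (\<lambda>\<sigma>. M \<rho> \<sigma>) \<nu>) \<mu>"
  by (simp add: act_def comp_def sum_distrib_left mult_ac)

lemma tr_outer: "tr D (\<lambda>\<rho> \<sigma>. u \<rho> * v \<sigma>) = (\<Sum>\<rho>\<in>UNIV. sg \<rho> * u \<rho> * comp D v \<rho>)"
  by (simp add: tr_def comp_def sum_distrib_left mult_ac)

lemma comp_0: "comp A (\<lambda>\<rho>. 0) \<mu> = 0"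
  by (simp add: comp_def)

lemma comp_table':
  "comp th (\<lambda>\<sigma>. th \<alpha> \<sigma>) \<mu> = th \<mu> \<alpha>" "comp th (\<lambda>\<sigma>. w \<alpha> \<sigma>) \<mu> = 0"
  "comp w (\<lambda>\<sigma>. th \<alpha> \<sigma>) \<mu> = 0" "comp w (\<lambda>\<sigma>. w \<alpha> \<sigma>) \<mu> = w \<mu> \<alpha>"
  by (simp_all only: th_sym[of \<alpha>] w_sym[of \<alpha>] comp_table comp_w)

lemma act_table:
  "act th th th \<mu> \<nu> = th \<mu> \<nu>" "act th th w \<mu> \<nu> = 0" "act th w th \<mu> \<nu> = 0" "act th w w \<mu> \<nu> = 0"
  "act w th th \<mu> \<nu> = 0" "act w th w \<mu> \<nu> = 0"
  by (simp_all only: act_matrix comp_table' comp_0 th_sym[of \<nu>] w_sym[of \<nu>] comp_table comp_w)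

lemma tr_table:
  "tr th th = real CARD('n) - 1" "tr th w = 0" "tr w th = 0" "tr w w = 1"
proof -
  have tr_comp: "tr A B = (\<Sum>\<rho>\<in>UNIV. sg \<rho> * comp A (\<lambda>\<sigma>. B \<rho> \<sigma>) \<rho>)"
    if "\<And>\<rho> \<sigma>. A \<rho> \<sigma> = A \<sigma> \<rho>" for A B
    by (simp add: tr_def comp_def sum_distrib_left mult_ac)
  have "sg \<rho> * w \<rho> \<rho> = sg \<rho> * p $ \<rho> * p $ \<rho> / psq sg p" for \<rho>
    by (simp add: omega_def)
  then have "(\<Sum>\<rho>\<in>UNIV. sg \<rho> * w \<rho> \<rho>) = psq sg p / psq sg p"
    by (simp only: sum_divide_distrib[symmetric] psq_def)
  then have ww: "(\<Sum>\<rho>\<in>UNIV. sg \<rho> * w \<rho> \<rho>) = 1"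
    using psq by simp
  have "sg \<rho> * th \<rho> \<rho> = 1 - sg \<rho> * w \<rho> \<rho>" for \<rho>
    using sg_sq[of \<rho>] by (simp add: theta_def eta_def algebra_simps)
  then have "(\<Sum>\<rho>\<in>UNIV. sg \<rho> * th \<rho> \<rho>) = real CARD('n) - 1"
    using ww by (simp add: sum_subtractf)
  with ww show "tr th th = real CARD('n) - 1" "tr th w = 0" "tr w th = 0" "tr w w = 1"
    by (simp_all add: tr_comp[OF th_sym] tr_comp[OF w_sym] comp_table')
qed

lemma tr_outer_table:
  "tr th (\<lambda>\<rho> \<sigma>. th \<rho> \<alpha> * th \<sigma> \<beta>) = th \<alpha> \<beta>" "tr w (\<lambda>\<rho> \<sigma>. th \<rho> \<alpha> * th \<sigma> \<beta>) = 0"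
  "tr th (\<lambda>\<rho> \<sigma>. th \<rho> \<alpha> * w \<sigma> \<beta>) = 0" "tr w (\<lambda>\<rho> \<sigma>. th \<rho> \<alpha> * w \<sigma> \<beta>) = 0"
  "tr th (\<lambda>\<rho> \<sigma>. w \<rho> \<alpha> * th \<sigma> \<beta>) = 0" "tr w (\<lambda>\<rho> \<sigma>. w \<rho> \<alpha> * th \<sigma> \<beta>) = 0"
proof -
  have c: "(\<Sum>\<rho>\<in>UNIV. sg \<rho> * th \<rho> \<alpha> * u \<rho>) = comp th u \<alpha>"
    "(\<Sum>\<rho>\<in>UNIV. sg \<rho> * w \<rho> \<alpha> * u \<rho>) = comp w u \<alpha>" for u
    unfolding comp_def by (simp_all add: th_sym[of \<alpha>] w_sym[of \<alpha>] mult_ac)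
  show "tr th (\<lambda>\<rho> \<sigma>. th \<rho> \<alpha> * th \<sigma> \<beta>) = th \<alpha> \<beta>" "tr w (\<lambda>\<rho> \<sigma>. th \<rho> \<alpha> * th \<sigma> \<beta>) = 0"
    "tr th (\<lambda>\<rho> \<sigma>. th \<rho> \<alpha> * w \<sigma> \<beta>) = 0" "tr w (\<lambda>\<rho> \<sigma>. th \<rho> \<alpha> * w \<sigma> \<beta>) = 0"
    "tr th (\<lambda>\<rho> \<sigma>. w \<rho> \<alpha> * th \<sigma> \<beta>) = 0" "tr w (\<lambda>\<rho> \<sigma>. w \<rho> \<alpha> * th \<sigma> \<beta>) = 0"
    by (simp_all only: tr_outer c comp_table comp_w comp_0)
qed

text \<open>
  A basis closed under products: \<open>a\<close> multiplies \<open>P\<^sup>2 + P\<^sup>0\<close>, the identity on symmetric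
  transverse tensors, and the last four coefficients are those of \<open>\<theta>\<theta>\<close>, \<open>\<theta>\<omega>\<close>, \<open>\<omega>\<theta>\<close>, \<open>\<omega>\<omega>\<close>.
\<close>

definition spin_op :: "real \<Rightarrow> real \<Rightarrow> real \<Rightarrow> real \<Rightarrow> real \<Rightarrow> real \<Rightarrow> 'n kernel" where
  "spin_op a b t m m' c \<mu> \<nu> \<alpha> \<beta> =
     a / 2 * (th \<mu> \<alpha> * th \<nu> \<beta>) + a / 2 * (th \<mu> \<beta> * th \<nu> \<alpha>)
     + (b / 2 * (th \<mu> \<alpha> * w \<nu> \<beta>) + b / 2 * (th \<mu> \<beta> * w \<nu> \<alpha>)
       + b / 2 * (th \<nu> \<alpha> * w \<mu> \<beta>) + b / 2 * (th \<nu> \<beta> * w \<mu> \<alpha>))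
     + (t * th \<alpha> \<beta> + m * w \<alpha> \<beta>) * th \<mu> \<nu> + (m' * th \<alpha> \<beta> + c * w \<alpha> \<beta>) * w \<mu> \<nu>"

lemma spin_op_cong:
  "a = a2 \<Longrightarrow> b = b2 \<Longrightarrow> t = t2 \<Longrightarrow> m = m2 \<Longrightarrow> m' = m2' \<Longrightarrow> c = c2 \<Longrightarrow>
    spin_op a b t m m' c = spin_op a2 b2 t2 m2 m2' c2"
  by simp

lemma spin_op_apply:
  "(\<Sum>\<rho>\<in>UNIV. \<Sum>\<sigma>\<in>UNIV. spin_op a b t m m' c \<mu> \<nu> \<rho> \<sigma> * sg \<rho> * sg \<sigma> * M \<rho> \<sigma>) =
     a / 2 * (act th th M \<mu> \<nu> + act th th M \<nu> \<mu>)
     + b / 2 * (act th w M \<mu> \<nu> + act w th M \<nu> \<mu> + act th w M \<nu> \<mu> + act w th M \<mu> \<nu>)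
     + (t * tr th M + m * tr w M) * th \<mu> \<nu> + (m' * tr th M + c * tr w M) * w \<mu> \<nu>"
  unfolding spin_op_def act_def tr_def
  by (simp add: algebra_simps sum.distrib sum_distrib_left)

text \<open>The coefficients a and b multiply separately. The remaining four multiply like a 2 x 2
  block, weighted by the traces d - 1 of theta and 1 of omega; the terms with a arise because theta
  itself is a symmetric transverse tensor.\<close>

lemma op_mult_spin_op:
  "op_mult sg (spin_op a1 b1 t1 m1 m1' c1) (spin_op a2 b2 t2 m2 m2' c2) =
     spin_op (a1 * a2) (b1 * b2)
       (a1 * t2 + t1 * a2 + (real CARD('n) - 1) * t1 * t2 + m1 * m2')
       (a1 * m2 + (real CARD('n) - 1) * t1 * m2 + m1 * c2)
       (m1' * a2 + (real CARD('n) - 1) * m1' * t2 + c1 * m2')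
       (c1 * c2 + (real CARD('n) - 1) * m1' * m2)"
proof (intro ext)
  fix \<mu> \<nu> \<alpha> \<beta>
  \<comment> \<open>The mixed terms are reordered so that the factor carrying \<rho> precedes the
    one carrying \<sigma>, the outer-product shape expected by \<open>act_outer\<close> and
    \<open>tr_outer\<close>.\<close>
  have col: "(\<lambda>\<rho> \<sigma>. spin_op a b t m m' c \<rho> \<sigma> \<alpha> \<beta>) = (\<lambda>\<rho> \<sigma>.
     a / 2 * (th \<rho> \<alpha> * th \<sigma> \<beta>) + a / 2 * (th \<rho> \<beta> * th \<sigma> \<alpha>)
     + (b / 2 * (th \<rho> \<alpha> * w \<sigma> \<beta>) + b / 2 * (th \<rho> \<beta> * w \<sigma> \<alpha>)
       + b / 2 * (w \<rho> \<beta> * th \<sigma> \<alpha>) + b / 2 * (w \<rho> \<alpha> * th \<sigma> \<beta>))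
     + (t * th \<alpha> \<beta> + m * w \<alpha> \<beta>) * th \<rho> \<sigma> + (m' * th \<alpha> \<beta> + c * w \<alpha> \<beta>) * w \<rho> \<sigma>)" for a b t m m' c
    by (intro ext) (simp add: spin_op_def mult.commute)
  define M where "M = (\<lambda>\<rho> \<sigma>. spin_op a2 b2 t2 m2 m2' c2 \<rho> \<sigma> \<alpha> \<beta>)"
  define U where "U = t2 * th \<alpha> \<beta> + m2 * w \<alpha> \<beta>"
  define V where "V = m2' * th \<alpha> \<beta> + c2 * w \<alpha> \<beta>"
  define N where "N = real CARD('n) - 1"
  note M = M_def[unfolded col U_def[symmetric] V_def[symmetric]]
  note table = act_linear tr_linear act_outer comp_table comp_w act_table
    tr_table[folded N_def] tr_outer_table
  have thth: "act th th M \<rho> \<sigma> = a2 / 2 * (th \<rho> \<alpha> * th \<sigma> \<beta> + th \<rho> \<beta> * th \<sigma> \<alpha>) + U * th \<rho> \<sigma>" for \<rho> \<sigma>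
    unfolding M by (simp only: table) (simp add: distrib_left)
  have thw: "act th w M \<rho> \<sigma> = b2 / 2 * (th \<rho> \<alpha> * w \<sigma> \<beta> + th \<rho> \<beta> * w \<sigma> \<alpha>)" for \<rho> \<sigma>
    unfolding M by (simp only: table) (simp add: distrib_left)
  have wth: "act w th M \<rho> \<sigma> = b2 / 2 * (th \<sigma> \<alpha> * w \<rho> \<beta> + th \<sigma> \<beta> * w \<rho> \<alpha>)" for \<rho> \<sigma>
    unfolding M by (simp only: table) (simp add: distrib_left mult.commute)
  have trth: "tr th M = a2 * th \<alpha> \<beta> + N * U"
    unfolding M by (simp only: table) (simp add: th_sym[of \<beta> \<alpha>] mult.commute)
  have trw: "tr w M = V"
    unfolding M by (simp only: table mult_zero_left mult_zero_right mult_1 mult_1_right add_0 add_0_right)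
  have "op_mult sg (spin_op a1 b1 t1 m1 m1' c1) (spin_op a2 b2 t2 m2 m2' c2) \<mu> \<nu> \<alpha> \<beta>
    = a1 * (a2 / 2 * (th \<mu> \<alpha> * th \<nu> \<beta> + th \<mu> \<beta> * th \<nu> \<alpha>) + U * th \<mu> \<nu>)
      + b1 / 2 * (b2 * (th \<mu> \<alpha> * w \<nu> \<beta> + th \<mu> \<beta> * w \<nu> \<alpha> + th \<nu> \<alpha> * w \<mu> \<beta> + th \<nu> \<beta> * w \<mu> \<alpha>))
      + (t1 * (a2 * th \<alpha> \<beta> + N * U) + m1 * V) * th \<mu> \<nu>
      + (m1' * (a2 * th \<alpha> \<beta> + N * U) + c1 * V) * w \<mu> \<nu>"
  proof -
    have "act th th M \<mu> \<nu> + act th th M \<nu> \<mu>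
        = 2 * (a2 / 2 * (th \<mu> \<alpha> * th \<nu> \<beta> + th \<mu> \<beta> * th \<nu> \<alpha>) + U * th \<mu> \<nu>)"
      unfolding thth th_sym[of \<nu> \<mu>] by (simp add: algebra_simps)
    moreover have "act th w M \<mu> \<nu> + act w th M \<nu> \<mu> + act th w M \<nu> \<mu> + act w th M \<mu> \<nu>
        = b2 * (th \<mu> \<alpha> * w \<nu> \<beta> + th \<mu> \<beta> * w \<nu> \<alpha> + th \<nu> \<alpha> * w \<mu> \<beta> + th \<nu> \<beta> * w \<mu> \<alpha>)"
      unfolding thw wth by (simp add: distrib_left)
    ultimately show ?thesis
      unfolding op_mult_def spin_op_apply[where M="\<lambda>\<rho> \<sigma>. spin_op a2 b2 t2 m2 m2' c2 \<rho> \<sigma> \<alpha> \<beta>"] M_def[symmetric]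
        trth trw by simp
  qed
  then show "op_mult sg (spin_op a1 b1 t1 m1 m1' c1) (spin_op a2 b2 t2 m2 m2' c2) \<mu> \<nu> \<alpha> \<beta> =
     spin_op (a1 * a2) (b1 * b2)
       (a1 * t2 + t1 * a2 + (real CARD('n) - 1) * t1 * t2 + m1 * m2')
       (a1 * m2 + (real CARD('n) - 1) * t1 * m2 + m1 * c2)
       (m1' * a2 + (real CARD('n) - 1) * m1' * t2 + c1 * m2')
       (c1 * c2 + (real CARD('n) - 1) * m1' * m2) \<mu> \<nu> \<alpha> \<beta>"
    unfolding N_def[symmetric] spin_op_def U_def V_def by (simp add: algebra_simps)
qed

lemma op_id_spin_op: "op_id sg = spin_op 1 1 0 0 0 1"
proof (intro ext)
  fix \<mu> \<nu> \<alpha> \<beta>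
  have e: "eta sg \<rho> \<sigma> = th \<rho> \<sigma> + w \<rho> \<sigma>" for \<rho> \<sigma>
    by (simp add: theta_def)
  show "op_id sg \<mu> \<nu> \<alpha> \<beta> = spin_op 1 1 0 0 0 1 \<mu> \<nu> \<alpha> \<beta>"
    unfolding op_id_def spin_op_def e
    using w_swap(1)[of \<mu> \<alpha> \<nu> \<beta>] w_swap(2)[of \<mu> \<beta> \<nu> \<alpha>] by algebra
qed

text \<open>\<open>NP2\<close> is the identity on symmetric transverse tensors minus
  \<open>NP0\<close>, which leaves (x0 - 1) / 3 for theta theta. The conventional factors 1/3
  disappear here, so the product computation is uniform in d.\<close>

lemma Nieuwenhuizen_spin_op:
  "x0 * NP0 sg p \<mu> \<nu> \<alpha> \<beta> + x1 * NP1 sg p \<mu> \<nu> \<alpha> \<beta> + NP2 sg p \<mu> \<nu> \<alpha> \<beta>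
     - y * NP0bar sg p \<mu> \<nu> \<alpha> \<beta> - z * NP0barbar sg p \<mu> \<nu> \<alpha> \<beta>
   = spin_op 1 x1 ((x0 - 1) / 3) (- z) (- z) (- y) \<mu> \<nu> \<alpha> \<beta>"
  by (simp add: NP0_def NP1_def NP2_def NP0bar_def NP0barbar_def spin_op_def field_simps)

lemma spin_op_scale:
  "k * spin_op a b t m m' c \<mu> \<nu> \<alpha> \<beta> = spin_op (k * a) (k * b) (k * t) (k * m) (k * m') (k * c) \<mu> \<nu> \<alpha> \<beta>"
  by (simp add: spin_op_def algebra_simps)

text \<open>Put p p = p^2 w and eta = th + w. Up to the factor k, the derivative terms of
  \<open>Pker\<close> give -P1 - 2 P0bar and its identity term contains P1 + P0bar, so P1 cancels:
  this is gauge invariance. The gauge-fixing kernel adds (P1/2 + P0bar) / \<epsilon> and restores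
  it.\<close>

lemma Peps_spin_op:
  fixes \<kappa> \<epsilon> :: real
  assumes "\<epsilon> \<noteq> 0"
  defines "k \<equiv> \<kappa> powi (4 - int CARD('n)) * psq sg p" and "D \<equiv> real CARD('n) - 2"
  shows "Peps sg \<kappa> \<epsilon> p \<mu> \<nu> \<alpha> \<beta> = k * spin_op 1 (1 / (2 * \<epsilon>)) (- 1 / D) (- 1 / D) (- 1 / D)
      (- 1 - 1 / D + 1 / \<epsilon>) \<mu> \<nu> \<alpha> \<beta>"
proof -
  have pp: "p $ \<rho> * p $ \<sigma> = psq sg p * w \<rho> \<sigma>" for \<rho> \<sigma>
    using psq by (simp add: omega_def)
  have pp': "x * p $ \<rho> * p $ \<sigma> = x * psq sg p * w \<rho> \<sigma>" for x \<rho> \<sigma>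
    using psq by (simp add: omega_def)
  have e: "eta sg \<rho> \<sigma> = th \<rho> \<sigma> + w \<rho> \<sigma>" for \<rho> \<sigma>
    by (simp add: theta_def)
  define K where "K = \<kappa> powi (4 - int CARD('n))"
  define q where "q = psq sg p"
  define I where "I = 1 / D"
  define E where "E = 1 / \<epsilon>"
  have E: "x / \<epsilon> = x * E" "1 / (2 * \<epsilon>) = E / 2" for x
    by (simp_all add: E_def)
  have I: "x / D = x * I" for x
    by (simp add: I_def)
  \<comment> \<open>Unprimed letters stand for entries of w, primed ones for the corresponding
    entries of th. With rank one expressed by the two premises, the claim is a polynomial
    identity.\<close>
  have ring: "K * (- 1 / 2 * (q * a * (b' + b) + q * c * (d' + d) + q * d * (c' + c) + q * b * (a' + a))
      + q * (1 / 2 * ((a' + a) * (b' + b) + (c' + c) * (d' + d)) - 1 * I * (e' + e) * (f' + f)))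
      + K * E * (1 / 4) * ((a' + a) * q * b + (c' + c) * q * d + (d' + d) * q * c + (b' + b) * q * a)
    = K * q * (1 / 2 * a' * b' + 1 / 2 * c' * d'
      + (E / 2 / 2 * a' * b + E / 2 / 2 * c' * d + E / 2 / 2 * d' * c + E / 2 / 2 * b' * a)
      + (- 1 * I * f' + - 1 * I * f) * e' + (- 1 * I * f' + (- 1 - 1 * I + 1 * E) * f) * e)"
    if "a * b = e * f" "c * d = e * f" for a b c d e f a' b' c' d' e' f' :: real
  proof -
    have assoc: "a * (b * x) = e * (f * x)" "c * (d * x) = e * (f * x)" for x
      using that by (simp_all add: mult.assoc[symmetric])
    show ?thesis
      by (simp add: algebra_simps that assoc)
  qed
  show ?thesis
    unfolding Peps_def Pker_def gf_ker_def k_def spin_op_def D_def[symmetric] K_def[symmetric]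
    unfolding e mult.assoc[symmetric] pp pp' th_sym[of \<alpha> \<nu>] w_sym[of \<alpha> \<nu>]
    unfolding q_def[symmetric] E I
    by (rule ring; rule w_swap)
qed

text \<open>Since eta eta = 3 P0 + P0bar + P0barbar, the coefficient of P0 is 1 - 3 / (d - 2). The
  gauge-fixing kernel equals p^2 (P1/2 + P0bar) and is added with +1/\<epsilon>, which makes the
  signs of the 1/\<epsilon> terms opposite to those in the formula displayed at the top.\<close>

theorem Peps_Nieuwenhuizen:
  fixes \<kappa> \<epsilon> :: real
  assumes "\<epsilon> \<noteq> 0" and dim: "CARD('n) > 2"
  shows "Peps sg \<kappa> \<epsilon> p \<mu> \<nu> \<alpha> \<beta> = \<kappa> powi (4 - int CARD('n)) * psq sg p *
         ((real CARD('n) - 5) / (real CARD('n) - 2) * NP0 sg p \<mu> \<nu> \<alpha> \<beta>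
          + 1 / (2 * \<epsilon>) * NP1 sg p \<mu> \<nu> \<alpha> \<beta>
          + NP2 sg p \<mu> \<nu> \<alpha> \<beta>
          - ((real CARD('n) - 1) / (real CARD('n) - 2) - 1 / \<epsilon>) * NP0bar sg p \<mu> \<nu> \<alpha> \<beta>
          - 1 / (real CARD('n) - 2) * NP0barbar sg p \<mu> \<nu> \<alpha> \<beta>)"
proof -
  have D: "real CARD('n) - 2 > 0" using dim by simp
  have c: "((real CARD('n) - 5) / (real CARD('n) - 2) - 1) / 3 = - 1 / (real CARD('n) - 2)"
    "- 1 / (real CARD('n) - 2) = - (1 / (real CARD('n) - 2))"
    "- 1 - 1 / (real CARD('n) - 2) + 1 / \<epsilon> = - ((real CARD('n) - 1) / (real CARD('n) - 2) - 1 / \<epsilon>)"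
    using D assms(1) by (simp_all add: field_simps)
  show ?thesis
    unfolding Nieuwenhuizen_spin_op Peps_spin_op[OF assms(1)] c ..
qed

text \<open>Put D = d - 2. On the span of theta and omega the kernel, divided by k, is the matrix
  with rows (-1/D, -1/D) and (-(D+1)/D, -(D+1)/D + 1/\<epsilon>). Its determinant -1/(D \<epsilon>)
  would vanish without the gauge term. Inverting it gives \<epsilon> - 1 for theta theta, hence 1 +
  3(\<epsilon> - 1) for P0, then -\<epsilon> for the mixed terms and \<epsilon> for omega
  omega.\<close>

theorem Peps_inverse:
  fixes \<kappa> \<epsilon> :: real
  assumes "\<kappa> \<noteq> 0" "\<epsilon> \<noteq> 0" and dim: "CARD('n) > 2"
  shows "inverse_op sg (Peps sg \<kappa> \<epsilon> p) (\<lambda>\<mu> \<nu> \<alpha> \<beta>. \<kappa> powi (int CARD('n) - 4) * (1 / psq sg p) *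
         ((- 2 + 3 * \<epsilon>) * NP0 sg p \<mu> \<nu> \<alpha> \<beta>
          + 2 * \<epsilon> * NP1 sg p \<mu> \<nu> \<alpha> \<beta>
          + NP2 sg p \<mu> \<nu> \<alpha> \<beta>
          + \<epsilon> * NP0bar sg p \<mu> \<nu> \<alpha> \<beta>
          - \<epsilon> * NP0barbar sg p \<mu> \<nu> \<alpha> \<beta>))"
proof -
  define k where "k = \<kappa> powi (4 - int CARD('n)) * psq sg p"
  define D where "D = real CARD('n) - 2"
  have k: "k \<noteq> 0" using assms(1) psq by (simp add: k_def)
  have D: "D > 0" "real CARD('n) = D + 2" using dim by (auto simp: D_def)
  have "\<kappa> powi (int CARD('n) - 4) = 1 / \<kappa> powi (4 - int CARD('n))"
    using power_int_minus_divide[of \<kappa> "4 - int CARD('n)"] by simp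
  then have k': "\<kappa> powi (int CARD('n) - 4) * (1 / psq sg p) = 1 / k"
    by (simp add: k_def)
  have K: "Peps sg \<kappa> \<epsilon> p = spin_op (k * 1) (k * (1 / (2 * \<epsilon>))) (k * (- 1 / D)) (k * (- 1 / D)) (k * (- 1 / D))
      (k * (- 1 - 1 / D + 1 / \<epsilon>))"
    by (intro ext) (simp only: Peps_spin_op[OF assms(2)] spin_op_scale k_def D_def)
  have L: "(\<lambda>\<mu> \<nu> \<alpha> \<beta>. \<kappa> powi (int CARD('n) - 4) * (1 / psq sg p) *
         ((- 2 + 3 * \<epsilon>) * NP0 sg p \<mu> \<nu> \<alpha> \<beta> + 2 * \<epsilon> * NP1 sg p \<mu> \<nu> \<alpha> \<beta> + NP2 sg p \<mu> \<nu> \<alpha> \<beta>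
          + \<epsilon> * NP0bar sg p \<mu> \<nu> \<alpha> \<beta> - \<epsilon> * NP0barbar sg p \<mu> \<nu> \<alpha> \<beta>))
      = spin_op (1 / k * 1) (1 / k * (2 * \<epsilon>)) (1 / k * (\<epsilon> - 1)) (1 / k * - \<epsilon>) (1 / k * - \<epsilon>) (1 / k * \<epsilon>)"
    (is "(\<lambda>\<mu> \<nu> \<alpha> \<beta>. _ * ?N \<mu> \<nu> \<alpha> \<beta>) = _")
  proof (intro ext)
    fix \<mu> \<nu> \<alpha> \<beta>
    have "?N \<mu> \<nu> \<alpha> \<beta> = spin_op 1 (2 * \<epsilon>) (\<epsilon> - 1) (- \<epsilon>) (- \<epsilon>) \<epsilon> \<mu> \<nu> \<alpha> \<beta>"
      using Nieuwenhuizen_spin_op[of "- 2 + 3 * \<epsilon>" \<mu> \<nu> \<alpha> \<beta> "2 * \<epsilon>" "- \<epsilon>" \<epsilon>]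
      by (simp add: diff_divide_distrib)
    then show "\<kappa> powi (int CARD('n) - 4) * (1 / psq sg p) * ?N \<mu> \<nu> \<alpha> \<beta>
      = spin_op (1 / k * 1) (1 / k * (2 * \<epsilon>)) (1 / k * (\<epsilon> - 1)) (1 / k * - \<epsilon>) (1 / k * - \<epsilon>) (1 / k * \<epsilon>) \<mu> \<nu> \<alpha> \<beta>"
      by (simp only: k' spin_op_scale)
  qed
  show ?thesis
    unfolding inverse_op_def K L op_mult_spin_op op_id_spin_op D(2)
    using k D(1) assms(2) by (intro conjI spin_op_cong) (simp_all add: field_simps)
qed

end

section \<open>Quadratic actions as momentum integrals against kernels\<close>

section \<open>Bilinear forms in momentum space\<close>

lemma eta_sum:
  fixes g :: "'n::finite \<Rightarrow> 'b::real_vector"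
  shows "(\<Sum>c\<in>UNIV. eta sg a c *\<^sub>R g c) = sg a *\<^sub>R g a"
proof -
  have "eta sg a c *\<^sub>R g c = (if c = a then sg a *\<^sub>R g a else 0)" for c
    by (simp add: eta_def)
  then show ?thesis by simp
qed

lemma gf_ker_eq:
  "gf_ker sg p a b c d = 1/4 * (eta sg a c * (p $ b * p $ d) + eta sg a d * (p $ b * p $ c)
     + eta sg b c * (p $ a * p $ d) + eta sg b d * (p $ a * p $ c))"
  by (simp add: gf_ker_def mult.assoc)

lemma of_bool_sum:
  fixes g :: "'n::finite \<Rightarrow> 'b::real_vector"
  shows "(\<Sum>\<beta>\<in>UNIV. of_bool (\<beta> = \<mu>) *\<^sub>R g \<beta>) = g \<mu>"
proof -
  have "of_bool (\<beta> = \<mu>) *\<^sub>R g \<beta> = (if \<beta> = \<mu> then g \<mu> else 0)" for \<beta>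
    by simp
  then show ?thesis by simp
qed

context imaginary_unit
begin

lemma J_left_commute: "x * (J * y) = J * (x * y)"
  by (metis J_central mult.assoc)

lemma integrable_modes:
  "schwartz f \<Longrightarrow> schwartz g \<Longrightarrow> integrable lborel (\<lambda>p. mode J f (- p) * mode J g p)"
  using integrable_mode_mult[of f g 0] by (simp add: schwartz_integrable)

text \<open>The sign of the reversed momentum cancels the sign of J J = -1.\<close>

lemma modes_pd:
  assumes "schwartz f" "schwartz g"
  shows "mode J (pd a f) (- p) * mode J (pd b g) p = (p $ a * p $ b) *\<^sub>R (mode J f (- p) * mode J g p)"
proof -
  have "(J * x) * (J * y) = - (x * y)" for x y
    by (metis J_central J_square mult.assoc mult_minus_left mult_minus_right mult_1_right)
  then show ?thesis
    by (simp add: mode_pd assms)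
qed

lemma parseval_pd:
  assumes "schwartz f" "schwartz g"
  shows "(LINT x|lborel. pd a f x * pd b g x) = mint (\<lambda>p. (p $ a * p $ b) *\<^sub>R (mode J f (- p) * mode J g p))"
  unfolding modes_pd[OF assms, symmetric]
  by (intro parseval schwartz_integrable schwartz_pd assms)

text \<open>Under the integral this takes the place of the symmetry of second partial
  derivatives.\<close>

lemma parseval_pd_swap:
  fixes f g :: "real^'n::finite \<Rightarrow> 'a"
  assumes "schwartz f" "schwartz g"
  shows "(LINT x|lborel. pd a f x * pd b g x) = (LINT x|lborel. pd b f x * pd a g x)"
  unfolding parseval_pd[OF assms] by (simp add: mult.commute)

text \<open>An integral over modes splits along a sum of kernels only if each part converges. This
  class is closed under sums and real multiples and contains the quadratic monomials, because p_a
  p_b is absorbed as one derivative on each field.\<close>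

definition mode_multiplier :: "(real^'n::finite \<Rightarrow> real) \<Rightarrow> bool" where
  "mode_multiplier q \<longleftrightarrow> (\<forall>f g. schwartz f \<longrightarrow> schwartz g \<longrightarrow>
     integrable lborel (\<lambda>p. q p *\<^sub>R (mode J f (- p) * mode J g p)))"

lemma mode_multiplier_momenta: "mode_multiplier (\<lambda>p. p $ a * p $ b)"
  unfolding mode_multiplier_def by (simp add: modes_pd[symmetric] integrable_modes schwartz_pd)

lemma mode_multiplier_add:
  "mode_multiplier q \<Longrightarrow> mode_multiplier r \<Longrightarrow> mode_multiplier (\<lambda>p. q p + r p)"
  unfolding mode_multiplier_def by (simp add: scaleR_add_left)

lemma mode_multiplier_cmult: "mode_multiplier q \<Longrightarrow> mode_multiplier (\<lambda>p. c * q p)"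
  unfolding mode_multiplier_def by (simp flip: scaleR_scaleR)

lemma mode_multiplier_multc: "mode_multiplier q \<Longrightarrow> mode_multiplier (\<lambda>p. q p * c)"
  using mode_multiplier_cmult[of q c] by (simp add: mult.commute)

lemma mode_multiplier_sum:
  "(\<And>i. i \<in> A \<Longrightarrow> mode_multiplier (q i)) \<Longrightarrow> mode_multiplier (\<lambda>p. \<Sum>i\<in>A. q i p)"
  unfolding mode_multiplier_def by (simp add: scaleR_sum_left)

lemma mode_multiplier_psq: "mode_multiplier (psq sg)"
  unfolding psq_def[abs_def] mult.assoc
  by (intro mode_multiplier_sum mode_multiplier_cmult mode_multiplier_momenta)

lemma mode_multiplier_Pker: "mode_multiplier (\<lambda>p. Pker sg \<kappa> p a b c d)"
  unfolding Pker_def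
  by (intro mode_multiplier_cmult mode_multiplier_add mode_multiplier_multc[OF mode_multiplier_psq]
      mode_multiplier_multc[OF mode_multiplier_momenta])

lemma mode_multiplier_gf_ker: "mode_multiplier (\<lambda>p. gf_ker sg p a b c d)"
  unfolding gf_ker_eq
  by (intro mode_multiplier_cmult mode_multiplier_add mode_multiplier_momenta)

lemma mint_multiplier:
  assumes "schwartz f" "schwartz g" "mode_multiplier q" "mode_multiplier r"
  shows "mint (\<lambda>p. (q p + r p) *\<^sub>R (mode J f (- p) * mode J g p))
      = mint (\<lambda>p. q p *\<^sub>R (mode J f (- p) * mode J g p)) + mint (\<lambda>p. r p *\<^sub>R (mode J f (- p) * mode J g p))"
  using assms unfolding mode_multiplier_def by (simp add: scaleR_add_left mint_add)

lemma mint_multiplier_scale: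
  "mint (\<lambda>p. (c * q p) *\<^sub>R (mode J f (- p) * mode J g p)) = c *\<^sub>R mint (\<lambda>p. q p *\<^sub>R (mode J f (- p) * mode J g p))"
  by (simp flip: scaleR_scaleR add: mint_scaleR)

lemma hh_form_eq:
  assumes "\<And>\<mu> \<nu>. schwartz (hf \<phi> \<mu> \<nu>)" "\<And>a b c d. mode_multiplier (\<lambda>p. K p a b c d)"
  shows "hh_form \<phi> J K = (\<Sum>a\<in>UNIV. \<Sum>b\<in>UNIV. \<Sum>c\<in>UNIV. \<Sum>d\<in>UNIV.
    mint (\<lambda>p. K p a b c d *\<^sub>R (mode J (hf \<phi> a b) (- p) * mode J (hf \<phi> c d) p)))"
proof -
  have "integrable lborel (\<lambda>p. K p a b c d *\<^sub>R (mode J (hf \<phi> a b) (- p) * mode J (hf \<phi> c d) p))" for a b c d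
    using assms unfolding mode_multiplier_def by blast
  then show ?thesis
    unfolding hh_form_def by (simp add: mint_sum)
qed

lemma hh_form_add:
  assumes "\<And>\<mu> \<nu>. schwartz (hf \<phi> \<mu> \<nu>)" "\<And>a b c d. mode_multiplier (\<lambda>p. K p a b c d)"
    "\<And>a b c d. mode_multiplier (\<lambda>p. L p a b c d)"
  shows "hh_form \<phi> J (\<lambda>p a b c d. K p a b c d + L p a b c d) = hh_form \<phi> J K + hh_form \<phi> J L"
  by (simp add: hh_form_eq assms mode_multiplier_add mint_multiplier sum.distrib)

lemma hh_form_scale: "hh_form \<phi> J (\<lambda>p a b c d. x * K p a b c d) = x *\<^sub>R hh_form \<phi> J K"
  unfolding hh_form_def by (simp flip: scaleR_scaleR scaleR_sum_right add: mint_scaleR)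

theorem A_hh_gf_eq:
  assumes h: "\<And>\<mu> \<nu>. schwartz (hf \<phi> \<mu> \<nu>)"
  shows "A_hh_gf sg \<phi> J \<kappa> \<epsilon> = hh_form \<phi> J (\<lambda>p a b c d. 1/2 * Peps sg \<kappa> \<epsilon> p a b c d)"
proof -
  have "(\<lambda>p a b c d. 1/2 * Peps sg \<kappa> \<epsilon> p a b c d)
    = (\<lambda>p a b c d. 1/2 * Pker sg \<kappa> p a b c d + 1/2 * (\<kappa> powi (4 - int CARD('b)) / \<epsilon>) * gf_ker sg (p::real^'b) a b c d)"
    by (intro ext) (simp add: Peps_def distrib_left)
  then show ?thesis
    unfolding A_hh_gf_def A_hh_def
    by (simp only: hh_form_add[OF h] mode_multiplier_cmult mode_multiplier_Pker mode_multiplier_gf_ker hh_form_scale)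
qed

text \<open>The four terms of \<open>gf_ker\<close> differ by exchanging indices within the
  symmetric pairs of h, so their full contractions agree and the factor 1/4 averages them. A single
  term is the Parseval image of the squared divergence.\<close>

lemma hh_form_gf_ker:
  assumes h: "\<And>\<mu> \<nu>. schwartz (hf \<phi> \<mu> \<nu>)" and sym: "\<And>\<mu> \<nu>. hf \<phi> \<mu> \<nu> = hf \<phi> \<nu> \<mu>"
  shows "hh_form \<phi> J (gf_ker sg) = (\<Sum>\<mu>\<in>UNIV. sg \<mu> *\<^sub>R
    (LINT x|lborel. (\<Sum>\<nu>\<in>UNIV. pd \<nu> (hf \<phi> \<mu> \<nu>) x) * (\<Sum>\<nu>\<in>UNIV. pd \<nu> (hf \<phi> \<mu> \<nu>) x)))"
proof -
  define T where "T a b c d = (LINT x|lborel. pd b (hf \<phi> a b) x * pd d (hf \<phi> c d) x)" for a b c d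
  define U where "U a b c d = eta sg a c *\<^sub>R T a b c d" for a b c d
  have term_eq: "mint (\<lambda>p. gf_ker sg p a b c d *\<^sub>R (mode J (hf \<phi> a b) (- p) * mode J (hf \<phi> c d) p))
      = (1/4) *\<^sub>R (U a b c d + U a b d c + U b a c d + U b a d c)" for a b c d
  proof -
    have "mint (\<lambda>p. gf_ker sg p a b c d *\<^sub>R (mode J (hf \<phi> a b) (- p) * mode J (hf \<phi> c d) p))
      = (1/4) *\<^sub>R (eta sg a c *\<^sub>R (LINT x|lborel. pd b (hf \<phi> a b) x * pd d (hf \<phi> c d) x)
        + eta sg a d *\<^sub>R (LINT x|lborel. pd b (hf \<phi> a b) x * pd c (hf \<phi> c d) x)
        + eta sg b c *\<^sub>R (LINT x|lborel. pd a (hf \<phi> a b) x * pd d (hf \<phi> c d) x)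
        + eta sg b d *\<^sub>R (LINT x|lborel. pd a (hf \<phi> a b) x * pd c (hf \<phi> c d) x))"
      unfolding gf_ker_eq
      by (simp only: mint_multiplier_scale mint_multiplier[OF h h] mode_multiplier_add mode_multiplier_cmult
          mode_multiplier_momenta parseval_pd[OF h h])
    then show ?thesis
      by (simp only: U_def T_def sym[of b a] sym[of d c])
  qed
  have swap12: "(\<Sum>a\<in>UNIV. \<Sum>b\<in>UNIV. \<Sum>c\<in>UNIV. \<Sum>d\<in>UNIV. F b a c d) = (\<Sum>a\<in>UNIV. \<Sum>b\<in>UNIV. \<Sum>c\<in>UNIV. \<Sum>d\<in>UNIV. F a b c d)"
    for F :: "'c \<Rightarrow> 'c \<Rightarrow> 'c \<Rightarrow> 'c \<Rightarrow> 'a"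
    by (rule sum.swap)
  have swap34: "(\<Sum>a\<in>UNIV. \<Sum>b\<in>UNIV. \<Sum>c\<in>UNIV. \<Sum>d\<in>UNIV. F a b d c) = (\<Sum>a\<in>UNIV. \<Sum>b\<in>UNIV. \<Sum>c\<in>UNIV. \<Sum>d\<in>UNIV. F a b c d)"
    for F :: "'c \<Rightarrow> 'c \<Rightarrow> 'c \<Rightarrow> 'c \<Rightarrow> 'a"
    by (intro sum.cong refl sum.swap)
  have "hh_form \<phi> J (gf_ker sg) = (\<Sum>a\<in>UNIV. \<Sum>b\<in>UNIV. \<Sum>c\<in>UNIV. \<Sum>d\<in>UNIV.
      (1/4) *\<^sub>R (U a b c d + U a b d c + U b a c d + U b a d c))"
    by (simp only: hh_form_eq[OF h mode_multiplier_gf_ker] term_eq)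
  also have "\<dots> = (1/4) *\<^sub>R (4 *\<^sub>R (\<Sum>a\<in>UNIV. \<Sum>b\<in>UNIV. \<Sum>c\<in>UNIV. \<Sum>d\<in>UNIV. U a b c d))"
    unfolding scaleR_sum_right[symmetric] sum.distrib swap12[of U] swap34[of U] swap12[of "\<lambda>a b c d. U a b d c"]
    by (simp add: scaleR_2[symmetric] scaleR_add_left[symmetric] algebra_simps)
  also have "\<dots> = (\<Sum>a\<in>UNIV. \<Sum>b\<in>UNIV. \<Sum>d\<in>UNIV. sg a *\<^sub>R T a b a d)"
  proof -
    have "(\<Sum>c\<in>UNIV. \<Sum>d\<in>UNIV. U a b c d) = (\<Sum>d\<in>UNIV. sg a *\<^sub>R T a b a d)" for a b
      unfolding U_def by (subst sum.swap) (simp add: eta_sum)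
    then show ?thesis by simp
  qed
  also have "\<dots> = (\<Sum>\<mu>\<in>UNIV. sg \<mu> *\<^sub>R
    (LINT x|lborel. (\<Sum>\<nu>\<in>UNIV. pd \<nu> (hf \<phi> \<mu> \<nu>) x) * (\<Sum>\<nu>\<in>UNIV. pd \<nu> (hf \<phi> \<mu> \<nu>) x)))"
    unfolding T_def sum_product
    by (simp add: scaleR_sum_right[symmetric] schwartz_integrable schwartz_mult schwartz_pd h)
  finally show ?thesis .
qed

end

section \<open>The gauge-fixing action in position space\<close>

section \<open>Gauge fixing and ghosts\<close>

lemma superalgebra_imaginary_unit: "superalgebra Ev Od J \<Longrightarrow> imaginary_unit J"
  unfolding superalgebra_def imaginary_unit_def by blast

lemma integral_commute:
  fixes f :: "'x \<Rightarrow> 'a::{real_normed_algebra,banach,second_countable_topology}"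
  assumes "integrable M f" "\<And>x. f x * y = y * f x"
  shows "integral\<^sup>L M f * y = y * integral\<^sup>L M f"
proof -
  have "integral\<^sup>L M f * y = (LINT x|M. f x * y)"
    using assms(1) by simp
  also have "\<dots> = y * integral\<^sup>L M f"
    using assms(1) by (simp add: assms(2))
  finally show ?thesis .
qed

locale field_config = imaginary_unit J
  for J :: "'a::{real_normed_algebra_1,banach,second_countable_topology}" +
  fixes Ev Od :: "'a set" and sg :: "'n::finite \<Rightarrow> real" and \<phi> :: "('a, 'n) fields"
  assumes super: "superalgebra Ev Od J" and \<phi>: "\<phi> \<in> field_space Ev Od"
    and metric: "sg \<mu> = 1 \<or> sg \<mu> = - 1"
begin

abbreviation "h \<equiv> hf \<phi>"
abbreviation "c \<equiv> cf \<phi>"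
abbreviation "cb \<equiv> cbf \<phi>"

lemma schwartz_fields: "schwartz (h \<mu> \<nu>)" "schwartz (c \<mu>)" "schwartz (cb \<mu>)"
  using \<phi> unfolding field_space_def by auto

lemma h_sym: "h \<mu> \<nu> = h \<nu> \<mu>"
  using \<phi> unfolding field_space_def by auto

lemma h_Ev: "range (h \<mu> \<nu>) \<subseteq> Ev"
  using \<phi> unfolding field_space_def by auto

lemma Ev_commute: "x \<in> Ev \<Longrightarrow> x * y = y * x"
  using super unfolding superalgebra_def by blast

lemma h_commute: "y * (h \<mu> \<nu> x * z) = h \<mu> \<nu> x * (y * z)"
proof -
  have "h \<mu> \<nu> x * y = y * h \<mu> \<nu> x"
    by (rule Ev_commute[OF subsetD[OF h_Ev rangeI]])
  then have "y * h \<mu> \<nu> x * z = h \<mu> \<nu> x * y * z"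
    by (rule arg_cong[of _ _ "\<lambda>t. t * z", OF sym])
  then show ?thesis
    unfolding mult.assoc .
qed

lemma sg_sq: "sg \<mu> * sg \<mu> = 1"
  using metric[of \<mu>] by auto

lemmas schwartz_intros = schwartz_integrable schwartz_sum schwartz_scaleR schwartz_add schwartz_diff
  schwartz_minus schwartz_mult schwartz_pd schwartz_fields

definition divh :: "'n \<Rightarrow> real^'n \<Rightarrow> 'a" where
  "divh \<mu> x = (\<Sum>\<nu>\<in>UNIV. pd \<nu> (h \<mu> \<nu>) x)"

definition brst_h :: "real \<Rightarrow> 'n \<Rightarrow> 'n \<Rightarrow> real^'n \<Rightarrow> 'a" where
  "brst_h \<kappa> \<mu> \<nu> x = (\<Sum>l\<in>UNIV. h \<mu> l x * pd l (c \<nu>) x) + (\<Sum>l\<in>UNIV. h \<nu> l x * pd l (c \<mu>) x)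
     - (\<Sum>l\<in>UNIV. pd l (\<lambda>x. h \<mu> \<nu> x * c l x) x)
     - (1 / \<kappa>) *\<^sub>R (sg \<mu> *\<^sub>R pd \<mu> (c \<nu>) x + sg \<nu> *\<^sub>R pd \<nu> (c \<mu>) x - eta sg \<mu> \<nu> *\<^sub>R (\<Sum>l\<in>UNIV. pd l (c l) x))"

lemma schwartz_divh: "schwartz (divh \<mu>)"
  unfolding divh_def[abs_def] by (intro schwartz_intros)

lemma schwartz_brst_h: "schwartz (brst_h \<kappa> \<mu> \<nu>)"
  unfolding brst_h_def[abs_def] by (intro schwartz_intros)

lemma divh_Ev: "divh \<mu> x \<in> Ev"
proof -
  have E: "subspace Ev" "closed Ev"
    using super unfolding superalgebra_def by auto
  show ?thesis
    unfolding divh_def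
    by (intro subspace_sum E pd_in_closed_subspace schwartz_differentiable schwartz_fields h_Ev)
qed

lemma den_brst_h: "den \<phi> b (brst_gen sg \<kappa> \<tau> (GH \<mu> \<nu>)) = brst_h \<kappa> \<mu> \<nu>"
  by (intro ext) (simp add: brst_h_def scaleR_conv_of_real algebra_simps)

text \<open>The antighost is odd, so the graded Leibniz rule puts a minus sign in front of the
  variation of h; as the variation of b vanishes, the \<epsilon> term contributes only b b.\<close>

lemma den_gf:
  "den \<phi> b (brst sg \<kappa> \<tau> (gf_density sg \<kappa> \<epsilon>)) x = (\<Sum>\<mu>\<in>UNIV.
     b \<mu> x * (\<kappa> *\<^sub>R divh \<mu> x) - (\<epsilon> / 2 * \<kappa>\<^sup>2) *\<^sub>R (b \<mu> x * (sg \<mu> *\<^sub>R b \<mu> x)))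
     - \<kappa> *\<^sub>R (\<Sum>\<mu>\<in>UNIV. \<Sum>\<nu>\<in>UNIV. cb \<mu> x * pd \<nu> (brst_h \<kappa> \<mu> \<nu>) x)"
  unfolding gf_density_def
  by (simp del: brst_gen.simps(1) add: den_brst_h divh_def[symmetric] scaleR_conv_of_real[symmetric]
      right_diff_distrib sum_subtractf sum.distrib sum_distrib_left scaleR_sum_right sum_negf mult_ac)

text \<open>With the indices kept free, matching the varied gauge condition to the ghost actions
  becomes a relabelling of finite sums.\<close>

definition vertex1 where "vertex1 \<mu> \<nu> l = (LINT x|lborel. h \<mu> \<nu> x * (pd l (cb \<mu>) x * pd \<nu> (c l) x))"
definition vertex2 where "vertex2 \<mu> \<nu> l = (LINT x|lborel. h \<mu> \<nu> x * (pd \<mu> (cb l) x * pd \<nu> (c l) x))"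
definition vertex3 where "vertex3 \<mu> \<nu> l = (LINT x|lborel. h \<mu> \<nu> x * (pd l (pd \<mu> (cb \<nu>)) x * c l x))"
definition ghost_kinetic where "ghost_kinetic a \<mu> b \<nu> = (LINT x|lborel. pd a (cb \<mu>) x * pd b (c \<nu>) x)"

lemma integral_brst_h:
  "(LINT x|lborel. pd \<nu> (cb \<mu>) x * brst_h \<kappa> \<mu> \<nu> x) =
     (\<Sum>l\<in>UNIV. vertex1 \<mu> l \<nu>) + (\<Sum>l\<in>UNIV. vertex2 \<nu> l \<mu>) + (\<Sum>l\<in>UNIV. vertex3 \<nu> \<mu> l)
     - (1 / \<kappa>) *\<^sub>R (sg \<mu> *\<^sub>R ghost_kinetic \<nu> \<mu> \<mu> \<nu> + sg \<nu> *\<^sub>R ghost_kinetic \<nu> \<mu> \<nu> \<mu> - eta sg \<mu> \<nu> *\<^sub>R (\<Sum>l\<in>UNIV. ghost_kinetic \<nu> \<mu> l l))"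
proof -
  \<comment> \<open>This integration by parts takes the derivative off the product of h and c. Its
    sign cancels the minus in the variation of h, so the vertex enters positively.\<close>
  have 3: "(LINT x|lborel. pd \<nu> (cb \<mu>) x * pd l (\<lambda>x. h \<mu> \<nu> x * c l x) x) = - vertex3 \<nu> \<mu> l" for l
    by (subst integration_by_parts) (intro schwartz_intros, intro schwartz_intros,
        simp add: vertex3_def h_commute h_sym[of \<nu> \<mu>])
  have int: "integrable lborel (\<lambda>x. pd \<nu> (cb \<mu>) x * (h a b x * pd d (c e) x))"
    "integrable lborel (\<lambda>x. pd \<nu> (cb \<mu>) x * pd l (\<lambda>x. h a b x * c l x) x)"
    "integrable lborel (\<lambda>x. pd \<nu> (cb \<mu>) x * pd d (c e) x)" for a b d e l
    by (intro schwartz_intros)+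
  have "pd \<nu> (cb \<mu>) x * brst_h \<kappa> \<mu> \<nu> x = (\<Sum>l\<in>UNIV. pd \<nu> (cb \<mu>) x * (h \<mu> l x * pd l (c \<nu>) x))
     + (\<Sum>l\<in>UNIV. pd \<nu> (cb \<mu>) x * (h \<nu> l x * pd l (c \<mu>) x))
     - (\<Sum>l\<in>UNIV. pd \<nu> (cb \<mu>) x * pd l (\<lambda>x. h \<mu> \<nu> x * c l x) x)
     - (1 / \<kappa>) *\<^sub>R (sg \<mu> *\<^sub>R (pd \<nu> (cb \<mu>) x * pd \<mu> (c \<nu>) x) + sg \<nu> *\<^sub>R (pd \<nu> (cb \<mu>) x * pd \<nu> (c \<mu>) x)
       - eta sg \<mu> \<nu> *\<^sub>R (\<Sum>l\<in>UNIV. pd \<nu> (cb \<mu>) x * pd l (c l) x))" for x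
    unfolding brst_h_def by (simp add: distrib_left right_diff_distrib sum_distrib_left)
  then have "(LINT x|lborel. pd \<nu> (cb \<mu>) x * brst_h \<kappa> \<mu> \<nu> x) =
     (\<Sum>l\<in>UNIV. LINT x|lborel. pd \<nu> (cb \<mu>) x * (h \<mu> l x * pd l (c \<nu>) x))
     + (\<Sum>l\<in>UNIV. LINT x|lborel. pd \<nu> (cb \<mu>) x * (h \<nu> l x * pd l (c \<mu>) x))
     - (\<Sum>l\<in>UNIV. LINT x|lborel. pd \<nu> (cb \<mu>) x * pd l (\<lambda>x. h \<mu> \<nu> x * c l x) x)
     - (1 / \<kappa>) *\<^sub>R (sg \<mu> *\<^sub>R ghost_kinetic \<nu> \<mu> \<mu> \<nu> + sg \<nu> *\<^sub>R ghost_kinetic \<nu> \<mu> \<nu> \<mu> - eta sg \<mu> \<nu> *\<^sub>R (\<Sum>l\<in>UNIV. ghost_kinetic \<nu> \<mu> l l))"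
    unfolding ghost_kinetic_def by (simp add: int)
  then show ?thesis
    unfolding 3 by (simp add: vertex1_def vertex2_def h_commute sum_negf)
qed

lemma ghost_sum:
  "(\<Sum>\<mu>\<in>UNIV. \<Sum>\<nu>\<in>UNIV. LINT x|lborel. pd \<nu> (cb \<mu>) x * brst_h \<kappa> \<mu> \<nu> x) =
     (\<Sum>\<mu>\<in>UNIV. \<Sum>\<nu>\<in>UNIV. \<Sum>l\<in>UNIV. vertex1 \<mu> \<nu> l + vertex2 \<mu> \<nu> l + vertex3 \<mu> \<nu> l)
     - (1 / \<kappa>) *\<^sub>R (\<Sum>\<mu>\<in>UNIV. \<Sum>\<nu>\<in>UNIV. sg \<nu> *\<^sub>R ghost_kinetic \<nu> \<mu> \<nu> \<mu>)"
proof -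
  have 1: "(\<Sum>\<mu>\<in>UNIV. \<Sum>\<nu>\<in>UNIV. \<Sum>l\<in>UNIV. vertex1 \<mu> l \<nu>) = (\<Sum>\<mu>\<in>UNIV. \<Sum>\<nu>\<in>UNIV. \<Sum>l\<in>UNIV. vertex1 \<mu> \<nu> l)"
    by (intro sum.cong refl sum.swap)
  have "(\<Sum>\<mu>\<in>UNIV. \<Sum>\<nu>\<in>UNIV. \<Sum>l\<in>UNIV. vertex2 \<nu> l \<mu>) = (\<Sum>\<nu>\<in>UNIV. \<Sum>\<mu>\<in>UNIV. \<Sum>l\<in>UNIV. vertex2 \<nu> l \<mu>)"
    by (rule sum.swap)
  also have "\<dots> = (\<Sum>\<mu>\<in>UNIV. \<Sum>\<nu>\<in>UNIV. \<Sum>l\<in>UNIV. vertex2 \<mu> \<nu> l)"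
    by (intro sum.cong refl sum.swap)
  finally have 2: "(\<Sum>\<mu>\<in>UNIV. \<Sum>\<nu>\<in>UNIV. \<Sum>l\<in>UNIV. vertex2 \<nu> l \<mu>) = (\<Sum>\<mu>\<in>UNIV. \<Sum>\<nu>\<in>UNIV. \<Sum>l\<in>UNIV. vertex2 \<mu> \<nu> l)" .
  have 3: "(\<Sum>\<mu>\<in>UNIV. \<Sum>\<nu>\<in>UNIV. \<Sum>l\<in>UNIV. vertex3 \<nu> \<mu> l) = (\<Sum>\<mu>\<in>UNIV. \<Sum>\<nu>\<in>UNIV. \<Sum>l\<in>UNIV. vertex3 \<mu> \<nu> l)"
    by (rule sum.swap)
  \<comment> \<open>Contracting \<open>eta\<close> leaves, in the divergence term, the same
    derivatives as in the term with exchanged indices, only in the other order; hence the two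
    cancel.\<close>
  have 4: "sg \<mu> *\<^sub>R (\<Sum>\<nu>\<in>UNIV. ghost_kinetic \<nu> \<mu> \<mu> \<nu>) = (\<Sum>\<nu>\<in>UNIV. eta sg \<mu> \<nu> *\<^sub>R (\<Sum>l\<in>UNIV. ghost_kinetic \<nu> \<mu> l l))" for \<mu>
    unfolding eta_sum ghost_kinetic_def
    by (simp only: parseval_pd_swap[OF schwartz_fields(3,2), of _ \<mu> \<mu>])
  show ?thesis
    unfolding integral_brst_h
    by (simp add: sum.distrib sum_subtractf 1 2 3 4 scaleR_sum_right[symmetric])
qed

lemma A_gh_eq: "A_gh sg \<phi> \<kappa> = - (\<kappa> powi (4 - int CARD('n)) *\<^sub>R (\<Sum>\<mu>\<in>UNIV. \<Sum>\<nu>\<in>UNIV. sg \<nu> *\<^sub>R ghost_kinetic \<nu> \<mu> \<nu> \<mu>))"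
proof -
  have int: "integrable lborel (\<lambda>x. cb \<mu> x * pd \<nu> (pd \<nu> (c \<mu>)) x)" for \<mu> \<nu>
    by (intro schwartz_intros)
  have "(LINT x|lborel. (\<Sum>\<mu>\<in>UNIV. cb \<mu> x * (\<Sum>\<nu>\<in>UNIV. sg \<nu> *\<^sub>R pd \<nu> (pd \<nu> (c \<mu>)) x)))
      = (\<Sum>\<mu>\<in>UNIV. \<Sum>\<nu>\<in>UNIV. sg \<nu> *\<^sub>R (LINT x|lborel. cb \<mu> x * pd \<nu> (pd \<nu> (c \<mu>)) x))"
    by (simp add: sum_distrib_left int)
  also have "\<dots> = - (\<Sum>\<mu>\<in>UNIV. \<Sum>\<nu>\<in>UNIV. sg \<nu> *\<^sub>R ghost_kinetic \<nu> \<mu> \<nu> \<mu>)"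
    unfolding ghost_kinetic_def by (simp add: integration_by_parts schwartz_fields schwartz_pd sum_negf)
  finally show ?thesis
    unfolding A_gh_def by simp
qed

lemma A_gh_h_eq:
  "A_gh_h \<phi> \<kappa> = \<kappa> powi (5 - int CARD('n)) *\<^sub>R
     (\<Sum>\<mu>\<in>UNIV. \<Sum>\<nu>\<in>UNIV. \<Sum>l\<in>UNIV. vertex1 \<mu> \<nu> l + vertex2 \<mu> \<nu> l + vertex3 \<mu> \<nu> l)"
proof -
  have int: "integrable lborel (\<lambda>x. h \<mu> \<nu> x * (pd l (cb a) x * pd \<nu> (c l) x))"
    "integrable lborel (\<lambda>x. h \<mu> \<nu> x * (pd \<mu> (cb l) x * pd \<nu> (c l) x))"
    "integrable lborel (\<lambda>x. h \<mu> \<nu> x * (pd l (pd \<mu> (cb \<nu>)) x * c l x))" for \<mu> \<nu> l a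
    by (intro schwartz_intros)+
  show ?thesis
    unfolding A_gh_h_def vertex1_def vertex2_def vertex3_def
    by (simp add: sum_distrib_left distrib_left int)
qed

text \<open>The factor \<kappa> of the gauge condition raises the cubic ghost terms to exponent 5 -
  d; in the quadratic ones it cancels the 1/\<kappa> in the variation of h, leaving 4 - d.\<close>

lemma A_gf_eq:
  assumes \<kappa>: "\<kappa> \<noteq> 0" and b: "b \<in> b_space Ev"
  shows "A_gf sg \<tau> \<phi> b \<kappa> \<epsilon> = \<kappa> powi (4 - int CARD('n)) *\<^sub>R (LINT x|lborel. (\<Sum>\<mu>\<in>UNIV.
     b \<mu> x * (\<kappa> *\<^sub>R divh \<mu> x) - (\<epsilon> / 2 * \<kappa>\<^sup>2) *\<^sub>R (b \<mu> x * (sg \<mu> *\<^sub>R b \<mu> x))))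
     + A_gh sg \<phi> \<kappa> + A_gh_h \<phi> \<kappa>"
proof -
  have sb: "schwartz (b \<mu>)" for \<mu>
    using b unfolding b_space_def by blast
  let ?q = "\<lambda>x. \<Sum>\<mu>\<in>UNIV. b \<mu> x * (\<kappa> *\<^sub>R divh \<mu> x) - (\<epsilon> / 2 * \<kappa>\<^sup>2) *\<^sub>R (b \<mu> x * (sg \<mu> *\<^sub>R b \<mu> x))"
  have q: "integrable lborel ?q"
    by (intro schwartz_intros schwartz_divh sb)
  have int: "integrable lborel (\<lambda>x. cb \<mu> x * pd \<nu> (brst_h \<kappa> \<mu> \<nu>) x)" for \<mu> \<nu>
    by (intro schwartz_intros schwartz_brst_h)
  have "(LINT x|lborel. den \<phi> b (brst sg \<kappa> \<tau> (gf_density sg \<kappa> \<epsilon>)) x)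
      = (LINT x|lborel. ?q x) - \<kappa> *\<^sub>R (\<Sum>\<mu>\<in>UNIV. \<Sum>\<nu>\<in>UNIV. LINT x|lborel. cb \<mu> x * pd \<nu> (brst_h \<kappa> \<mu> \<nu>) x)"
    unfolding den_gf by (subst Bochner_Integration.integral_diff[OF q]) (simp_all add: int)
  also have "(\<Sum>\<mu>\<in>UNIV. \<Sum>\<nu>\<in>UNIV. LINT x|lborel. cb \<mu> x * pd \<nu> (brst_h \<kappa> \<mu> \<nu>) x)
      = - (\<Sum>\<mu>\<in>UNIV. \<Sum>\<nu>\<in>UNIV. LINT x|lborel. pd \<nu> (cb \<mu>) x * brst_h \<kappa> \<mu> \<nu> x)"
    by (simp add: integration_by_parts schwartz_fields schwartz_brst_h sum_negf)
  finally have *: "(LINT x|lborel. den \<phi> b (brst sg \<kappa> \<tau> (gf_density sg \<kappa> \<epsilon>)) x)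
      = (LINT x|lborel. ?q x) + \<kappa> *\<^sub>R (\<Sum>\<mu>\<in>UNIV. \<Sum>\<nu>\<in>UNIV. \<Sum>l\<in>UNIV. vertex1 \<mu> \<nu> l + vertex2 \<mu> \<nu> l + vertex3 \<mu> \<nu> l)
        - (\<Sum>\<mu>\<in>UNIV. \<Sum>\<nu>\<in>UNIV. sg \<nu> *\<^sub>R ghost_kinetic \<nu> \<mu> \<nu> \<mu>)"
    using \<kappa> by (simp add: ghost_sum scaleR_diff_right)
  have "\<kappa> powi (5 - int CARD('n)) = \<kappa> powi (4 - int CARD('n)) * \<kappa>"
    using power_int_add[of \<kappa> "4 - int CARD('n)" 1] \<kappa> by simp
  then show ?thesis
    unfolding A_gf_def * A_gh_eq A_gh_h_eq by (simp add: scaleR_add_right scaleR_diff_right)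
qed

text \<open>The stationary point of the action in \<open>b\<close>; shifting by it completes the square.\<close>

definition b_shift :: "real \<Rightarrow> real \<Rightarrow> 'n \<Rightarrow> real^'n \<Rightarrow> 'a" where
  "b_shift \<kappa> \<epsilon> \<mu> x = (sg \<mu> / (\<epsilon> * \<kappa>)) *\<^sub>R divh \<mu> x"

lemma b_shift_space: "b_shift \<kappa> \<epsilon> \<in> b_space Ev"
proof -
  have "subspace Ev"
    using super unfolding superalgebra_def by auto
  then have "b_shift \<kappa> \<epsilon> \<mu> x \<in> Ev" for \<mu> x
    unfolding b_shift_def by (intro subspace_scale divh_Ev)
  moreover have "schwartz (b_shift \<kappa> \<epsilon> \<mu>)" for \<mu>
    unfolding b_shift_def[abs_def] by (intro schwartz_scaleR schwartz_divh)
  ultimately show ?thesis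
    unfolding b_space_def by auto
qed

lemma complete_square:
  assumes \<kappa>: "\<kappa> \<noteq> 0" and \<epsilon>: "\<epsilon> \<noteq> 0" and b: "b \<in> b_space Ev"
  shows "(LINT x|lborel. (\<Sum>\<mu>\<in>UNIV.
     b \<mu> x * (\<kappa> *\<^sub>R divh \<mu> x) - (\<epsilon> / 2 * \<kappa>\<^sup>2) *\<^sub>R (b \<mu> x * (sg \<mu> *\<^sub>R b \<mu> x))))
    = (LINT x|lborel. (- (\<epsilon> / 2) * \<kappa>\<^sup>2) *\<^sub>R (\<Sum>\<mu>\<in>UNIV. (b \<mu> x - b_shift \<kappa> \<epsilon> \<mu> x) * (sg \<mu> *\<^sub>R (b \<mu> x - b_shift \<kappa> \<epsilon> \<mu> x))))
      + (1 / (2 * \<epsilon>)) *\<^sub>R (\<Sum>\<mu>\<in>UNIV. sg \<mu> *\<^sub>R (LINT x|lborel. divh \<mu> x * divh \<mu> x))"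
proof -
  have sb: "schwartz (b \<mu>)" and bE: "b \<mu> x \<in> Ev" for \<mu> x
    using b unfolding b_space_def by blast+
  have sf: "schwartz (b_shift \<kappa> \<epsilon> \<mu>)" for \<mu>
    using b_shift_space unfolding b_space_def by blast
  let ?Q = "\<lambda>x. (- (\<epsilon> / 2) * \<kappa>\<^sup>2) *\<^sub>R (\<Sum>\<mu>\<in>UNIV. (b \<mu> x - b_shift \<kappa> \<epsilon> \<mu> x) * (sg \<mu> *\<^sub>R (b \<mu> x - b_shift \<kappa> \<epsilon> \<mu> x)))"
  have Q: "integrable lborel ?Q"
    by (intro schwartz_intros sb sf)
  have D: "integrable lborel (\<lambda>x. divh \<mu> x * divh \<mu> x)" for \<mu>
    by (intro schwartz_intros schwartz_divh)
  have "b \<mu> x * (\<kappa> *\<^sub>R divh \<mu> x) - (\<epsilon> / 2 * \<kappa>\<^sup>2) *\<^sub>R (b \<mu> x * (sg \<mu> *\<^sub>R b \<mu> x))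
    = (- (\<epsilon> / 2) * \<kappa>\<^sup>2) *\<^sub>R ((b \<mu> x - b_shift \<kappa> \<epsilon> \<mu> x) * (sg \<mu> *\<^sub>R (b \<mu> x - b_shift \<kappa> \<epsilon> \<mu> x)))
      + (1 / (2 * \<epsilon>)) *\<^sub>R (sg \<mu> *\<^sub>R (divh \<mu> x * divh \<mu> x))" for \<mu> x
  proof -
    let ?B = "b \<mu> x" and ?D = "divh \<mu> x"
    \<comment> \<open>E is the coefficient of the quadratic term up to sign, s that of the shift: 2
      E s reproduces the coupling \<kappa> of b to the divergence, and in the remainder E s^2 the
      coupling \<kappa> drops out.\<close>
    define s E where "s = sg \<mu> / (\<epsilon> * \<kappa>)" and "E = \<epsilon> / 2 * \<kappa>\<^sup>2 * sg \<mu>"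
    have E: "E * (2 * s) = \<kappa>" "E * (s * s) = 1 / (2 * \<epsilon>) * sg \<mu>"
      using metric[of \<mu>] \<kappa> \<epsilon> by (auto simp: s_def E_def power2_eq_square field_simps)
    have sq: "(?B - s *\<^sub>R ?D) * (?B - s *\<^sub>R ?D) = ?B * ?B - (2 * s) *\<^sub>R (?B * ?D) + (s * s) *\<^sub>R (?D * ?D)"
      unfolding mult_2 scaleR_add_left using Ev_commute[OF bE, of \<mu> x ?D]
      by (simp add: left_diff_distrib right_diff_distrib algebra_simps)
    have "(- (\<epsilon> / 2) * \<kappa>\<^sup>2) *\<^sub>R (y * (sg \<mu> *\<^sub>R y)) = - (E *\<^sub>R (y * y))" for y :: 'a
      by (simp add: E_def)
    then have "(- (\<epsilon> / 2) * \<kappa>\<^sup>2) *\<^sub>R ((?B - s *\<^sub>R ?D) * (sg \<mu> *\<^sub>R (?B - s *\<^sub>R ?D)))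
        = - (E *\<^sub>R (?B * ?B)) + (E * (2 * s)) *\<^sub>R (?B * ?D) - (E * (s * s)) *\<^sub>R (?D * ?D)"
      by (simp only: sq) (simp add: scaleR_add_right scaleR_diff_right)
    then show ?thesis
      unfolding b_shift_def s_def[symmetric] E by (simp add: E_def)
  qed
  then have "(LINT x|lborel. (\<Sum>\<mu>\<in>UNIV.
     b \<mu> x * (\<kappa> *\<^sub>R divh \<mu> x) - (\<epsilon> / 2 * \<kappa>\<^sup>2) *\<^sub>R (b \<mu> x * (sg \<mu> *\<^sub>R b \<mu> x))))
    = (LINT x|lborel. ?Q x + (1 / (2 * \<epsilon>)) *\<^sub>R (\<Sum>\<mu>\<in>UNIV. sg \<mu> *\<^sub>R (divh \<mu> x * divh \<mu> x)))"
    by (simp only: sum.distrib scaleR_sum_right)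
  also have "\<dots> = integral\<^sup>L lborel ?Q + (1 / (2 * \<epsilon>)) *\<^sub>R (\<Sum>\<mu>\<in>UNIV. sg \<mu> *\<^sub>R (LINT x|lborel. divh \<mu> x * divh \<mu> x))"
    by (subst Bochner_Integration.integral_add[OF Q]) (simp_all add: D)
  finally show ?thesis .
qed

end

section \<open>Ghost terms in momentum space and the Gaussian integral over b\<close>

context field_config
begin

theorem A_gh_mint:
  "A_gh sg \<phi> \<kappa> = \<kappa> powi (4 - int CARD('n)) *\<^sub>R mint (\<lambda>p. \<Sum>\<mu>\<in>UNIV. \<Sum>\<nu>\<in>UNIV.
     (- psq sg p * eta sg \<mu> \<nu>) *\<^sub>R ((sg \<nu> *\<^sub>R mode J (cb \<nu>) (- p)) * mode J (c \<mu>) p))"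
proof -
  let ?m = "\<lambda>\<mu> p. mode J (cb \<mu>) (- p) * mode J (c \<mu>) p"
  \<comment> \<open>Raising the antighost index costs a factor \<open>sg\<close>, which squares to 1
    against the one from \<open>eta\<close>.\<close>
  have "(\<Sum>\<nu>\<in>UNIV. (- psq sg p * eta sg \<mu> \<nu>) *\<^sub>R ((sg \<nu> *\<^sub>R mode J (cb \<nu>) (- p)) * mode J (c \<mu>) p))
      = (\<Sum>\<nu>\<in>UNIV. (- sg \<nu>) *\<^sub>R ((p $ \<nu> * p $ \<nu>) *\<^sub>R ?m \<mu> p))" for \<mu> p
  proof -
    have "(\<Sum>\<nu>\<in>UNIV. (- psq sg p * eta sg \<mu> \<nu>) *\<^sub>R ((sg \<nu> *\<^sub>R mode J (cb \<nu>) (- p)) * mode J (c \<mu>) p))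
      = (\<Sum>\<nu>\<in>UNIV. eta sg \<mu> \<nu> *\<^sub>R ((- psq sg p * sg \<nu>) *\<^sub>R (mode J (cb \<nu>) (- p) * mode J (c \<mu>) p)))"
      by (simp add: mult_ac)
    also have "\<dots> = (sg \<mu> * sg \<mu>) *\<^sub>R ((- psq sg p) *\<^sub>R ?m \<mu> p)"
      unfolding eta_sum by (simp add: mult_ac)
    finally show ?thesis
      by (simp add: sg_sq psq_def scaleR_sum_left sum_negf mult.assoc)
  qed
  moreover have "integrable lborel (\<lambda>p. (p $ \<nu> * p $ \<nu>) *\<^sub>R ?m \<mu> p)" for \<mu> \<nu>
    using mode_multiplier_momenta schwartz_fields unfolding mode_multiplier_def by blast
  ultimately have "mint (\<lambda>p. \<Sum>\<mu>\<in>UNIV. \<Sum>\<nu>\<in>UNIV.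
     (- psq sg p * eta sg \<mu> \<nu>) *\<^sub>R ((sg \<nu> *\<^sub>R mode J (cb \<nu>) (- p)) * mode J (c \<mu>) p))
      = (\<Sum>\<mu>\<in>UNIV. \<Sum>\<nu>\<in>UNIV. (- sg \<nu>) *\<^sub>R mint (\<lambda>p. (p $ \<nu> * p $ \<nu>) *\<^sub>R ?m \<mu> p))"
    by (simp only:) (simp add: mint_sum mint_scaleR del: scaleR_scaleR scaleR_minus_left)
  then show ?thesis
    unfolding A_gh_eq ghost_kinetic_def parseval_pd[OF schwartz_fields(3,2)] by (simp add: sum_negf)
qed

lemma trilinear_momenta:
  "mode J f k * mode J (pd a (cb \<beta>)) p2 * mode J (pd b (c \<alpha>)) p1
     = - (p2 $ a * p1 $ b) *\<^sub>R (mode J f k * mode J (cb \<beta>) p2 * mode J (c \<alpha>) p1)"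
  "mode J f k * mode J (pd a (pd b (cb \<beta>))) p2 * mode J (c \<alpha>) p1
     = - (p2 $ a * p2 $ b) *\<^sub>R (mode J f k * mode J (cb \<beta>) p2 * mode J (c \<alpha>) p1)"
proof -
  have JJ: "J * (J * x) = - x" for x
    by (simp add: mult.assoc[symmetric] J_square)
  have JJ': "x * (J * y) * (J * z) = - (x * y * z)" for x y z
    by (simp only: J_left_commute[of x y] mult.assoc[of J] J_left_commute[of "x * y" z] JJ)
  show "mode J f k * mode J (pd a (cb \<beta>)) p2 * mode J (pd b (c \<alpha>)) p1
     = - (p2 $ a * p1 $ b) *\<^sub>R (mode J f k * mode J (cb \<beta>) p2 * mode J (c \<alpha>) p1)"
    by (simp add: mode_pd schwartz_fields JJ' mult.commute)
  show "mode J f k * mode J (pd a (pd b (cb \<beta>))) p2 * mode J (c \<alpha>) p1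
     = - (p2 $ a * p2 $ b) *\<^sub>R (mode J f k * mode J (cb \<beta>) p2 * mode J (c \<alpha>) p1)"
    by (simp add: mode_pd schwartz_fields schwartz_pd JJ)
qed

text \<open>Every vertex carries two derivatives, each acting on modes as J times the momentum of
  its field. Their product J J = -1 is the overall minus sign, which the momentum-space formula
  displayed at the top does not show.\<close>

theorem A_gh_h_mint:
  "A_gh_h \<phi> \<kappa> = mint_delta (\<lambda>k p1 p2.
     \<Sum>\<mu>\<in>UNIV. \<Sum>\<nu>\<in>UNIV. \<Sum>\<alpha>\<in>UNIV. \<Sum>\<beta>\<in>UNIV.
       (- (\<kappa> powi (5 - int CARD('n))) *
          (p2 $ \<alpha> * p1 $ \<nu> * of_bool (\<beta> = \<mu>)
           + p2 $ \<mu> * p1 $ \<nu> * of_bool (\<beta> = \<alpha>)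
           + p2 $ \<alpha> * p2 $ \<mu> * of_bool (\<beta> = \<nu>))) *\<^sub>R
       (mode J (h \<mu> \<nu>) k * mode J (cb \<beta>) p2 * mode J (c \<alpha>) p1))"
proof -
  let ?T = "\<lambda>f g e k p1 p2. mode J f k * mode J g p2 * mode J e p1"
  let ?K = "\<kappa> powi (5 - int CARD('n))"
  have distrib: "(- K * (u * A + v * B + w * C)) *\<^sub>R x
      = K *\<^sub>R (A *\<^sub>R (- u *\<^sub>R x) + B *\<^sub>R (- v *\<^sub>R x) + C *\<^sub>R (- w *\<^sub>R x))"
    for K u v w A B C :: real and x :: 'a
    by (simp add: algebra_simps)
  have "(- ?K * (p2 $ \<alpha> * p1 $ \<nu> * of_bool (\<beta> = \<mu>) + p2 $ \<mu> * p1 $ \<nu> * of_bool (\<beta> = \<alpha>)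
           + p2 $ \<alpha> * p2 $ \<mu> * of_bool (\<beta> = \<nu>))) *\<^sub>R ?T (h \<mu> \<nu>) (cb \<beta>) (c \<alpha>) k p1 p2
    = ?K *\<^sub>R (of_bool (\<beta> = \<mu>) *\<^sub>R ?T (h \<mu> \<nu>) (pd \<alpha> (cb \<beta>)) (pd \<nu> (c \<alpha>)) k p1 p2
        + of_bool (\<beta> = \<alpha>) *\<^sub>R ?T (h \<mu> \<nu>) (pd \<mu> (cb \<beta>)) (pd \<nu> (c \<alpha>)) k p1 p2
        + of_bool (\<beta> = \<nu>) *\<^sub>R ?T (h \<mu> \<nu>) (pd \<alpha> (pd \<mu> (cb \<beta>))) (c \<alpha>) k p1 p2)" for k p1 p2 \<mu> \<nu> \<alpha> \<beta>
    unfolding trilinear_momenta by (rule distrib)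
  moreover have T: "delta_integrable (?T f g e)" "mint_delta (?T f g e) = (LINT x|lborel. f x * (g x * e x))"
    if "schwartz f" "schwartz g" "schwartz e" for f g e :: "real^'n \<Rightarrow> 'a"
    using delta_integrable_modes[OF that] by (simp_all add: mult.assoc)
  ultimately show ?thesis
    unfolding A_gh_h_eq vertex1_def vertex2_def vertex3_def
    by (simp only: T schwartz_fields schwartz_pd delta_integrable_sum delta_integrable_add
        delta_integrable_scaleR sum.distrib scaleR_sum_right[symmetric] of_bool_sum)
qed

text \<open>Even values commute with everything, integration preserves this, and J is central; so
  the exponent of the Gaussian is central.\<close>

lemma b_gauss_commute:
  assumes "b \<in> b_space Ev"
  shows "J * (k *\<^sub>R (LINT x|lborel. r *\<^sub>R (\<Sum>\<mu>\<in>UNIV. b \<mu> x * (sg \<mu> *\<^sub>R b \<mu> x)))) * y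
    = y * (J * (k *\<^sub>R (LINT x|lborel. r *\<^sub>R (\<Sum>\<mu>\<in>UNIV. b \<mu> x * (sg \<mu> *\<^sub>R b \<mu> x)))))"
proof -
  have b: "schwartz (b \<mu>)" "b \<mu> x \<in> Ev" for \<mu> x
    using assms unfolding b_space_def by blast+
  have E: "subspace Ev" "\<And>a b. a \<in> Ev \<Longrightarrow> b \<in> Ev \<Longrightarrow> a * b \<in> Ev"
    using super unfolding superalgebra_def by blast+
  let ?I = "LINT x|lborel. r *\<^sub>R (\<Sum>\<mu>\<in>UNIV. b \<mu> x * (sg \<mu> *\<^sub>R b \<mu> x))"
  have "?I * z = z * ?I" for z
    by (intro integral_commute schwartz_intros b Ev_commute subspace_scale subspace_sum E)
  then have "(J * ?I) * y = y * (J * ?I)"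
    by (simp only: J_left_commute mult.assoc)
  then show ?thesis
    by (simp only: mult_scaleR_right mult_scaleR_left)
qed

theorem b_integration:
  assumes \<kappa>: "\<kappa> \<noteq> 0" and \<epsilon>: "\<epsilon> \<noteq> 0" and gauss: "gaussian_b_integral sg Ev J \<kappa> \<epsilon> Db"
  shows "fint Db (b_space Ev) (\<lambda>b. exp (J * A_CR sg \<phi> J \<kappa> + J * A_gf sg \<tau> \<phi> b \<kappa> \<epsilon>))
    = exp (J * A_hh_gf sg \<phi> J \<kappa> \<epsilon> + J * A_BB sg \<phi> \<kappa> + J * A_hhh sg \<phi> \<kappa>
             + J * A_Bhh sg \<phi> \<kappa> + J * A_BBh sg \<phi> \<kappa> + J * A_gh sg \<phi> \<kappa> + J * A_gh_h \<phi> \<kappa>)"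
    (is "_ = exp ?Z")
proof -
  note G = gauss[unfolded gaussian_b_integral_def]
  let ?f = "b_shift \<kappa> \<epsilon>"
  let ?K = "\<kappa> powi (4 - int CARD('n))"
  have "exp (J * A_CR sg \<phi> J \<kappa> + J * A_gf sg \<tau> \<phi> b \<kappa> \<epsilon>) = exp ?Z * b_gauss sg J \<kappa> \<epsilon> (\<lambda>\<mu> x. b \<mu> x - ?f \<mu> x)"
    if b: "b \<in> b_space Ev" for b
  proof -
    let ?u = "\<lambda>\<mu> x. b \<mu> x - ?f \<mu> x"
    let ?Q = "LINT x|lborel. (- (\<epsilon> / 2) * \<kappa>\<^sup>2) *\<^sub>R (\<Sum>\<mu>\<in>UNIV. ?u \<mu> x * (sg \<mu> *\<^sub>R ?u \<mu> x))"
    have "subspace Ev"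
      using super unfolding superalgebra_def by blast
    moreover have "schwartz (e \<mu>)" "e \<mu> x \<in> Ev" if "e \<in> b_space Ev" for e \<mu> x
      using that unfolding b_space_def by blast+
    ultimately have u: "?u \<in> b_space Ev"
      using b b_shift_space[of \<kappa> \<epsilon>] by (simp add: b_space_def schwartz_diff subspace_diff image_subset_iff)
    have S: "hh_form \<phi> J (gf_ker sg) = (\<Sum>\<mu>\<in>UNIV. sg \<mu> *\<^sub>R (LINT x|lborel. divh \<mu> x * divh \<mu> x))"
      unfolding divh_def by (rule hh_form_gf_ker[OF schwartz_fields(1) h_sym])
    \<comment> \<open>The remainder of the completed square is exactly what distinguishes
      \<open>A_hh_gf\<close> from \<open>A_hh\<close>, so adding \<open>A_CR\<close> replaces the
      one by the other.\<close>
    have "A_gf sg \<tau> \<phi> b \<kappa> \<epsilon> = ?K *\<^sub>R ?Q + (A_hh_gf sg \<phi> J \<kappa> \<epsilon> - A_hh sg \<phi> J \<kappa>) + A_gh sg \<phi> \<kappa> + A_gh_h \<phi> \<kappa>"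
      unfolding A_gf_eq[OF \<kappa> b] complete_square[OF \<kappa> \<epsilon> b] A_hh_gf_def S[symmetric]
      by (simp add: scaleR_add_right scaleR_diff_right)
    then have "J * A_CR sg \<phi> J \<kappa> + J * A_gf sg \<tau> \<phi> b \<kappa> \<epsilon> = ?Z + J * (?K *\<^sub>R ?Q)"
      by (simp only: A_CR_def distrib_left right_diff_distrib) (simp only: algebra_simps)
    moreover have "?Z * (J * (?K *\<^sub>R ?Q)) = J * (?K *\<^sub>R ?Q) * ?Z"
      by (rule b_gauss_commute[OF u, symmetric])
    ultimately show ?thesis
      unfolding b_gauss_def by (simp only: exp_add_commuting)
  qed
  then have "fint Db (b_space Ev) (\<lambda>b. exp (J * A_CR sg \<phi> J \<kappa> + J * A_gf sg \<tau> \<phi> b \<kappa> \<epsilon>))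
      = fint Db (b_space Ev) (\<lambda>b. exp ?Z * b_gauss sg J \<kappa> \<epsilon> (\<lambda>\<mu> x. b \<mu> x - ?f \<mu> x))"
    by (intro arg_cong[of _ _ Db] restrict_ext)
  \<comment> \<open>The three formal rules in turn: pull out the factor independent of b, shift by
    \<open>?f\<close>, normalise the pure Gaussian to 1.\<close>
  also have "\<dots> = exp ?Z * 1"
    by (simp only: G[THEN conjunct1, rule_format, OF b_shift_space]
        G[THEN conjunct2, THEN conjunct1, rule_format, OF b_shift_space] G[THEN conjunct2, THEN conjunct2])
  finally show ?thesis by simp
qed

end

theorem theorem19:
  fixes sg :: "'n::finite \<Rightarrow> real"
    and \<kappa> \<epsilon> :: real
    and Ev Od :: "'a::{real_normed_algebra_1,banach,second_countable_topology} set"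
    and J :: 'a
    and \<tau> :: "'n \<Rightarrow> 'n \<Rightarrow> 'n \<Rightarrow> 'n dpoly"
    and D :: "(('a, 'n) fields \<Rightarrow> 'a) \<Rightarrow> 'z"
    and Db :: "(('n \<Rightarrow> real^'n \<Rightarrow> 'a) \<Rightarrow> 'a) \<Rightarrow> 'a"
  assumes dim: "CARD('n) > 2"
    and metric: "\<And>\<mu>. sg \<mu> = 1 \<or> sg \<mu> = - 1"
    and coupling: "\<kappa> \<noteq> 0"
    and gauge_parameter: "\<epsilon> \<noteq> 0"
    and grassmann: "superalgebra Ev Od J"
    and gaussian: "gaussian_b_integral sg Ev J \<kappa> \<epsilon> Db"
  shows "(fint D (field_space Ev Od) (\<lambda>\<phi>. fint Db (b_space Ev) (\<lambda>b.
        exp (J * A_CR sg \<phi> J \<kappa> + J * A_gf sg \<tau> \<phi> b \<kappa> \<epsilon>)))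
     = fint D (field_space Ev Od) (\<lambda>\<phi>.
        exp (J * A_hh_gf sg \<phi> J \<kappa> \<epsilon> + J * A_BB sg \<phi> \<kappa> + J * A_hhh sg \<phi> \<kappa>
             + J * A_Bhh sg \<phi> \<kappa> + J * A_BBh sg \<phi> \<kappa> + J * A_gh sg \<phi> \<kappa> + J * A_gh_h \<phi> \<kappa>)))
     \<and> (\<forall>\<phi>\<in>field_space Ev Od.
       A_hh_gf sg \<phi> J \<kappa> \<epsilon> = hh_form \<phi> J (\<lambda>p \<mu>1 \<nu>1 \<mu>2 \<nu>2. 1/2 * Peps sg \<kappa> \<epsilon> p \<mu>1 \<nu>1 \<mu>2 \<nu>2))
     \<and> (\<forall>p \<mu> \<nu> \<alpha> \<beta>. psq sg p \<noteq> 0 \<longrightarrow>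
       Peps sg \<kappa> \<epsilon> p \<mu> \<nu> \<alpha> \<beta> = \<kappa> powi (4 - int CARD('n)) * psq sg p *
         ((real CARD('n) - 5) / (real CARD('n) - 2) * NP0 sg p \<mu> \<nu> \<alpha> \<beta>
          + 1 / (2 * \<epsilon>) * NP1 sg p \<mu> \<nu> \<alpha> \<beta>
          + NP2 sg p \<mu> \<nu> \<alpha> \<beta>
          - ((real CARD('n) - 1) / (real CARD('n) - 2) - 1 / \<epsilon>) * NP0bar sg p \<mu> \<nu> \<alpha> \<beta>
          - 1 / (real CARD('n) - 2) * NP0barbar sg p \<mu> \<nu> \<alpha> \<beta>))
     \<and> (\<forall>p. psq sg p \<noteq> 0 \<longrightarrow>
       inverse_op sg (Peps sg \<kappa> \<epsilon> p) (\<lambda>\<mu> \<nu> \<alpha> \<beta>. \<kappa> powi (int CARD('n) - 4) * (1 / psq sg p) *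
         ((- 2 + 3 * \<epsilon>) * NP0 sg p \<mu> \<nu> \<alpha> \<beta>
          + 2 * \<epsilon> * NP1 sg p \<mu> \<nu> \<alpha> \<beta>
          + NP2 sg p \<mu> \<nu> \<alpha> \<beta>
          + \<epsilon> * NP0bar sg p \<mu> \<nu> \<alpha> \<beta>
          - \<epsilon> * NP0barbar sg p \<mu> \<nu> \<alpha> \<beta>)))
     \<and> (\<forall>\<phi>\<in>field_space Ev Od.
       A_gh sg \<phi> \<kappa> = \<kappa> powi (4 - int CARD('n)) *\<^sub>R mint (\<lambda>p. \<Sum>\<mu>\<in>UNIV. \<Sum>\<nu>\<in>UNIV.
         (- psq sg p * eta sg \<mu> \<nu>) *\<^sub>R ((sg \<nu> *\<^sub>R mode J (cbf \<phi> \<nu>) (- p)) * mode J (cf \<phi> \<mu>) p)))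
     \<and> (\<forall>\<phi>\<in>(field_space Ev Od :: ('a, 'n) fields set).
       A_gh_h \<phi> \<kappa> = mint_delta (\<lambda>k p1 p2.
         \<Sum>\<mu>\<in>UNIV. \<Sum>\<nu>\<in>UNIV. \<Sum>\<alpha>\<in>UNIV. \<Sum>\<beta>\<in>UNIV.
           (- (\<kappa> powi (5 - int CARD('n))) *
              (p2 $ \<alpha> * p1 $ \<nu> * of_bool (\<beta> = \<mu>)
               + p2 $ \<mu> * p1 $ \<nu> * of_bool (\<beta> = \<alpha>)
               + p2 $ \<alpha> * p2 $ \<mu> * of_bool (\<beta> = \<nu>))) *\<^sub>R
           (mode J (hf \<phi> \<mu> \<nu>) k * mode J (cbf \<phi> \<beta>) p2 * mode J (cf \<phi> \<alpha>) p1)))"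
proof -
  have config: "field_config J Ev Od sg \<phi>" if "\<phi> \<in> field_space Ev Od" for \<phi>
    by (intro field_config.intro field_config_axioms.intro superalgebra_imaginary_unit[OF grassmann]
        grassmann that metric)
  have proj: "projectors sg p" if "psq sg p \<noteq> 0" for p
    using metric that by unfold_locales
  show ?thesis
  proof (intro conjI ballI allI impI)
    fix \<phi> :: "('a, 'n) fields" assume \<phi>: "\<phi> \<in> field_space Ev Od"
    interpret field_config J Ev Od sg \<phi> by (rule config[OF \<phi>])
    show "A_hh_gf sg \<phi> J \<kappa> \<epsilon> = hh_form \<phi> J (\<lambda>p \<mu>1 \<nu>1 \<mu>2 \<nu>2. 1/2 * Peps sg \<kappa> \<epsilon> p \<mu>1 \<nu>1 \<mu>2 \<nu>2)"
      by (rule A_hh_gf_eq[OF schwartz_fields(1)])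
  qed (intro arg_cong[of _ _ D] restrict_ext field_config.b_integration[OF config]
      projectors.Peps_Nieuwenhuizen[OF proj] projectors.Peps_inverse[OF proj]
      field_config.A_gh_mint[OF config] field_config.A_gh_h_mint[OF config]
      coupling gauge_parameter gaussian dim; assumption)+
qed

end
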